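(* Let $m\in\{1,\dots,d\}$ and let $\mathbf{S}(n)=\sum_{i=1}^n\mathbf{Y}_i$, $\mathbf{S}(0)=0$, be a random walk in $\mathbb{R}^d$ with i.i.d. steps such that $\mu=\mathbb{E}[\mathbf{Y}_1]\neq0$ and $\mathbb{E}\bigl[\|\mathbf{Y}_1\|^{\max(2,mp)}\bigr]<\infty$ for some $p>1$. Let $\{\bar e_1,\dots,\bar e_d\}$ be an orthonormal basis of $\mathbb{R}^d$ with $\bar e_1=\mu/\|\mu\|$, let $D_n=\mathrm{diag}(1/n,1/\sqrt n,\dots,1/\sqrt n)\in\mathbb{R}^{d\times d}$, and $\widetilde{\mathbf{X}}(t)=\bigl(\|\mu\|t,\langle\mathbf{X}(t),\bar e_2\rangle,\dots,\langle\mathbf{X}(t),\bar e_d\rangle\bigr)$, $t\ge0$, where $\{\mathbf{X}(t)\}_{t\ge0}$ is the (zero-drift) Brownian motion in $\mathbb{R}^d$ arising as the limit $(\mathbf{S}(n)-n\mu)/\sqrt n\xrightarrow{\mathcal{D}}\mathbf{X}(1)$. Then $$\mathbb{E}\bigl[V_m\bigl(\mathrm{conv}\,\widetilde{\mathbf{X}}[0,1]\bigr)\bigr]<\infty$$ and $$\lim_{n\to\infty}\mathbb{E}\Bigl[V_m\Bigl(D_n\bigl(\mathrm{conv}\{\mathbf{S}(0),\ldots,\mathbf{S}(n)\}\bigr)\Bigr)\Bigr]=\mathbb{E}\bigl[V_m\bigl(\mathrm{conv}\,\widetilde{\mathbf{X}}[0,1]\bigr)\bigr].$$ In particular (case $m=d$),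 $$\lim_{n\to\infty}\frac{\mathbb{E}\bigl[V_d\bigl(\mathrm{conv}\{\mathbf{S}(0),\ldots,\mathbf{S}(n)\}\bigr)\bigr]}{n^{(d+1)/2}}=\mathbb{E}\bigl[V_d\bigl(\mathrm{conv}\,\widetilde{\mathbf{X}}[0,1]\bigr)\bigr].$$
   Context: $\mathbf{X}$ is a continuous centered Brownian motion with covariance of $\mathbf{X}(1)$ equal to the covariance matrix of $\mathbf{Y}_1$. $\mathrm{conv}$ is the convex hull, $\widetilde{\mathbf{X}}[0,1]=\mathrm{cl}\{\widetilde{\mathbf{X}}(t):t\in[0,1]\}$, and $D_n(A)=\{D_nx:x\in A\}$. Intrinsic volumes $V_0(A),\dots,V_d(A)$ of a convex body $A\subset\mathbb{R}^d$ are defined by the Steiner formula $\mathrm{Vol}_d(A+\rho B^d)=\sum_{m=0}^d\rho^{d-m}\kappa_{d-m}V_m(A)$, $\rho\ge0$, where $B^d$ is the closed unit ball and $\kappa_d=\mathrm{Vol}_d(B^d)$; in particular $V_d$ is $d$-dimensional Lebesgue measure. *)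

theory Defs
  imports "HOL-Probability.Probability"
begin

text \<open>Intrinsic volumes as the coefficients of the Steiner polynomial. Since
  \<open>\<kappa>\<^sub>j = unit_ball_vol (real j)\<close> is positive, the Steiner formula determines
  \<open>V\<^sub>0, \<dots>, V\<^sub>d\<close>; the requirement that \<open>V\<close> vanishes beyond the dimension only makes
  the description on all of \<open>nat\<close> unique. The value is meaningful for convex bodies only.\<close>

definition steiner_coefficients :: "'a::euclidean_space set \<Rightarrow> (nat \<Rightarrow> real) \<Rightarrow> bool" where
  "steiner_coefficients A V \<longleftrightarrow>
     (\<forall>k>DIM('a). V k = 0) \<and>
     (\<forall>\<rho>\<ge>0. measure lebesgue {x + \<rho> *\<^sub>R y | x y. x \<in> A \<and> y \<in> cball 0 1} =
        (\<Sum>k\<le>DIM('a). \<rho> ^ (DIM('a) - k) * unit_ball_vol (real (DIM('a) - k)) * V k))"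

definition intrinsic_volume :: "nat \<Rightarrow> 'a::euclidean_space set \<Rightarrow> real" where
  "intrinsic_volume m A = (THE V. steiner_coefficients A V) m"

definition covariance_matrix :: "'w measure \<Rightarrow> ('w \<Rightarrow> real ^ 'n) \<Rightarrow> real ^ 'n ^ 'n" where
  "covariance_matrix M Z =
     (\<chi> i j. \<integral>\<omega>. (Z \<omega> - integral\<^sup>L M Z) $ i * (Z \<omega> - integral\<^sup>L M Z) $ j \<partial>M)"

text \<open>The centered normal law on the line with variance \<open>v\<close>; the point mass at \<open>0\<close> if \<open>v = 0\<close>.\<close>

definition centered_normal :: "real \<Rightarrow> real measure" where
  "centered_normal v =
     (if v = 0 then return borel 0 else density lborel (normal_density 0 (sqrt v)))"

text \<open>A random vector is centered Gaussian with a (possibly singular) covariance matrix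
  \<open>C\<close> if all its one-dimensional projections are.\<close>

definition centered_gaussian ::
  "'w measure \<Rightarrow> real ^ 'n ^ 'n \<Rightarrow> ('w \<Rightarrow> real ^ 'n) \<Rightarrow> bool" where
  "centered_gaussian N C Z \<longleftrightarrow>
     Z \<in> borel_measurable N \<and>
     (\<forall>u. distr N borel (\<lambda>\<omega>. u \<bullet> Z \<omega>) = centered_normal (u \<bullet> (C *v u)))"

text \<open>A centered Brownian motion, indexed by \<open>t \<ge> 0\<close>, with all paths continuous and with
  \<open>C\<close> the covariance matrix of its value at time \<open>1\<close>.\<close>

definition brownian_motion ::
  "'w measure \<Rightarrow> real ^ 'n ^ 'n \<Rightarrow> (real \<Rightarrow> 'w \<Rightarrow> real ^ 'n) \<Rightarrow> bool" where
  "brownian_motion N C X \<longleftrightarrow>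
     prob_space N \<and>
     (\<forall>t\<ge>0. X t \<in> borel_measurable N) \<and>
     (AE \<omega> in N. X 0 \<omega> = 0) \<and>
     (\<forall>\<omega>\<in>space N. continuous_on {0..} (\<lambda>t. X t \<omega>)) \<and>
     (\<forall>(k::nat) t. 0 \<le> t 0 \<and> (\<forall>i<k. t i \<le> t (Suc i)) \<longrightarrow>
        prob_space.indep_vars N (\<lambda>_. borel)
          (\<lambda>i \<omega>. X (t (Suc i)) \<omega> - X (t i) \<omega>) {..<k}) \<and>
     (\<forall>s t. 0 \<le> s \<and> s < t \<longrightarrow>
        centered_gaussian N ((t - s) *\<^sub>R C) (\<lambda>\<omega>. X t \<omega> - X s \<omega>))"

definition orthonormal_basis :: "('n \<Rightarrow> real ^ 'n) \<Rightarrow> bool" where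
  "orthonormal_basis e \<longleftrightarrow> (\<forall>i j. e i \<bullet> e j = (if i = j then 1 else 0))"

definition coordinates :: "('n \<Rightarrow> real ^ 'n) \<Rightarrow> real ^ 'n \<Rightarrow> real ^ 'n" where
  "coordinates e x = (\<chi> i. x \<bullet> e i)"

text \<open>In the following two definitions the index \<open>a\<close> plays the role of the first coordinate.\<close>

definition scaling_matrix :: "'n \<Rightarrow> nat \<Rightarrow> real ^ 'n ^ 'n" where
  "scaling_matrix a n =
     (\<chi> i j. if i = j then (if i = a then 1 / real n else 1 / sqrt (real n)) else 0)"

definition drift_process ::
  "'n \<Rightarrow> ('n \<Rightarrow> real ^ 'n) \<Rightarrow> real ^ 'n \<Rightarrow> (real \<Rightarrow> 'w \<Rightarrow> real ^ 'n) \<Rightarrow> real \<Rightarrow> 'w \<Rightarrow> real ^ 'n" where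
  "drift_process a e \<mu> X t \<omega> = (\<chi> i. if i = a then norm \<mu> * t else X t \<omega> \<bullet> e i)"

definition random_walk :: "(nat \<Rightarrow> 'w \<Rightarrow> real ^ 'n) \<Rightarrow> nat \<Rightarrow> 'w \<Rightarrow> real ^ 'n" where
  "random_walk Y n \<omega> = (\<Sum>i=1..n. Y i \<omega>)"

definition walk_hull :: "(nat \<Rightarrow> 'w \<Rightarrow> real ^ 'n) \<Rightarrow> nat \<Rightarrow> 'w \<Rightarrow> (real ^ 'n) set" where
  "walk_hull Y n \<omega> = convex hull ((\<lambda>k. random_walk Y k \<omega>) ` {0..n})"

text \<open>The matrix \<open>D\<^sub>n\<close> acts on coordinate vectors with respect to the orthonormal basis
  \<open>e\<close>, whose vector \<open>e a\<close> points in the direction of the drift.\<close>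

definition scaled_walk_hull ::
  "'n \<Rightarrow> ('n \<Rightarrow> real ^ 'n) \<Rightarrow> (nat \<Rightarrow> 'w \<Rightarrow> real ^ 'n) \<Rightarrow> nat \<Rightarrow> 'w \<Rightarrow> (real ^ 'n) set" where
  "scaled_walk_hull a e Y n \<omega> =
     (\<lambda>x. scaling_matrix a n *v coordinates e x) ` walk_hull Y n \<omega>"

definition limit_hull ::
  "'n \<Rightarrow> ('n \<Rightarrow> real ^ 'n) \<Rightarrow> real ^ 'n \<Rightarrow> (real \<Rightarrow> 'w \<Rightarrow> real ^ 'n) \<Rightarrow> 'w \<Rightarrow> (real ^ 'n) set" where
  "limit_hull a e \<mu> X \<omega> =
     convex hull (closure ((\<lambda>t. drift_process a e \<mu> X t \<omega>) ` {0..1}))"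

end

theory Submission
  imports Defs
begin

text \<open>The Steiner formula for a polytope follows by sorting the points of the parallel body according
  to the face that contains their nearest point; compact convex sets are handled by approximation.
  Since the coefficients of a polynomial are linear in its values at \<open>0, \<dots>, d\<close>, the functional
  \<open>V\<^sub>m\<close> is homogeneous of degree \<open>m\<close>, bounded by \<open>C R\<^sup>m\<close> on the ball of radius \<open>R\<close>, and Lipschitz there
  in the Hausdorff distance with constant \<open>C R\<^sup>m\<^sup>-\<^sup>1\<close>.

  Hence \<open>V\<^sub>m\<close> of the rescaled hull is close to \<open>V\<^sub>m\<close> of the hull of the walk at \<open>J + 1\<close> equidistant times
  as soon as the walk does not oscillate between these times. Ottaviani's inequality reduces the
  oscillation to the increments over the \<open>J\<close> blocks, which converge jointly to the increments of the
  Brownian motion by the central limit theorem, and these are small by path continuity. This gives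
  weak convergence of the volumes. A maximal moment inequality of order \<open>max 2 (m * p) > m\<close>
  makes them uniformly integrable; the integrability of the limit comes from the same bound, so that no
  moments of Brownian motion are needed.\<close>

section \<open>Parallel bodies\<close>

text \<open>\<open>intrinsic_volume\<close> selects the Steiner coefficients by description, so a
  polynomial has to be produced before any property can be stated. Afterwards each estimate is made
  on volumes of parallel bodies at finitely many radii.

  \<open>D_n\<close> divides the drift direction by \<open>n\<close>, while the fluctuations there
  are only of order \<open>sqrt n\<close>. They disappear in the limit and the coordinate
  \<open>a\<close> turns into deterministic time: a rescaled walk point is a space-time point plus a
  small error.

  Only finite-dimensional laws are compared. The number \<open>J\<close> of blocks is fixed first,
  then \<open>n\<close> grows, and \<open>J\<close> is chosen beforehand so large that both the walk
  and the Brownian path are close to their grids. Bounded 1-Lipschitz test functions suffice, since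
  the passage to expectations uses truncations of the identity.

  The exponent in the moment condition comes from the bound \<open>C R^m\<close>: a moment of order
  \<open>q > m\<close> of the radius is a moment of order \<open>q / m > 1\<close> of the volume.
  Centering the steps gives the walk after \<open>n\<close> steps a \<open>q\<close>-th moment of
  order \<open>n^(q/2)\<close>, which the normalisation by \<open>sqrt n\<close> compensates
  exactly.\<close>

definition parallel_body :: "'a::euclidean_space set \<Rightarrow> real \<Rightarrow> 'a set" where
  "parallel_body A r = {x. infdist x A \<le> r}"

text \<open>Closedness makes the distance to \<open>A\<close> attained, so that a point at distance
  exactly \<open>r\<close> is still a sum. This links the Minkowski sum of the Steiner formula to
  the distance function, for which closedness and monotonicity are immediate.\<close>

lemma parallel_body_eq_Minkowski:
  assumes "closed A" "A \<noteq> {}" "r \<ge> 0"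
  shows "{x + r *\<^sub>R y | x y. x \<in> A \<and> y \<in> cball 0 1} = parallel_body A r"
proof (intro set_eqI iffI)
  fix z assume "z \<in> {x + r *\<^sub>R y | x y. x \<in> A \<and> y \<in> cball 0 1}"
  then obtain x y where xy: "z = x + r *\<^sub>R y" "x \<in> A" "norm y \<le> 1" by auto
  have "infdist z A \<le> dist z x" using xy by (auto intro: infdist_le)
  also have "\<dots> \<le> r" using xy assms by (simp add: dist_norm mult_left_le)
  finally show "z \<in> parallel_body A r" by (simp add: parallel_body_def)
next
  fix z assume z: "z \<in> parallel_body A r"
  obtain q where q: "q \<in> A" "infdist z A = dist z q"
    using infdist_attains_inf[OF assms(1,2)] by blast
  have d: "norm (z - q) \<le> r" using z q by (simp add: parallel_body_def dist_norm)
  show "z \<in> {x + r *\<^sub>R y | x y. x \<in> A \<and> y \<in> cball 0 1}"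
  proof (cases "r = 0")
    case True
    then show ?thesis using q d by (auto intro!: exI[of _ q] exI[of _ "0::'a"])
  next
    case False
    then have "r > 0" using assms by simp
    then have "z = q + r *\<^sub>R ((1 / r) *\<^sub>R (z - q))" "(1 / r) *\<^sub>R (z - q) \<in> cball 0 1"
      using d by (auto simp: divide_simps)
    then show ?thesis using q by blast
  qed
qed

lemma closed_parallel_body: "closed (parallel_body A r)"
proof -
  have "continuous_on UNIV (\<lambda>x. infdist x A)" by (intro continuous_intros)
  then show ?thesis unfolding parallel_body_def by (intro closed_Collect_le continuous_intros)
qed

lemma parallel_body_mono: "r \<le> s \<Longrightarrow> parallel_body A r \<subseteq> parallel_body A s"
  by (auto simp: parallel_body_def)

lemma parallel_body_mono_set: "A \<noteq> {} \<Longrightarrow> A \<subseteq> B \<Longrightarrow> parallel_body A r \<subseteq> parallel_body B r"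
  using infdist_mono unfolding parallel_body_def by (metis (mono_tags, lifting) Collect_mono order_trans)

text \<open>The distance function is 1-Lipschitz. This is how a one-sided Hausdorff bound on bodies
  becomes an inclusion of parallel bodies with a shifted radius.\<close>

lemma parallel_body_parallel_body:
  assumes "closed A" "A \<noteq> {}" "K \<subseteq> parallel_body A r" "K \<noteq> {}"
  shows "parallel_body K s \<subseteq> parallel_body A (s + r)"
proof
  fix x assume x: "x \<in> parallel_body K s"
  have "infdist x A \<le> infdist x K + r"
  proof (rule ccontr)
    assume "\<not> infdist x A \<le> infdist x K + r"
    then have "infdist x K < infdist x A - r" by simp
    then obtain k where k: "k \<in> K" "dist x k < infdist x A - r"
      using assms(4) by (auto simp: infdist_def cINF_less_iff split: if_splits)
    have "infdist x A \<le> infdist k A + dist x k" by (rule infdist_triangle)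
    moreover have "infdist k A \<le> r" using k assms(3) by (auto simp: parallel_body_def)
    ultimately show False using k by simp
  qed
  then show "x \<in> parallel_body A (s + r)" using x by (simp add: parallel_body_def)
qed

lemma parallel_body_cball:
  assumes "A \<subseteq> cball 0 R" "A \<noteq> {}" "r \<ge> 0"
  shows "parallel_body A r \<subseteq> cball 0 (R + r)"
proof
  fix x assume x: "x \<in> parallel_body A r"
  show "x \<in> cball 0 (R + r)"
  proof (rule ccontr)
    assume "x \<notin> cball 0 (R + r)"
    then have "infdist x A < norm x - R" using x by (simp add: parallel_body_def)
    then obtain k where k: "k \<in> A" "dist x k < norm x - R"
      using assms(2) by (auto simp: infdist_def cINF_less_iff split: if_splits)
    have "norm k \<le> R" using k assms by auto
    then show False using k norm_triangle_sub[of x k] by (simp add: dist_norm)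
  qed
qed

lemma parallel_body_0:
  assumes "closed A" "A \<noteq> {}"
  shows "parallel_body A 0 = A"
  using in_closed_iff_infdist_zero[OF assms] infdist_nonneg[of _ A]
  by (auto simp: parallel_body_def intro: antisym)

lemma compact_parallel_body:
  assumes "bounded A" "A \<noteq> {}"
  shows "compact (parallel_body A r)"
proof -
  obtain R where "A \<subseteq> cball 0 R" using assms(1) by (metis bounded_iff subsetI mem_cball_0)
  then have "parallel_body A r \<subseteq> cball 0 (R + max r 0)"
    using parallel_body_cball[of A R "max r 0"] parallel_body_mono[of r "max r 0" A] assms(2) by auto
  then show ?thesis
    using closed_parallel_body bounded_subset[OF bounded_cball] by (auto simp: compact_eq_bounded_closed)
qed

section \<open>Linear images and Lebesgue measure\<close>

text \<open>Uniqueness of Haar measure: for two translation invariant measures \<open>\<nu>\<close> and \<open>\<lambda>\<close> and a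
  symmetric set \<open>B\<close>, computing the measure of \<open>{(x, y). x + y \<in> A, y \<in> B}\<close> in both orders gives
  \<open>\<nu> A * \<lambda> B = \<lambda> A * \<nu> B\<close>.\<close>

lemma lborel_linear_image_proportional:
  fixes f :: "'a::euclidean_space \<Rightarrow> 'a"
  assumes f: "linear f" "inj f" and A: "A \<in> sets borel"
  shows "f ` A \<in> sets borel"
    "emeasure lborel (f ` A) * emeasure lborel (ball (0::'a) 1) =
     emeasure lborel A * emeasure lborel (f ` ball 0 1)"
proof -
  obtain g where g: "linear g" "g \<circ> f = id" "f \<circ> g = id"
    using linear_injective_isomorphism[OF f] by (auto simp: fun_eq_iff)
  have [measurable]: "f \<in> borel_measurable borel" "g \<in> borel_measurable borel"
    using f(1) g(1) by (auto intro!: borel_measurable_continuous_onI linear_continuous_on simp: linear_conv_bounded_linear)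
  have img: "f ` X = g -` X" for X
    using g(2,3) by (auto simp: fun_eq_iff) (metis image_eqI)
  have meas: "f ` X \<in> sets borel" if "X \<in> sets borel" for X
    unfolding img using measurable_sets[OF \<open>g \<in> borel_measurable borel\<close> that] by simp
  show "f ` A \<in> sets borel" using meas[OF A] .
  \<comment> \<open>The measure sending \<open>X\<close> to the volume of \<open>f(X)\<close>,
    written as a push-forward under the inverse \<open>g\<close>; its translation invariance then
    follows from that of \<open>lborel\<close>.\<close>
  define \<nu> where "\<nu> = distr lborel borel g"
  have [simp, measurable_cong]: "sets \<nu> = sets borel" by (simp add: \<nu>_def)
  have [simp]: "space \<nu> = UNIV" by (simp add: \<nu>_def)
  have nu: "emeasure \<nu> X = emeasure lborel (f ` X)" if "X \<in> sets borel" for X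
    using that by (simp add: \<nu>_def emeasure_distr img)
  interpret nu: sigma_finite_measure \<nu>
  proof
    show "\<exists>A. countable A \<and> A \<subseteq> sets \<nu> \<and> \<Union> A = space \<nu> \<and> (\<forall>a\<in>A. emeasure \<nu> a \<noteq> \<infinity>)"
    proof (intro exI conjI)
      show "countable (range (\<lambda>n::nat. cball (0::'a) n))" by simp
      show "range (\<lambda>n::nat. cball (0::'a) n) \<subseteq> sets \<nu>" by auto
      show "\<Union> (range (\<lambda>n::nat. cball (0::'a) n)) = space \<nu>" by (auto intro: real_arch_simple)
      have "emeasure lborel (f ` cball 0 (real n)) < \<infinity>" for n
        using f by (intro emeasure_bounded_finite bounded_linear_image) (auto simp: linear_conv_bounded_linear)
      then show "\<forall>a\<in>range (\<lambda>n::nat. cball (0::'a) n). emeasure \<nu> a \<noteq> \<infinity>"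
        by (auto simp: nu less_top)
    qed
  qed
  interpret P: pair_sigma_finite lborel \<nu> ..
  have trans: "distr \<nu> borel (\<lambda>x. x + t) = \<nu>" for t
  proof -
    have "distr \<nu> borel (\<lambda>x. x + t) = distr lborel borel (\<lambda>x. g x + t)"
      unfolding \<nu>_def by (simp add: distr_distr comp_def)
    also have "(\<lambda>x. g x + t) = (\<lambda>x. g (f t + x))"
      using g by (auto simp: fun_eq_iff linear_add)
    also have "distr lborel borel (\<lambda>x. g (f t + x)) = distr (distr lborel borel ((+) (f t))) borel g"
      by (subst distr_distr) (auto simp: comp_def)
    also have "\<dots> = \<nu>" by (simp only: lborel_distr_plus \<nu>_def)
    finally show ?thesis .
  qed
  have transl: "distr lborel borel (\<lambda>x. x + t) = lborel" for t :: 'a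
    using lborel_distr_plus[of t] by (simp add: add.commute[of _ t])
  define B where "B = ball (0::'a) 1"
  have [measurable]: "A \<in> sets borel" "B \<in> sets borel" using A by (auto simp: B_def)
  have "emeasure \<nu> A * emeasure lborel B =
      (\<integral>\<^sup>+y. (\<integral>\<^sup>+x. indicator A (x + y) * indicator B y \<partial>\<nu>) \<partial>lborel)"
  proof -
    have "(\<integral>\<^sup>+x. indicator A (x + y) * indicator B y \<partial>\<nu>) = emeasure \<nu> A * indicator B y" for y
    proof -
      have "(\<integral>\<^sup>+x. indicator A (x + y) \<partial>\<nu>) = (\<integral>\<^sup>+x. indicator A x \<partial>distr \<nu> borel (\<lambda>x. x + y))"
        by (subst nn_integral_distr) auto
      then show ?thesis by (simp add: nn_integral_multc trans)
    qed
    then show ?thesis by (simp add: nn_integral_cmult)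
  qed
  also have "\<dots> = (\<integral>\<^sup>+x. (\<integral>\<^sup>+y. indicator A (x + y) * indicator B y \<partial>lborel) \<partial>\<nu>)"
    by (subst P.Fubini'[symmetric]) simp_all
  \<comment> \<open>Substitute \<open>y - x\<close> for \<open>y\<close>; the ball is symmetric, so
    the factor may be written with \<open>x - y\<close>, ready for translation in \<open>x\<close>
    after the next exchange of integrals.\<close>
  also have "\<dots> = (\<integral>\<^sup>+x. (\<integral>\<^sup>+y. indicator A y * indicator B (x - y) \<partial>lborel) \<partial>\<nu>)"
  proof (rule nn_integral_cong)
    fix x :: 'a
    have "(\<integral>\<^sup>+y. indicator A (x + y) * indicator B y \<partial>lborel) =
        (\<integral>\<^sup>+y. indicator A (y + x) * indicator B (x - (y + x)) \<partial>lborel)"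
      by (intro nn_integral_cong) (auto simp: B_def indicator_def add.commute)
    also have "\<dots> = (\<integral>\<^sup>+y. indicator A y * indicator B (x - y) \<partial>distr lborel borel (\<lambda>y. y + x))"
      by (subst nn_integral_distr) auto
    finally show "(\<integral>\<^sup>+y. indicator A (x + y) * indicator B y \<partial>lborel) =
        (\<integral>\<^sup>+y. indicator A y * indicator B (x - y) \<partial>lborel)" by (simp add: transl)
  qed
  also have "\<dots> = (\<integral>\<^sup>+y. (\<integral>\<^sup>+x. indicator A y * indicator B (x - y) \<partial>\<nu>) \<partial>lborel)"
    by (subst P.Fubini') simp_all
  also have "\<dots> = emeasure lborel A * emeasure \<nu> B"
  proof -
    have "(\<integral>\<^sup>+x. indicator A y * indicator B (x - y) \<partial>\<nu>) = emeasure \<nu> B * indicator A y" for y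
    proof -
      have "(\<integral>\<^sup>+x. indicator B (x - y) \<partial>\<nu>) = (\<integral>\<^sup>+x. indicator B x \<partial>distr \<nu> borel (\<lambda>x. x + (- y)))"
        by (subst nn_integral_distr) auto
      then have "(\<integral>\<^sup>+x. indicator B (x - y) \<partial>\<nu>) = emeasure \<nu> B"
        unfolding trans by simp
      then show ?thesis by (subst nn_integral_cmult) (auto simp: mult.commute)
    qed
    then show ?thesis by (simp add: nn_integral_multc mult.commute)
  qed
  finally show "emeasure lborel (f ` A) * emeasure lborel (ball (0::'a) 1) =
     emeasure lborel A * emeasure lborel (f ` ball 0 1)"
    by (simp add: nu B_def)
qed

text \<open>The factor is the volume ratio between the image of the unit ball and the ball itself.
  It is positive because an injective linear map sends the open ball to a nonempty open set.\<close>

lemma lborel_linear_image: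
  fixes f :: "'a::euclidean_space \<Rightarrow> 'a"
  assumes f: "linear f" "inj f"
  obtains c where "c > 0" "\<And>A. A \<in> sets borel \<Longrightarrow> measure lborel (f ` A) = c * measure lborel A"
proof -
  have fin: "emeasure lborel (f ` ball 0 1) < \<infinity>" "emeasure lborel (ball (0::'a) 1) < \<infinity>"
    using f unfolding linear_conv_bounded_linear
    by (intro emeasure_bounded_finite bounded_linear_image bounded_ball; simp)+
  have op: "open (f ` ball 0 1)" using f open_ball
    by (intro open_surjective_linear_image) (auto simp: linear_injective_imp_surjective)
  have pos: "measure lborel U > 0" if "open U" "U \<noteq> {}" "emeasure lborel U < \<infinity>" for U :: "'a set"
  proof -
    have "\<not> negligible U" using that open_not_negligible by blast
    then have "emeasure lebesgue U \<noteq> 0"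
      using that by (auto simp: negligible_iff_emeasure0)
    then have "emeasure lborel U \<noteq> 0" using that by simp
    then show ?thesis using that by (simp add: measure_def enn2real_positive_iff zero_less_iff_neq_zero)
  qed
  let ?c = "measure lborel (f ` ball 0 1) / measure lborel (ball (0::'a) 1)"
  have p: "measure lborel (ball (0::'a) 1) > 0" "measure lborel (f ` ball 0 1) > 0"
    by (intro pos; use fin op in auto)+
  show thesis
  proof (rule that[of ?c])
    show "?c > 0" using p by simp
    fix A :: "'a set" assume "A \<in> sets borel"
    from lborel_linear_image_proportional(2)[OF f this]
    have "measure lborel (f ` A) * measure lborel (ball (0::'a) 1) =
      measure lborel A * measure lborel (f ` ball 0 1)"
      unfolding measure_def by (metis enn2real_mult)
    then show "measure lborel (f ` A) = ?c * measure lborel A" using p by (simp add: field_simps)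
  qed
qed

text \<open>An isometry maps the unit ball onto itself, which forces the constant of
  \<open>lborel_linear_image\<close> to be 1.\<close>

lemma lborel_isometric_image:
  fixes f :: "'a::euclidean_space \<Rightarrow> 'a"
  assumes f: "linear f" "\<And>x. norm (f x) = norm x" and A: "A \<in> sets borel"
  shows "measure lborel (f ` A) = measure lborel A"
proof -
  have inj: "inj f" using f linear_injective_0 by (metis norm_eq_zero)
  have "f ` ball 0 1 = ball 0 1"
  proof (intro set_eqI iffI)
    fix y assume "y \<in> ball (0::'a) 1"
    moreover obtain x where "f x = y" using linear_injective_imp_surjective[OF f(1) inj] by (metis surjD)
    ultimately show "y \<in> f ` ball 0 1" using f(2)[of x] by (intro image_eqI[of _ _ x]) auto
  qed (auto simp: f)
  moreover obtain c where "c > 0" "\<And>A. A \<in> sets borel \<Longrightarrow> measure lborel (f ` A) = c * measure lborel A"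
    using lborel_linear_image[OF f(1) inj] by blast
  moreover have "measure lborel (ball (0::'a) 1) > 0"
    using content_ball_pos[of 1 "0::'a"] by simp
  ultimately show ?thesis using A by (metis borel_open mult_cancel_right1 less_irrefl open_ball)
qed

lemma lborel_diagonal_image:
  fixes c :: "'a::euclidean_space \<Rightarrow> real"
  assumes c: "\<And>b. b \<in> Basis \<Longrightarrow> c b > 0" and A: "A \<in> sets borel"
  shows "measure lborel ((\<lambda>x. \<Sum>b\<in>Basis. (c b * (x \<bullet> b)) *\<^sub>R b) ` A) = (\<Prod>b\<in>Basis. c b) * measure lborel A"
proof -
  let ?f = "\<lambda>x. \<Sum>b\<in>Basis. (c b * (x \<bullet> b)) *\<^sub>R b"
  let ?g = "\<lambda>x. \<Sum>b\<in>Basis. ((1 / c b) * (x \<bullet> b)) *\<^sub>R b"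
  have gf: "?g (?f x) = x" "?f (?g x) = x" for x
  proof -
    have "c b \<noteq> 0" if "b \<in> Basis" for b using c[OF that] by simp
    then show "?g (?f x) = x" "?f (?g x) = x"
      by (auto intro!: euclidean_eqI[where 'a='a] simp: inner_sum_left inner_Basis if_distrib cong: if_cong)
  qed
  have [measurable]: "?g \<in> borel_measurable borel" "?f \<in> borel_measurable borel" by measurable
  have img: "?f ` A = ?g -` A"
  proof (intro set_eqI iffI)
    fix y assume "y \<in> ?g -` A"
    then show "y \<in> ?f ` A" using gf(2)[of y] by (intro image_eqI[of y ?f "?g y"]) (simp_all only: vimage_eq)
  next
    fix y assume "y \<in> ?f ` A"
    then obtain x where "x \<in> A" "y = ?f x" by blast
    then show "y \<in> ?g -` A" using gf(1)[of x] by (simp only: vimage_eq)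
  qed
  have B: "?f ` A \<in> sets borel"
    unfolding img using measurable_sets[OF \<open>?g \<in> borel_measurable borel\<close> A] by simp
  have "emeasure lborel (?f ` A) =
      emeasure (density (distr lborel borel (\<lambda>x. 0 + ?f x)) (\<lambda>_. ennreal (\<Prod>b\<in>Basis. \<bar>c b\<bar>))) (?f ` A)"
    using lborel_affine_euclidean[of c 0] c by fastforce
  also have "\<dots> = (\<Prod>b\<in>Basis. \<bar>c b\<bar>) * emeasure (distr lborel borel (\<lambda>x. 0 + ?f x)) (?f ` A)"
    using B by (simp add: emeasure_density nn_integral_cmult)
  also have "emeasure (distr lborel borel (\<lambda>x. 0 + ?f x)) (?f ` A) = emeasure lborel (?f -` (?f ` A))"
    using B by (simp add: emeasure_distr)
  also have "?f -` (?f ` A) = A"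
    by (rule inj_vimage_image_eq, rule inj_on_inverseI[of _ ?g], rule gf(1))
  finally have "emeasure lborel (?f ` A) = (\<Prod>b\<in>Basis. \<bar>c b\<bar>) * emeasure lborel A" .
  moreover have "(\<Prod>b\<in>Basis. \<bar>c b\<bar>) = (\<Prod>b\<in>Basis. c b)"
    using c by (intro prod.cong) (auto simp: less_imp_le)
  moreover have "(\<Prod>b\<in>Basis. c b) \<ge> 0" using c by (intro prod_nonneg) (auto simp: less_imp_le)
  ultimately show ?thesis
    by (simp add: measure_def enn2real_mult)
qed

text \<open>In a basis adapted to \<open>S\<close> and its orthogonal complement the map is
  diagonal, with entries 1 and \<open>r\<close>. It is built as a conjugate \<open>U D W\<close>
  with \<open>W\<close> inverse to \<open>U\<close>, so that the volume factor of the change of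
  basis drops out and only the product of the diagonal entries remains.\<close>

lemma dilation_orthogonal_to_subspace:
  fixes S :: "'a::euclidean_space set" and r :: real
  assumes S: "subspace S" and r: "r > 0"
  obtains T where "linear T" "\<And>s. s \<in> S \<Longrightarrow> T s = s"
    "\<And>t. (\<And>s. s \<in> S \<Longrightarrow> t \<bullet> s = 0) \<Longrightarrow> T t = r *\<^sub>R t"
    "\<And>A. A \<in> sets borel \<Longrightarrow> measure lborel (T ` A) = r ^ (DIM('a) - dim S) * measure lborel A"
proof -
  define S' where "S' = {t. \<forall>s\<in>S. t \<bullet> s = 0}"
  have S': "subspace S'" unfolding S'_def by (auto simp: subspace_def inner_add_left)
  obtain B where B: "B \<subseteq> S" "pairwise orthogonal B" "\<And>x. x \<in> B \<Longrightarrow> norm x = 1"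
    "independent B" "card B = dim S" "span B = S"
    using orthonormal_basis_subspace[OF S] by metis
  obtain B' where B': "B' \<subseteq> S'" "pairwise orthogonal B'" "\<And>x. x \<in> B' \<Longrightarrow> norm x = 1"
    "independent B'" "card B' = dim S'" "span B' = S'"
    using orthonormal_basis_subspace[OF S'] by metis
  have fin: "finite B" "finite B'" using B B' independent_imp_finite by auto
  have disj: "B \<inter> B' = {}"
  proof (rule ccontr)
    assume "B \<inter> B' \<noteq> {}"
    then obtain x where "x \<in> B" "x \<in> B'" by auto
    then have "x \<in> S" "x \<in> S'" using B(1) B'(1) by auto
    then have "x \<bullet> x = 0" unfolding S'_def by blast
    then show False using B(3)[OF \<open>x \<in> B\<close>] by simp
  qed
  have decomp: "\<exists>s t. s \<in> S \<and> t \<in> S' \<and> x = s + t" for x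
  proof -
    obtain y z where "y \<in> span S" "\<And>w. w \<in> span S \<Longrightarrow> orthogonal z w" "x = y + z"
      using orthogonal_subspace_decomp_exists[of S x] by blast
    then show ?thesis using span_base[of _ S] S unfolding S'_def orthogonal_def
      by (intro exI[of _ y] exI[of _ z]) (simp add: span_eq_iff[THEN iffD2, OF S])
  qed
  have dim: "dim S + dim S' = DIM('a)"
  proof -
    have "span (B \<union> B') = UNIV"
    proof (intro set_eqI iffI UNIV_I)
      fix x :: 'a
      obtain s t where "s \<in> S" "t \<in> S'" "x = s + t" using decomp by blast
      then show "x \<in> span (B \<union> B')"
        using B(6) B'(6) by (auto intro!: span_add intro: span_mono[THEN subsetD])
    qed
    moreover have "independent (B \<union> B')"
    proof (rule pairwise_orthogonal_independent)
      show "pairwise orthogonal (B \<union> B')"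
      proof -
        have "orthogonal x y" "orthogonal y x" if "x \<in> B" "y \<in> B'" for x y
        proof -
          have "x \<in> S" "y \<in> S'" using that B(1) B'(1) by auto
          then have "y \<bullet> x = 0" unfolding S'_def by blast
          then show "orthogonal x y" "orthogonal y x" by (simp_all add: orthogonal_def inner_commute)
        qed
        then show ?thesis using B(2) B'(2) unfolding pairwise_def by blast
      qed
      show "0 \<notin> B \<union> B'" using B(3) B'(3) by force
    qed
    ultimately have "card (B \<union> B') = DIM('a)"
      using dim_eq_card[of "B \<union> B'" UNIV] by simp
    then show ?thesis using B B' fin disj by (simp add: card_Un_disjoint)
  qed
  then have "card (B \<union> B') = card (Basis :: 'a set)"
    using B B' fin disj by (simp add: card_Un_disjoint)
  then obtain g where g: "bij_betw g (Basis :: 'a set) (B \<union> B')"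
    using finite_same_card_bij[of "Basis :: 'a set" "B \<union> B'"] fin by auto
  define U where "U x = (\<Sum>b\<in>Basis. (x \<bullet> b) *\<^sub>R g b)" for x :: 'a
  have U: "linear U" unfolding U_def
    by (intro linearI) (simp_all add: inner_add_left scaleR_add_left sum.distrib scaleR_sum_right)
  have Ub: "U b = g b" if "b \<in> Basis" for b
    using that by (simp add: U_def inner_Basis if_distrib if_distribR sum.delta cong: if_cong)
  have "range U = UNIV"
  proof -
    have "B \<union> B' = g ` Basis" using g by (simp add: bij_betw_def)
    also have "\<dots> = U ` Basis" using Ub by simp
    finally have "B \<union> B' \<subseteq> range U" by blast
    then have "span (B \<union> B') \<subseteq> range U"
      by (intro span_minimal linear_subspace_image[OF U]) auto
    moreover have "x \<in> span (B \<union> B')" for x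
    proof -
      obtain s t where "s \<in> S" "t \<in> S'" "x = s + t" using decomp by blast
      then show ?thesis
        using B(6) B'(6) by (auto intro!: span_add intro: span_mono[THEN subsetD])
    qed
    ultimately show ?thesis by blast
  qed
  then have Uinj: "inj U" using linear_surjective_imp_injective[OF U] by simp
  define c where "c b = (if g b \<in> B then 1 else r)" for b
  define D where "D x = (\<Sum>b\<in>Basis. (c b * (x \<bullet> b)) *\<^sub>R b)" for x :: 'a
  have D: "linear D" unfolding D_def
    by (intro linearI) (simp_all add: inner_add_left scaleR_add_left sum.distrib scaleR_sum_right algebra_simps)
  have Db: "D b = c b *\<^sub>R b" if "b \<in> Basis" for b
    using that by (simp add: D_def inner_Basis if_distrib if_distribR sum.delta cong: if_cong)
  obtain W where W: "linear W" "W \<circ> U = id" "U \<circ> W = id"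
    using linear_injective_isomorphism[OF U Uinj] by (auto simp: fun_eq_iff)
  define T where "T = U \<circ> D \<circ> W"
  have T: "linear T" unfolding T_def by (intro linear_compose W U D)
  have Tg: "T (g b) = c b *\<^sub>R g b" if "b \<in> Basis" for b
  proof -
    have "W (g b) = b" using Ub[OF that] W(2) by (simp add: fun_eq_iff flip: Ub[OF that])
    then show ?thesis using that by (simp add: T_def Db linear_scale[OF U] Ub)
  qed
  have TB: "T x = x" if "x \<in> B" for x
  proof -
    have "x \<in> g ` Basis" using g that by (simp add: bij_betw_def)
    then obtain b where "b \<in> Basis" "x = g b" by blast
    then show ?thesis using Tg[of b] that by (simp add: c_def)
  qed
  have TB': "T x = r *\<^sub>R x" if "x \<in> B'" for x
  proof -
    have "x \<in> g ` Basis" using g that by (simp add: bij_betw_def)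
    then obtain b where "b \<in> Basis" "x = g b" by blast
    then show ?thesis using Tg[of b] that disj by (auto simp: c_def)
  qed
  show thesis
  proof (rule that[OF T])
    fix s assume "s \<in> S"
    then show "T s = s"
      using linear_eq_on_span[OF T linear_ident, of B s] TB B(6) by auto
  next
    fix t assume "\<And>s. s \<in> S \<Longrightarrow> t \<bullet> s = 0"
    then have "t \<in> span B'" using B'(6) by (auto simp: S'_def)
    moreover have "linear (\<lambda>x::'a. r *\<^sub>R x)" by (intro linearI) (simp_all add: scaleR_add_right)
    ultimately show "T t = r *\<^sub>R t"
      using linear_eq_on_span[OF T, of "\<lambda>x. r *\<^sub>R x" B' t] TB' by auto
  next
    fix A :: "'a set" assume A: "A \<in> sets borel"
    obtain k where k: "k > 0" "\<And>A. A \<in> sets borel \<Longrightarrow> measure lborel (U ` A) = k * measure lborel A"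
      using lborel_linear_image[OF U Uinj] by blast
    have Winj: "inj W" by (rule inj_on_inverseI[of _ U]) (use W(3) in \<open>simp add: fun_eq_iff\<close>)
    have WA: "W ` A \<in> sets borel" using lborel_linear_image_proportional(1)[OF W(1) Winj A] .
    have cpos: "c b > 0" for b using r by (simp add: c_def)
    have Dinj: "inj D"
    proof (rule linear_injective_on_subspace_0[OF D subspace_UNIV, THEN iffD2, rule_format])
      fix x assume "D x = 0"
      then have "D x \<bullet> b = 0" for b by simp
      then have "c b * (x \<bullet> b) = 0" if "b \<in> Basis" for b
        using that by (metis D_def inner_sum_left_Basis)
      then have "x \<bullet> b = 0" if "b \<in> Basis" for b using that cpos[of b] by fastforce
      then show "x = 0" using euclidean_all_zero_iff[of x] by blast
    qed
    have DWA: "D ` W ` A \<in> sets borel" using lborel_linear_image_proportional(1)[OF D Dinj WA] .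
    have UWA: "U ` W ` A = A" using W(3) by (simp add: image_comp)
    have "measure lborel (T ` A) = measure lborel (U ` D ` W ` A)"
      by (simp add: T_def image_comp comp_assoc)
    also have "\<dots> = k * ((\<Prod>b\<in>Basis. c b) * measure lborel (W ` A))"
      using k(2)[OF DWA] lborel_diagonal_image[of c, OF cpos WA] by (simp add: D_def[abs_def])
    \<comment> \<open>The factors of \<open>U\<close> and of its inverse \<open>W\<close>
      cancel.\<close>
    also have "k * measure lborel (W ` A) = measure lborel A"
      using k(2)[OF WA] UWA by simp
    then have "k * ((\<Prod>b\<in>Basis. c b) * measure lborel (W ` A)) = (\<Prod>b\<in>Basis. c b) * measure lborel A"
      by (simp add: mult.left_commute)
    also have "(\<Prod>b\<in>Basis. c b) = (\<Prod>x\<in>B \<union> B'. if x \<in> B then 1 else r)"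
      unfolding c_def using g by (rule prod.reindex_bij_betw)
    also have "\<dots> = r ^ card B'"
    proof -
      have "(\<Prod>x\<in>B'. if x \<in> B then 1 else r) = (\<Prod>x\<in>B'. r)" using disj by (intro prod.cong) auto
      then show ?thesis using fin disj by (simp add: prod.union_disjoint)
    qed
    also have "card B' = DIM('a) - dim S" using dim B' by simp
    finally show "measure lborel (T ` A) = r ^ (DIM('a) - dim S) * measure lborel A" .
  qed
qed

section \<open>The Steiner formula\<close>

text \<open>Take the smallest face containing \<open>x\<close>. Were \<open>x\<close> on its
  relative boundary, a facet of that face would contain \<open>x\<close> and be a strictly smaller
  face.\<close>

lemma mem_rel_interior_face_of_polytope:
  fixes P :: "'a::euclidean_space set"
  assumes P: "polytope P" and x: "x \<in> P"
  obtains F where "F face_of P" "x \<in> rel_interior F"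
proof -
  let ?M = "{F. F face_of P \<and> x \<in> F}"
  have "P face_of P" using P polytope_imp_convex face_of_refl by blast
  then have ne: "?M \<noteq> {}" using x by blast
  define F where "F = \<Inter> ?M"
  have F: "F face_of P" unfolding F_def by (rule face_of_Inter[OF ne]) auto
  have xF: "x \<in> F" by (simp add: F_def)
  have pF: "polyhedron F" using F P face_of_polytope_polytope polytope_imp_polyhedron by blast
  have "x \<in> rel_interior F"
  proof (rule ccontr)
    assume "x \<notin> rel_interior F"
    then have "x \<in> F - rel_interior F" using xF by simp
    then obtain G where G: "G facet_of F" "x \<in> G"
      using rel_boundary_of_polyhedron[OF pF] by auto
    then have "G face_of P" using F face_of_trans facet_of_imp_face_of by blast
    then have "F \<subseteq> G" using G by (auto simp: F_def)
    then show False using G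
      by (metis facet_of_imp_subset facet_of_irrefl subset_antisym)
  qed
  then show thesis using that F by blast
qed

text \<open>The obtuse angle criterion gives one sign. Since the nearest point lies in the relative
  interior of \<open>F\<close>, one can also move a little away from \<open>y\<close> without
  leaving \<open>F\<close>, and this gives the other sign.\<close>

lemma closest_point_orthogonal_face:
  assumes P: "closed P" "convex P" and F: "F \<subseteq> P" and q: "closest_point P x \<in> rel_interior F" and y: "y \<in> F"
  shows "(x - closest_point P x) \<bullet> (y - closest_point P x) = 0"
proof -
  let ?q = "closest_point P x"
  have qF: "?q \<in> F" using q rel_interior_subset by blast
  have le: "(x - ?q) \<bullet> (z - ?q) \<le> 0" if "z \<in> F" for z
    using closest_point_dot[OF P(2,1)] F that by blast
  obtain e where e: "e > 0" "cball ?q e \<inter> affine hull F \<subseteq> F"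
    using q by (auto simp: mem_rel_interior_cball)
  \<comment> \<open>Small enough for the point \<open>z\<close> beyond the nearest point to stay
    within distance \<open>e\<close>; the added 1 avoids a zero denominator.\<close>
  define t where "t = e / (1 + norm (y - ?q))"
  have t: "t > 0" "t * norm (y - ?q) \<le> e"
    using e by (auto simp: t_def divide_simps add_pos_nonneg intro!: mult_left_mono)
  define z where "z = ?q - t *\<^sub>R (y - ?q)"
  have "z = (1 + t) *\<^sub>R ?q + (- t) *\<^sub>R y" by (simp add: z_def algebra_simps)
  then have "z \<in> affine hull F"
    using mem_affine[OF affine_affine_hull, of ?q F y "1 + t" "- t"] qF y by (simp add: hull_inc)
  moreover have "z \<in> cball ?q e" using t by (simp add: z_def dist_norm)
  ultimately have "z \<in> F" using e by blast
  from le[OF this] have "t * ((x - ?q) \<bullet> (y - ?q)) \<ge> 0" by (simp add: z_def)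
  then have "(x - ?q) \<bullet> (y - ?q) \<ge> 0" using t by (simp add: zero_le_mult_iff)
  then show ?thesis using le[OF y] by simp
qed

lemma rel_interior_borel: "rel_interior S \<in> sets borel" for S :: "'a::euclidean_space set"
proof -
  have "openin (top_of_set (affine hull S)) (rel_interior S)" by (rule openin_rel_interior)
  then obtain U where "open U" "rel_interior S = affine hull S \<inter> U" by (auto simp: openin_open)
  then show ?thesis by (simp add: closed_affine_hull)
qed

lemma infdist_closest_point:
  fixes P :: "'a::euclidean_space set"
  assumes "closed P" "P \<noteq> {}"
  shows "infdist x P = dist x (closest_point P x)"
proof (rule antisym)
  show "infdist x P \<le> dist x (closest_point P x)"
    by (intro infdist_le closest_point_in_set assms)
  obtain q where "q \<in> P" "infdist x P = dist x q"
    using infdist_attains_inf[OF assms] by blast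
  then show "dist x (closest_point P x) \<le> infdist x P"
    using closest_point_le[OF assms(1)] by metis
qed

text \<open>The obtuse angle criterion is preserved when the normal vector is scaled by a
  nonnegative factor: the points with a given nearest point form a translated cone.\<close>

lemma closest_point_ray:
  fixes P :: "'a::euclidean_space set"
  assumes P: "closed P" "convex P" "P \<noteq> {}" and r: "r \<ge> 0"
  shows "closest_point P (closest_point P x + r *\<^sub>R (x - closest_point P x)) = closest_point P x"
proof -
  let ?q = "closest_point P x"
  have q: "?q \<in> P" using closest_point_in_set P by blast
  have "dist (?q + r *\<^sub>R (x - ?q)) ?q \<le> dist (?q + r *\<^sub>R (x - ?q)) z" if z: "z \<in> P" for z
  proof -
    have "(x - ?q) \<bullet> (z - ?q) \<le> 0" using closest_point_dot[OF P(2,1) z] .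
    then have "r * ((x - ?q) \<bullet> (z - ?q)) \<le> 0" using r by (simp add: mult_nonneg_nonpos)
    moreover have "(norm (r *\<^sub>R (x - ?q) - (z - ?q)))\<^sup>2 =
        (norm (r *\<^sub>R (x - ?q)))\<^sup>2 - 2 * (r * ((x - ?q) \<bullet> (z - ?q))) + (norm (z - ?q))\<^sup>2"
      unfolding power2_norm_eq_inner by (simp add: inner_diff_left inner_diff_right inner_commute algebra_simps)
    ultimately have "(norm (r *\<^sub>R (x - ?q)))\<^sup>2 \<le> (norm (r *\<^sub>R (x - ?q) - (z - ?q)))\<^sup>2"
      by (smt (verit) zero_le_power2)
    then have "norm (r *\<^sub>R (x - ?q)) \<le> norm (r *\<^sub>R (x - ?q) - (z - ?q))"
      by (rule power2_le_imp_le) simp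
    also have "r *\<^sub>R (x - ?q) - (z - ?q) = (?q + r *\<^sub>R (x - ?q)) - z" by simp
    finally show ?thesis by (simp add: dist_norm)
  qed
  then show ?thesis using closest_point_unique[OF P(2,1) q] by metis
qed

text \<open>The points of the parallel body at distance at most \<open>\<rho>\<close> whose nearest point lies in the relative
  interior of a face \<open>F\<close> are obtained from those for \<open>\<rho> = 1\<close> by the dilation by \<open>\<rho>\<close> orthogonal
  to \<open>F\<close>. This makes the volume of the piece a monomial in \<open>\<rho>\<close>.\<close>

lemma measure_face_piece:
  fixes P F :: "'a::euclidean_space set"
  assumes P: "closed P" "convex P" "bounded P" and F: "F \<subseteq> P" "F \<noteq> {}"
  obtains k where "k \<le> DIM('a)" "\<And>\<rho>. \<rho> \<ge> 0 \<Longrightarrow>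
    measure lborel {x. closest_point P x \<in> rel_interior F \<and> dist x (closest_point P x) \<le> \<rho>} =
    \<rho> ^ k * measure lborel {x. closest_point P x \<in> rel_interior F \<and> dist x (closest_point P x) \<le> 1}"
proof -
  let ?q = "closest_point P"
  define A where "A \<rho> = {x. ?q x \<in> rel_interior F \<and> dist x (?q x) \<le> \<rho>}" for \<rho> :: real
  have Pne: "P \<noteq> {}" using F by auto
  have [measurable]: "?q \<in> borel_measurable borel"
    by (intro borel_measurable_continuous_onI continuous_on_closest_point P Pne)
  have [measurable]: "rel_interior F \<in> sets borel" by (rule rel_interior_borel)
  have A[measurable]: "A \<rho> \<in> sets borel" for \<rho> unfolding A_def by measurable
  obtain q0 where q0: "q0 \<in> F" using F by auto
  \<comment> \<open>\<open>S\<close> is the direction space of the affine hull of \<open>F\<close>;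
    its codimension \<open>k\<close> becomes the exponent.\<close>
  define S where "S = span ((\<lambda>y. y - q0) ` F)"
  have S: "subspace S" by (simp add: S_def subspace_span)
  have inS: "y - q0 \<in> S" if "y \<in> F" for y using that by (auto simp: S_def intro: span_base)
  have riF: "y \<in> F" if "y \<in> rel_interior F" for y using that rel_interior_subset by blast
  have orth: "(x - ?q x) \<bullet> s = 0" if x: "?q x \<in> rel_interior F" and s: "s \<in> S" for x s
  proof -
    have "orthogonal (x - ?q x) s"
    proof (rule orthogonal_to_span[OF s[unfolded S_def]])
      fix y assume "y \<in> (\<lambda>y. y - q0) ` F"
      then obtain z where z: "z \<in> F" "y = z - q0" by auto
      have "(x - ?q x) \<bullet> (z - ?q x) = 0" "(x - ?q x) \<bullet> (q0 - ?q x) = 0"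
        using closest_point_orthogonal_face[OF P(1,2) F(1) x] z q0 by auto
      then show "orthogonal (x - ?q x) y" by (simp add: orthogonal_def z inner_diff_right)
    qed
    then show ?thesis by (simp add: orthogonal_def)
  qed
  define k where "k = DIM('a) - dim S"
  have main: "measure lborel (A \<rho>) = \<rho> ^ k * measure lborel (A 1)" if rho: "\<rho> \<ge> 0" for \<rho>
  proof (cases "k = 0")
    \<comment> \<open>A face of full dimension has no nonzero normal vectors: the piece consists of
      points of \<open>F\<close> itself and does not depend on the radius.\<close>
    case True
    then have "dim S = DIM('a)" using dim_subset_UNIV[of S] by (simp add: k_def)
    then have "S = UNIV" using S by (metis dim_eq_full span_eq_iff)
    then have d0: "dist x (?q x) = 0" if "?q x \<in> rel_interior F" for x
      using orth[OF that, of "x - ?q x"] by simp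
    have "dist x (?q x) \<le> \<rho> \<longleftrightarrow> dist x (?q x) \<le> 1" if "?q x \<in> rel_interior F" for x
      unfolding d0[OF that] using rho by simp
    then have "A \<rho> = A 1" unfolding A_def by blast
    then show ?thesis using True by simp
  next
    case False
    show ?thesis
    proof (cases "\<rho> = 0")
      \<comment> \<open>At radius 0 the dilation degenerates. The piece is contained in an affine
        subspace of positive codimension, so both sides vanish.\<close>
      case True
      have "A 0 \<subseteq> (+) q0 ` S"
      proof
        fix x assume "x \<in> A 0"
        then have "x \<in> F" using riF by (auto simp: A_def)
        then show "x \<in> (+) q0 ` S" using inS[of x] by (intro image_eqI[of _ _ "x - q0"]) auto
      qed
      moreover have "negligible ((+) q0 ` S)"
        using negligible_lowdim[of S] False by (simp add: negligible_translation k_def)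
      ultimately have "negligible (A 0)" using negligible_subset by blast
      then have "emeasure lebesgue (A 0) = 0" by (simp add: negligible_iff_emeasure0)
      then have "measure lborel (A 0) = 0" using A[of 0] by (simp add: measure_def)
      then show ?thesis using True False by simp
    next
      case False
      then have r: "\<rho> > 0" using rho by simp
      obtain T where T: "linear T" "\<And>s. s \<in> S \<Longrightarrow> T s = s"
        "\<And>t. (\<And>s. s \<in> S \<Longrightarrow> t \<bullet> s = 0) \<Longrightarrow> T t = \<rho> *\<^sub>R t"
        "\<And>A. A \<in> sets borel \<Longrightarrow> measure lborel (T ` A) = \<rho> ^ (DIM('a) - dim S) * measure lborel A"
        using dilation_orthogonal_to_subspace[OF S r] by blast
      \<comment> \<open>The tangential part \<open>?q x - q0\<close> is fixed and the normal part
        \<open>x - ?q x\<close> is stretched. Hence the dilation centred at \<open>q0\<close> moves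
        \<open>x\<close> along its own normal ray, whatever its nearest point in \<open>F\<close>
        is.\<close>
      have Tx: "q0 + T (x - q0) = ?q x + \<rho> *\<^sub>R (x - ?q x)" if x: "?q x \<in> rel_interior F" for x
      proof -
        have "T (x - q0) = T (?q x - q0) + T (x - ?q x)"
          using linear_add[OF T(1), of "?q x - q0" "x - ?q x"] by simp
        also have "T (?q x - q0) = ?q x - q0" by (rule T(2)[OF inS[OF riF[OF x]]])
        also have "T (x - ?q x) = \<rho> *\<^sub>R (x - ?q x)" by (rule T(3)[OF orth[OF x]])
        finally show ?thesis by simp
      qed
      have "A \<rho> = (\<lambda>x. q0 + T (x - q0)) ` A 1"
      proof (intro set_eqI iffI)
        fix z assume "z \<in> (\<lambda>x. q0 + T (x - q0)) ` A 1"
        then obtain x where "x \<in> A 1" "z = q0 + T (x - q0)" by blast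
        then have x: "?q x \<in> rel_interior F" "dist x (?q x) \<le> 1" "z = ?q x + \<rho> *\<^sub>R (x - ?q x)"
          using Tx[of x] by (simp_all add: A_def)
        have "?q z = ?q x" unfolding x(3) using closest_point_ray[OF P(1,2) Pne, of \<rho>] r by simp
        then show "z \<in> A \<rho>" using x r by (simp add: A_def dist_norm)
      next
        fix z assume z: "z \<in> A \<rho>"
        define x where "x = ?q z + (1 / \<rho>) *\<^sub>R (z - ?q z)"
        have qx: "?q x = ?q z" unfolding x_def using closest_point_ray[OF P(1,2) Pne, of "1/\<rho>"] r by simp
        have "x \<in> A 1" using z r by (simp add: A_def qx) (simp add: x_def dist_norm divide_simps)
        moreover have "z = q0 + T (x - q0)"
          using Tx[of x] z r by (simp add: qx A_def) (simp add: x_def)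
        ultimately show "z \<in> (\<lambda>x. q0 + T (x - q0)) ` A 1" by blast
      qed
      also have "\<dots> = (+) q0 ` T ` (+) (- q0) ` A 1" by (simp add: image_image)
      finally have eq: "A \<rho> = (+) q0 ` T ` (+) (- q0) ` A 1" .
      have b: "(+) (- q0) ` A 1 \<in> sets borel"
      proof -
        have "(+) (- q0) ` A 1 = (+) q0 -` A 1 \<inter> space borel"
          by (auto intro!: image_eqI[of _ _ "q0 + x" for x])
        also have "\<dots> \<in> sets borel" by (rule measurable_sets[OF _ A]) simp
        finally show ?thesis .
      qed
      have "(+) q0 -` A \<rho> = T ` (+) (- q0) ` A 1"
        unfolding eq by (rule inj_vimage_image_eq) simp
      moreover have "measure lborel (A \<rho>) = measure lborel ((+) q0 -` A \<rho>)"
        using A by (subst (1) lborel_distr_plus[of q0, symmetric]) (simp add: measure_distr)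
      ultimately have "measure lborel (A \<rho>) = \<rho> ^ k * measure lborel ((+) (- q0) ` A 1)"
        using T(4)[OF b] by (simp add: k_def)
      also have "measure lborel ((+) (- q0) ` A 1) = measure lborel (A 1)"
      proof -
        have "(+) (- q0) -` ((+) (- q0) ` A 1) = A 1" by (rule inj_vimage_image_eq) simp
        moreover have "measure lborel ((+) (- q0) ` A 1) = measure lborel ((+) (- q0) -` ((+) (- q0) ` A 1))"
          using b by (subst (1) lborel_distr_plus[of "- q0", symmetric]) (simp add: measure_distr)
        ultimately show ?thesis by simp
      qed
      finally show ?thesis .
    qed
  qed
  show thesis by (rule that[OF _ main[unfolded A_def]]) (simp add: k_def)
qed

text \<open>Relative interiors of distinct faces are disjoint and together cover the polytope, so
  the pieces of \<open>measure_face_piece\<close> form a finite partition. Pieces with the same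
  exponent are then collected into one coefficient.\<close>

lemma steiner_polynomial_polytope:
  fixes P :: "'a::euclidean_space set"
  assumes P: "polytope P" "P \<noteq> {}"
  obtains c where "\<And>\<rho>. \<rho> \<ge> 0 \<Longrightarrow> measure lborel (parallel_body P \<rho>) = (\<Sum>k\<le>DIM('a). c k * \<rho> ^ k)"
proof -
  have P': "closed P" "convex P" "bounded P"
    using P polytope_imp_closed polytope_imp_convex polytope_imp_bounded by auto
  let ?q = "closest_point P"
  define \<F> where "\<F> = {F. F face_of P \<and> F \<noteq> {}}"
  have fin: "finite \<F>" unfolding \<F>_def using finite_polytope_faces[OF P(1)] by (rule rev_finite_subset) auto
  define A where "A F \<rho> = {x. ?q x \<in> rel_interior F \<and> dist x (?q x) \<le> \<rho>}" for F and \<rho> :: real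
  have [measurable]: "?q \<in> borel_measurable borel"
    by (intro borel_measurable_continuous_onI continuous_on_closest_point P P')
  have A: "A F \<rho> \<in> sets borel" for F \<rho>
  proof -
    have [measurable]: "rel_interior F \<in> sets borel" by (rule rel_interior_borel)
    show ?thesis unfolding A_def by measurable
  qed
  have union: "parallel_body P \<rho> = (\<Union>F\<in>\<F>. A F \<rho>)" for \<rho>
  proof (intro set_eqI iffI)
    fix x assume x: "x \<in> parallel_body P \<rho>"
    have "?q x \<in> P" using P P' by (simp add: closest_point_in_set)
    then obtain F where F: "F face_of P" "?q x \<in> rel_interior F"
      using mem_rel_interior_face_of_polytope[OF P(1)] by blast
    then have "F \<in> \<F>" using rel_interior_subset by (auto simp: \<F>_def)
    then show "x \<in> (\<Union>F\<in>\<F>. A F \<rho>)" using F x infdist_closest_point[OF P'(1) P(2)]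
      by (auto simp: A_def parallel_body_def)
  qed (auto simp: A_def parallel_body_def infdist_closest_point[OF P'(1) P(2)])
  have disj: "disjoint_family_on (\<lambda>F. A F \<rho>) \<F>" for \<rho>
  proof (unfold disjoint_family_on_def, intro ballI impI)
    fix F G assume FG: "F \<in> \<F>" "G \<in> \<F>" "F \<noteq> G"
    then have "rel_interior F \<inter> rel_interior G = {}" using face_of_eq[of F P G] by (auto simp: \<F>_def)
    then show "A F \<rho> \<inter> A G \<rho> = {}" by (auto simp: A_def)
  qed
  have fm: "emeasure lborel (A F \<rho>) \<noteq> \<infinity>" if "F \<in> \<F>" for F \<rho>
  proof -
    have "A F \<rho> \<subseteq> parallel_body P \<rho>" unfolding union using that by blast
    then have "bounded (A F \<rho>)"
      using compact_imp_bounded[OF compact_parallel_body[OF P'(3) P(2)]] by (rule bounded_subset[rotated])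
    then show ?thesis using emeasure_bounded_finite[of "A F \<rho>"] by simp
  qed
  have sum: "measure lborel (parallel_body P \<rho>) = (\<Sum>F\<in>\<F>. measure lborel (A F \<rho>))" for \<rho>
    unfolding union using A fm by (intro measure_finite_Union fin disj) auto
  have "\<exists>k. k \<le> DIM('a) \<and> (\<forall>\<rho>\<ge>0. measure lborel (A F \<rho>) = \<rho> ^ k * measure lborel (A F 1))"
    if "F \<in> \<F>" for F
  proof -
    have F: "F \<subseteq> P" "F \<noteq> {}" using that face_of_imp_subset by (auto simp: \<F>_def)
    obtain k where "k \<le> DIM('a)" "\<And>\<rho>. \<rho> \<ge> 0 \<Longrightarrow> measure lborel (A F \<rho>) = \<rho> ^ k * measure lborel (A F 1)"
      unfolding A_def using measure_face_piece[OF P' F] by blast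
    then show ?thesis by blast
  qed
  then have "\<exists>k. \<forall>F\<in>\<F>. k F \<le> DIM('a) \<and> (\<forall>\<rho>\<ge>0. measure lborel (A F \<rho>) = \<rho> ^ k F * measure lborel (A F 1))"
    by (intro bchoice ballI)
  then obtain k where k: "\<And>F. F \<in> \<F> \<Longrightarrow> k F \<le> DIM('a)"
    "\<And>F \<rho>. F \<in> \<F> \<Longrightarrow> \<rho> \<ge> 0 \<Longrightarrow> measure lborel (A F \<rho>) = \<rho> ^ k F * measure lborel (A F 1)"
    by blast
  show thesis
  proof (rule that)
    fix \<rho> :: real assume "\<rho> \<ge> 0"
    then have "measure lborel (parallel_body P \<rho>) = (\<Sum>F\<in>\<F>. \<rho> ^ k F * measure lborel (A F 1))"
      unfolding sum by (intro sum.cong refl k(2))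
    also have "\<dots> = (\<Sum>j\<in>{..DIM('a)}. \<Sum>F\<in>{F\<in>\<F>. k F = j}. \<rho> ^ k F * measure lborel (A F 1))"
      using k(1) fin by (intro sum.group[symmetric]) auto
    also have "\<dots> = (\<Sum>j\<le>DIM('a). (\<Sum>F\<in>{F\<in>\<F>. k F = j}. measure lborel (A F 1)) * \<rho> ^ j)"
      by (intro sum.cong refl) (simp add: sum_distrib_left mult.commute)
    finally show "measure lborel (parallel_body P \<rho>) =
      (\<Sum>j\<le>DIM('a). (\<Sum>F\<in>{F\<in>\<F>. k F = j}. measure lborel (A F 1)) * \<rho> ^ j)" .
  qed
qed

text \<open>Lagrange interpolation: \<open>\<Lambda>\<close> is the inverse Vandermonde matrix for
  the nodes \<open>0, ..., d\<close>. The order of quantifiers is the point, for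
  \<open>\<Lambda>\<close> depends on \<open>d\<close> alone and therefore carries uniform bounds
  and limits from values to coefficients.\<close>

lemma polynomial_coefficients_from_values:
  "\<exists>\<Lambda>::nat \<Rightarrow> nat \<Rightarrow> real. \<forall>c k. k \<le> d \<longrightarrow> c k = (\<Sum>j\<le>d. \<Lambda> k j * (\<Sum>i\<le>d. c i * real j ^ i))"
proof -
  define L where "L j = (\<Prod>l\<in>{..d} - {j}. smult (1 / (real j - real l)) [:- real l, 1:])" for j
  have Lval: "poly (L j) (real l) = (if l = j then 1 else 0)" if "j \<le> d" "l \<le> d" for j l
  proof -
    have "poly (L j) (real l) = (\<Prod>i\<in>{..d} - {j}. (real l - real i) / (real j - real i))"
      by (simp add: L_def poly_prod diff_divide_distrib)
    also have "\<dots> = (if l = j then 1 else 0)"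
    proof (cases "l = j")
      case True
      then show ?thesis by (simp add: prod.neutral)
    next
      case False
      then have "\<exists>i\<in>{..d} - {j}. (real l - real i) / (real j - real i) = 0"
        using that by (intro bexI[of _ l]) auto
      then show ?thesis using False by (simp add: prod_zero)
    qed
    finally show ?thesis .
  qed
  have Ldeg: "degree (L j) \<le> d" if "j \<le> d" for j
  proof -
    have "degree (L j) \<le> (\<Sum>l\<in>{..d} - {j}. degree (smult (1 / (real j - real l)) [:- real l, 1:]))"
      unfolding L_def using degree_prod_sum_le[of "{..d} - {j}" "\<lambda>l. smult (1 / (real j - real l)) [:- real l, 1:]"]
      by (simp add: comp_def)
    also have "\<dots> \<le> (\<Sum>l\<in>{..d} - {j}. 1)"
      by (intro sum_mono order_trans[OF degree_smult_le]) simp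
    also have "\<dots> = d" using that by simp
    finally show ?thesis .
  qed
  have "c k = (\<Sum>j\<le>d. coeff (L j) k * (\<Sum>i\<le>d. c i * real j ^ i))" if k: "k \<le> d" for c k
  proof -
    define p where "p = (\<Sum>i\<le>d. monom (c i) i)"
    have pval: "poly p x = (\<Sum>i\<le>d. c i * x ^ i)" for x by (simp add: p_def poly_sum poly_monom)
    define q where "q = (\<Sum>j\<le>d. smult (poly p (real j)) (L j))"
    \<comment> \<open>Two polynomials of degree at most \<open>d\<close> that agree at
      \<open>d + 1\<close> points.\<close>
    have "p = q"
    proof (rule poly_eqI_degree[of "real ` {..d}"])
      fix x assume "x \<in> real ` {..d}"
      then obtain l where l: "l \<le> d" "x = real l" by auto
      have "poly q x = (\<Sum>j\<le>d. if l = j then poly p (real j) else 0)"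
        unfolding q_def poly_sum poly_smult l using l by (intro sum.cong refl) (simp add: Lval)
      then show "poly p x = poly q x" using l by simp
    next
      have c: "card (real ` {..d}) = Suc d" by (subst card_image) (auto simp: inj_on_def)
      have "degree p \<le> d" unfolding p_def
        by (intro degree_sum_le) (auto intro: order_trans[OF degree_monom_le])
      then show "degree p < card (real ` {..d})" using c by simp
      have "degree q \<le> d" unfolding q_def
        by (intro degree_sum_le) (auto intro: order_trans[OF degree_smult_le] Ldeg)
      then show "degree q < card (real ` {..d})" using c by simp
    qed
    moreover have "coeff p k = c k" using k by (simp add: p_def coeff_sum)
    ultimately have "c k = coeff q k" by simp
    also have "\<dots> = (\<Sum>j\<le>d. coeff (L j) k * (\<Sum>i\<le>d. c i * real j ^ i))"
      by (simp add: q_def coeff_sum pval mult.commute)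
    finally show ?thesis .
  qed
  then show ?thesis by (intro exI[of _ "\<lambda>k j. coeff (L j) k"]) blast
qed

lemma measure_parallel_body_mono:
  assumes "parallel_body A r \<subseteq> parallel_body B s" "bounded B" "B \<noteq> {}"
  shows "measure lborel (parallel_body A r) \<le> measure lborel (parallel_body B s)"
  using assms closed_parallel_body[of A r]
  by (intro measure_mono_fmeasurable fmeasurable_compact compact_parallel_body) auto

text \<open>The hull of a finite \<open>e\<close>-net of \<open>K\<close>.\<close>

lemma polytope_approximation:
  fixes K :: "'a::euclidean_space set"
  assumes K: "compact K" "convex K" "K \<noteq> {}" and e: "e > 0"
  obtains P where "polytope P" "P \<noteq> {}" "P \<subseteq> K" "K \<subseteq> parallel_body P e"
proof -
  have "K \<subseteq> (\<Union>x\<in>K. ball x e)" using e by auto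
  then obtain F where F: "finite F" "F \<subseteq> K" "K \<subseteq> (\<Union>x\<in>F. ball x e)"
    by (rule compactE_image[OF K(1), of K "\<lambda>x. ball x e", rotated]) auto
  show thesis
  proof (rule that[of "convex hull F"])
    show "polytope (convex hull F)" using F by (auto simp: polytope_def)
    show "convex hull F \<noteq> {}" using F K by auto
    show "convex hull F \<subseteq> K" using F K by (simp add: hull_minimal)
    show "K \<subseteq> parallel_body (convex hull F) e"
    proof
      fix x assume "x \<in> K"
      then obtain y where y: "y \<in> F" "dist x y < e" using F by (auto simp: dist_commute)
      have "y \<in> convex hull F" using y(1) by (rule hull_inc)
      from infdist_le[OF this, of x] show "x \<in> parallel_body (convex hull F) e"
        using y by (simp add: parallel_body_def)
    qed
  qed
qed

text \<open>The polynomials of approximating polytopes have bounded coefficients, because these are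
  determined by their values at \<open>0, \<dots>, d\<close>. This yields convergence of the volumes of the
  parallel bodies without any continuity property of the volume.\<close>

lemma steiner_polynomial:
  fixes K :: "'a::euclidean_space set"
  assumes K: "compact K" "convex K" "K \<noteq> {}"
  obtains c where "\<And>\<rho>. \<rho> \<ge> 0 \<Longrightarrow> measure lborel (parallel_body K \<rho>) = (\<Sum>k\<le>DIM('a). c k * \<rho> ^ k)"
proof -
  define d where "d = DIM('a)"
  define f where "f \<rho> = measure lborel (parallel_body K \<rho>)" for \<rho>
  define \<epsilon> where "\<epsilon> n = inverse (real (Suc n))" for n
  have eps: "\<epsilon> n > 0" for n by (simp add: \<epsilon>_def)
  have "\<forall>n. \<exists>P. polytope P \<and> P \<noteq> {} \<and> P \<subseteq> K \<and> K \<subseteq> parallel_body P (\<epsilon> n)"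
  proof
    fix n
    show "\<exists>P. polytope P \<and> P \<noteq> {} \<and> P \<subseteq> K \<and> K \<subseteq> parallel_body P (\<epsilon> n)"
      by (rule polytope_approximation[OF K eps[of n]]) blast
  qed
  then obtain P where P: "\<And>n. polytope (P n)" "\<And>n. P n \<noteq> {}" "\<And>n. P n \<subseteq> K" "\<And>n. K \<subseteq> parallel_body (P n) (\<epsilon> n)"
    by metis
  have Pb: "closed (P n)" "bounded (P n)" for n
    using P(1) polytope_imp_closed polytope_imp_bounded by auto
  have "\<forall>n. \<exists>c. \<forall>\<rho>\<ge>0. measure lborel (parallel_body (P n) \<rho>) = (\<Sum>k\<le>d. c k * \<rho> ^ k)"
  proof
    fix n
    show "\<exists>c. \<forall>\<rho>\<ge>0. measure lborel (parallel_body (P n) \<rho>) = (\<Sum>k\<le>d. c k * \<rho> ^ k)"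
      unfolding d_def by (rule steiner_polynomial_polytope[OF P(1)[of n] P(2)[of n]]) blast
  qed
  then obtain c where c: "\<And>n \<rho>. \<rho> \<ge> 0 \<Longrightarrow> measure lborel (parallel_body (P n) \<rho>) = (\<Sum>k\<le>d. c n k * \<rho> ^ k)"
    by metis
  have lower: "(\<Sum>k\<le>d. c n k * \<rho> ^ k) \<le> f \<rho>" if "\<rho> \<ge> 0" for n \<rho>
    unfolding c[OF that, symmetric] f_def
    by (intro measure_parallel_body_mono parallel_body_mono_set P compact_imp_bounded K)
  have upper: "f \<rho> \<le> (\<Sum>k\<le>d. c n k * (\<rho> + \<epsilon> n) ^ k)" if "\<rho> \<ge> 0" for n \<rho>
    unfolding c[OF add_nonneg_nonneg[OF that less_imp_le[OF eps]], symmetric] f_def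
    by (intro measure_parallel_body_mono parallel_body_parallel_body P Pb K)
  obtain \<Lambda> :: "nat \<Rightarrow> nat \<Rightarrow> real" where
    L: "\<And>c k. k \<le> d \<Longrightarrow> c k = (\<Sum>j\<le>d. \<Lambda> k j * (\<Sum>i\<le>d. c i * real j ^ i))"
    using polynomial_coefficients_from_values[of d] by blast
  define C where "C = (\<Sum>k\<le>d. \<Sum>j\<le>d. \<bar>\<Lambda> k j\<bar> * f (real j))"
  have cb: "\<bar>c n k\<bar> \<le> C" if "k \<le> d" for n k
  proof -
    have "\<bar>c n k\<bar> \<le> (\<Sum>j\<le>d. \<bar>\<Lambda> k j * (\<Sum>i\<le>d. c n i * real j ^ i)\<bar>)"
      by (subst L[OF that]) (rule sum_abs)
    also have "\<dots> \<le> (\<Sum>j\<le>d. \<bar>\<Lambda> k j\<bar> * f (real j))"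
    proof (intro sum_mono)
      fix j
      have "0 \<le> (\<Sum>i\<le>d. c n i * real j ^ i)" by (subst c[symmetric]) auto
      then show "\<bar>\<Lambda> k j * (\<Sum>i\<le>d. c n i * real j ^ i)\<bar> \<le> \<bar>\<Lambda> k j\<bar> * f (real j)"
        using lower[of "real j" n] by (auto simp: abs_mult intro!: mult_left_mono)
    qed
    also have "\<dots> \<le> C" unfolding C_def using that
      by (intro member_le_sum[of k "{..d}" "\<lambda>k. \<Sum>j\<le>d. \<bar>\<Lambda> k j\<bar> * f (real j)"])
        (auto intro!: sum_nonneg simp: f_def)
    finally show ?thesis .
  qed
  have e0: "\<epsilon> \<longlonglongrightarrow> 0" unfolding \<epsilon>_def using LIMSEQ_inverse_real_of_nat .
  have conv: "(\<lambda>n. \<Sum>k\<le>d. c n k * \<rho> ^ k) \<longlonglongrightarrow> f \<rho>" if r: "\<rho> \<ge> 0" for \<rho>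
  proof (rule tendsto_sandwich[OF _ _ _ tendsto_const])
    show "\<forall>\<^sub>F n in sequentially. (\<Sum>k\<le>d. c n k * \<rho> ^ k) \<le> f \<rho>" using lower[OF r] by simp
    \<comment> \<open>In the upper bound the radius is \<rho> + \<epsilon>. Going back to \<rho>
      costs at most \<open>C\<close> times the change of the monomials, because all coefficients are
      bounded by \<open>C\<close>.\<close>
    show "\<forall>\<^sub>F n in sequentially. f \<rho> - C * (\<Sum>k\<le>d. (\<rho> + \<epsilon> n) ^ k - \<rho> ^ k) \<le> (\<Sum>k\<le>d. c n k * \<rho> ^ k)"
    proof (intro always_eventually allI)
      fix n
      have "f \<rho> - (\<Sum>k\<le>d. c n k * \<rho> ^ k) \<le> (\<Sum>k\<le>d. c n k * ((\<rho> + \<epsilon> n) ^ k - \<rho> ^ k))"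
        using upper[OF r, of n] by (simp add: sum_subtractf right_diff_distrib)
      also have "\<dots> \<le> (\<Sum>k\<le>d. C * ((\<rho> + \<epsilon> n) ^ k - \<rho> ^ k))"
      proof (intro sum_mono mult_right_mono)
        fix k show "0 \<le> (\<rho> + \<epsilon> n) ^ k - \<rho> ^ k"
          using power_mono[of \<rho> "\<rho> + \<epsilon> n" k] r eps[of n] by simp
      qed (use cb abs_le_D1 in auto)
      finally show "f \<rho> - C * (\<Sum>k\<le>d. (\<rho> + \<epsilon> n) ^ k - \<rho> ^ k) \<le> (\<Sum>k\<le>d. c n k * \<rho> ^ k)"
        by (simp add: sum_distrib_left)
    qed
    have "(\<lambda>n. f \<rho> - C * (\<Sum>k\<le>d. (\<rho> + \<epsilon> n) ^ k - \<rho> ^ k)) \<longlonglongrightarrow> f \<rho> - C * (\<Sum>k\<le>d. (\<rho> + 0) ^ k - \<rho> ^ k)"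
      by (intro tendsto_intros e0)
    then show "(\<lambda>n. f \<rho> - C * (\<Sum>k\<le>d. (\<rho> + \<epsilon> n) ^ k - \<rho> ^ k)) \<longlonglongrightarrow> f \<rho>" by simp
  qed
  \<comment> \<open>The limiting coefficients must be those that interpolate the limiting values at
    \<open>0, ..., d\<close>; they exist as limits because the coefficients are fixed linear
    combinations of convergent values.\<close>
  define a where "a k = (\<Sum>j\<le>d. \<Lambda> k j * f (real j))" for k
  have ca: "(\<lambda>n. c n k) \<longlonglongrightarrow> a k" if "k \<le> d" for k
  proof -
    have "(\<lambda>n. \<Sum>j\<le>d. \<Lambda> k j * (\<Sum>i\<le>d. c n i * real j ^ i)) \<longlonglongrightarrow> a k"
      unfolding a_def by (intro tendsto_intros conv) simp
    then show ?thesis unfolding L[OF that, of "c n" for n, symmetric] .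
  qed
  show thesis
  proof (rule that)
    fix \<rho> :: real assume r: "\<rho> \<ge> 0"
    have "(\<lambda>n. \<Sum>k\<le>d. c n k * \<rho> ^ k) \<longlonglongrightarrow> (\<Sum>k\<le>d. a k * \<rho> ^ k)"
      by (intro tendsto_intros ca) simp
    from LIMSEQ_unique[OF conv[OF r] this]
    show "measure lborel (parallel_body K \<rho>) = (\<Sum>k\<le>DIM('a). a k * \<rho> ^ k)"
      by (simp add: f_def d_def)
  qed
qed

section \<open>Intrinsic volumes of convex bodies\<close>

text \<open>Nonemptiness is included because \<open>infdist\<close> to the empty set is 0, which
  would make its parallel bodies the whole space.\<close>

definition convex_body :: "'a::euclidean_space set \<Rightarrow> bool" where
  "convex_body K \<longleftrightarrow> compact K \<and> convex K \<and> K \<noteq> {}"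

lemma sum_diff_index: "(\<Sum>m\<le>d. h (d - m)) = (\<Sum>i\<le>d. h i)" for h :: "nat \<Rightarrow> real"
  by (rule sum.reindex_bij_witness[of _ "\<lambda>i. d - i" "\<lambda>i. d - i"]) auto

text \<open>The parallel body is closed, hence Borel, so that the completed measure can be replaced
  by \<open>lborel\<close>.\<close>

lemma steiner_coefficients_iff:
  fixes K :: "'a::euclidean_space set"
  assumes K: "convex_body K"
  shows "steiner_coefficients K V \<longleftrightarrow> (\<forall>k>DIM('a). V k = 0) \<and>
    (\<forall>\<rho>\<ge>0. measure lborel (parallel_body K \<rho>) =
      (\<Sum>m\<le>DIM('a). \<rho> ^ (DIM('a) - m) * unit_ball_vol (real (DIM('a) - m)) * V m))"
proof -
  have cl: "closed K" "K \<noteq> {}" using K by (auto simp: convex_body_def compact_imp_closed)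
  have "measure lebesgue {x + \<rho> *\<^sub>R y | x y. x \<in> K \<and> y \<in> cball 0 1} = measure lborel (parallel_body K \<rho>)"
    if "\<rho> \<ge> 0" for \<rho>
    unfolding parallel_body_eq_Minkowski[OF cl that] using closed_parallel_body[of K \<rho>]
    by (intro measure_completion) simp
  then show ?thesis unfolding steiner_coefficients_def by simp
qed

text \<open>Existence divides the polynomial coefficients by the positive ball volumes. For
  uniqueness, two coefficient families give the same values at \<open>0, ..., d\<close>, which
  determine them. This gives meaning to the \<open>THE\<close> in
  \<open>intrinsic_volume\<close>.\<close>

lemma ex1_steiner_coefficients:
  fixes K :: "'a::euclidean_space set"
  assumes K: "convex_body K"
  shows "\<exists>!V. steiner_coefficients K V"
proof -
  define d where "d = DIM('a)"
  obtain c where c: "\<And>\<rho>. \<rho> \<ge> 0 \<Longrightarrow> measure lborel (parallel_body K \<rho>) = (\<Sum>k\<le>d. c k * \<rho> ^ k)"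
    using steiner_polynomial[of K] K unfolding convex_body_def d_def by blast
  have kap: "unit_ball_vol (real i) \<noteq> 0" for i using unit_ball_vol_pos[of "real i"] of_nat_0_le_iff[of i] by fastforce
  define V where "V m = (if m \<le> d then c (d - m) / unit_ball_vol (real (d - m)) else 0)" for m
  show ?thesis
  proof (rule ex1I[of _ V])
    have "(\<Sum>m\<le>d. \<rho> ^ (d - m) * unit_ball_vol (real (d - m)) * V m) = (\<Sum>k\<le>d. c k * \<rho> ^ k)" for \<rho>
      using sum_diff_index[of "\<lambda>k. c k * \<rho> ^ k" d] kap
      by (simp add: V_def mult.commute del: of_nat_diff)
    then show "steiner_coefficients K V"
      unfolding steiner_coefficients_iff[OF K] using c by (simp add: V_def d_def)
  next
    fix W assume "steiner_coefficients K W"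
    then have W: "\<And>k. k > d \<Longrightarrow> W k = 0" "\<And>\<rho>. \<rho> \<ge> 0 \<Longrightarrow> measure lborel (parallel_body K \<rho>) =
      (\<Sum>m\<le>d. \<rho> ^ (d - m) * unit_ball_vol (real (d - m)) * W m)"
      unfolding steiner_coefficients_iff[OF K] d_def by auto
    define c' where "c' i = unit_ball_vol (real i) * W (d - i)" for i
    have c': "measure lborel (parallel_body K \<rho>) = (\<Sum>k\<le>d. c' k * \<rho> ^ k)" if "\<rho> \<ge> 0" for \<rho>
      using W(2)[OF that] sum_diff_index[of "\<lambda>k. c' k * \<rho> ^ k" d] by (simp add: c'_def mult_ac)
    obtain \<Lambda> :: "nat \<Rightarrow> nat \<Rightarrow> real" where
      L: "\<And>c k. k \<le> d \<Longrightarrow> c k = (\<Sum>j\<le>d. \<Lambda> k j * (\<Sum>i\<le>d. c i * real j ^ i))"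
      using polynomial_coefficients_from_values[of d] by blast
    have cc: "c' k = c k" if "k \<le> d" for k
      using L[OF that, of c'] L[OF that, of c] by (simp flip: c c')
    have "W m = V m" if "m \<le> d" for m
    proof -
      have "unit_ball_vol (real (d - m)) * W m = c (d - m)"
        using cc[of "d - m"] that by (simp add: c'_def del: of_nat_diff)
      then show ?thesis using kap[of "d - m"] that
        by (simp add: V_def eq_divide_eq mult.commute del: of_nat_diff)
    qed
    then show "W = V" using W(1) by (auto simp: V_def fun_eq_iff)
  qed
qed

lemma steiner_formula:
  fixes K :: "'a::euclidean_space set"
  assumes K: "convex_body K" and "\<rho> \<ge> 0"
  shows "measure lborel (parallel_body K \<rho>) =
    (\<Sum>m\<le>DIM('a). \<rho> ^ (DIM('a) - m) * unit_ball_vol (real (DIM('a) - m)) * intrinsic_volume m K)"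
  using theI'[OF ex1_steiner_coefficients[OF K]] assms(2)
  unfolding steiner_coefficients_iff[OF K] intrinsic_volume_def by blast

lemma intrinsic_volume_eqI:
  fixes K :: "'a::euclidean_space set"
  assumes K: "convex_body K" and "m \<le> DIM('a)"
    "\<And>\<rho>. \<rho> \<ge> 0 \<Longrightarrow> measure lborel (parallel_body K \<rho>) =
      (\<Sum>m\<le>DIM('a). \<rho> ^ (DIM('a) - m) * unit_ball_vol (real (DIM('a) - m)) * V m)"
  shows "intrinsic_volume m K = V m"
proof -
  have "steiner_coefficients K (\<lambda>m. if m \<le> DIM('a) then V m else 0)"
    unfolding steiner_coefficients_iff[OF K] using assms(3) by simp
  then show ?thesis unfolding intrinsic_volume_def
    using the1_equality[OF ex1_steiner_coefficients[OF K]] assms(2) by simp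
qed

text \<open>Evaluate the Steiner formula at radius 0: only \<open>0 ^ 0\<close> survives, multiplied
  by the volume 1 of the zero-dimensional ball.\<close>

lemma intrinsic_volume_top:
  fixes K :: "'a::euclidean_space set"
  assumes K: "convex_body K"
  shows "intrinsic_volume DIM('a) K = measure lborel K"
proof -
  have "measure lborel K = (\<Sum>m\<le>DIM('a). 0 ^ (DIM('a) - m) * unit_ball_vol (real (DIM('a) - m)) * intrinsic_volume m K)"
    using steiner_formula[OF K, of 0] K parallel_body_0[of K] by (simp add: convex_body_def compact_imp_closed)
  also have "\<dots> = (\<Sum>m\<le>DIM('a). if m = DIM('a) then intrinsic_volume m K else 0)"
    by (intro sum.cong refl) (auto simp: power_0_left)
  finally show ?thesis by simp
qed

section \<open>Homogeneity, size and Hausdorff continuity of intrinsic volumes\<close>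

lemma parallel_body_scaleR:
  fixes K :: "'a::euclidean_space set"
  assumes "K \<noteq> {}" "r > 0"
  shows "parallel_body ((*\<^sub>R) r ` K) (r * \<rho>) = (*\<^sub>R) r ` parallel_body K \<rho>"
proof -
  have inf: "infdist (r *\<^sub>R x) ((*\<^sub>R) r ` K) = r * infdist x K" for x
  proof -
    have "(INF y\<in>K. r * dist x y) = r * (INF y\<in>K. dist x y)"
    proof (rule continuous_at_Inf_mono[symmetric, of "\<lambda>y. r * y" "dist x ` K", unfolded image_image])
      show "mono ((*) r)" using assms by (simp add: mono_def)
    qed (use assms in \<open>auto intro!: continuous_intros bdd_belowI2[of _ 0]\<close>)
    then show ?thesis using assms
      by (simp add: infdist_def image_image dist_norm flip: scaleR_diff_right)
  qed
  show ?thesis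
  proof (intro set_eqI iffI)
    fix z assume "z \<in> parallel_body ((*\<^sub>R) r ` K) (r * \<rho>)"
    then have "z = r *\<^sub>R ((1 / r) *\<^sub>R z)" "(1 / r) *\<^sub>R z \<in> parallel_body K \<rho>"
      using inf[of "(1 / r) *\<^sub>R z"] assms by (auto simp: parallel_body_def)
    then show "z \<in> (*\<^sub>R) r ` parallel_body K \<rho>" by blast
  qed (use assms inf in \<open>auto simp: parallel_body_def\<close>)
qed

lemma measure_lborel_scaleR:
  fixes A :: "'a::euclidean_space set"
  assumes "A \<in> sets borel" "r > 0"
  shows "measure lborel ((*\<^sub>R) r ` A) = r ^ DIM('a) * measure lborel A"
proof -
  have "(\<lambda>x::'a. \<Sum>b\<in>Basis. (r * (x \<bullet> b)) *\<^sub>R b) = (*\<^sub>R) r"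
    by (simp add: fun_eq_iff euclidean_representation flip: scaleR_scaleR scaleR_sum_right)
  then show ?thesis using lborel_diagonal_image[of "\<lambda>_. r" A] assms by (simp only: prod_constant)
qed

lemma convex_body_scaleR: "convex_body K \<Longrightarrow> convex_body ((*\<^sub>R) r ` K)"
  unfolding convex_body_def by (auto intro: compact_scaling convex_scaling)

text \<open>Scaling turns radius \<rho> into \<rho> / r and multiplies volumes by
  \<open>r ^ d\<close>; the power \<rho> ^ (d - m) absorbs \<open>r ^ (d - m)\<close> of it and
  leaves \<open>r ^ m\<close>.\<close>

lemma intrinsic_volume_scaleR:
  fixes K :: "'a::euclidean_space set"
  assumes K: "convex_body K" and r: "r > 0" and m: "m \<le> DIM('a)"
  shows "intrinsic_volume m ((*\<^sub>R) r ` K) = r ^ m * intrinsic_volume m K"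
proof (rule intrinsic_volume_eqI[OF convex_body_scaleR[OF K] m])
  fix \<rho> :: real assume rho: "\<rho> \<ge> 0"
  have ne: "K \<noteq> {}" using K by (simp add: convex_body_def)
  have "parallel_body ((*\<^sub>R) r ` K) \<rho> = (*\<^sub>R) r ` parallel_body K (\<rho> / r)"
    using parallel_body_scaleR[OF ne r, of "\<rho> / r"] r by simp
  then have "measure lborel (parallel_body ((*\<^sub>R) r ` K) \<rho>) = r ^ DIM('a) * measure lborel (parallel_body K (\<rho> / r))"
    using closed_parallel_body[of K] r by (simp add: measure_lborel_scaleR)
  also have "\<dots> = (\<Sum>m\<le>DIM('a). r ^ DIM('a) * ((\<rho> / r) ^ (DIM('a) - m) * unit_ball_vol (real (DIM('a) - m)) * intrinsic_volume m K))"
    using r rho by (simp add: steiner_formula[OF K] sum_distrib_left)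
  also have "\<dots> = (\<Sum>m\<le>DIM('a). \<rho> ^ (DIM('a) - m) * unit_ball_vol (real (DIM('a) - m)) * (r ^ m * intrinsic_volume m K))"
  proof (intro sum.cong refl)
    fix k assume "k \<in> {..DIM('a)}"
    then have "r ^ DIM('a) = r ^ (DIM('a) - k) * r ^ k" by (simp flip: power_add)
    then show "r ^ DIM('a) * ((\<rho> / r) ^ (DIM('a) - k) * unit_ball_vol (real (DIM('a) - k)) * intrinsic_volume k K) =
      \<rho> ^ (DIM('a) - k) * unit_ball_vol (real (DIM('a) - k)) * (r ^ k * intrinsic_volume k K)"
      using r by (simp add: power_divide)
  qed
  finally show "measure lborel (parallel_body ((*\<^sub>R) r ` K) \<rho>) =
    (\<Sum>m\<le>DIM('a). \<rho> ^ (DIM('a) - m) * unit_ball_vol (real (DIM('a) - m)) * (r ^ m * intrinsic_volume m K))" .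
qed

text \<open>A single set of weights serves all bodies, so bounds and Lipschitz estimates for
  intrinsic volumes reduce to those for the volumes of the parallel bodies at radii
  \<open>0, ..., d\<close>.\<close>

lemma intrinsic_volume_from_values:
  "\<exists>\<Lambda>::nat \<Rightarrow> nat \<Rightarrow> real. \<forall>K::'a::euclidean_space set. \<forall>m\<le>DIM('a). convex_body K \<longrightarrow>
     intrinsic_volume m K = (\<Sum>j\<le>DIM('a). \<Lambda> m j * measure lborel (parallel_body K (real j)))"
proof -
  define d where "d = DIM('a)"
  obtain \<Lambda> :: "nat \<Rightarrow> nat \<Rightarrow> real" where
    L: "\<And>c k. k \<le> d \<Longrightarrow> c k = (\<Sum>j\<le>d. \<Lambda> k j * (\<Sum>i\<le>d. c i * real j ^ i))"
    using polynomial_coefficients_from_values[of d] by blast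
  show ?thesis
  proof (intro exI[of _ "\<lambda>m j. \<Lambda> (d - m) j / unit_ball_vol (real (d - m))"] allI impI)
    fix K :: "'a set" and m assume K: "convex_body K" and m: "m \<le> DIM('a)"
    define c where "c i = unit_ball_vol (real i) * intrinsic_volume (d - i) K" for i
    have c: "measure lborel (parallel_body K \<rho>) = (\<Sum>k\<le>d. c k * \<rho> ^ k)" if "\<rho> \<ge> 0" for \<rho>
      using steiner_formula[OF K that] sum_diff_index[of "\<lambda>k. c k * \<rho> ^ k" d]
      by (simp add: c_def d_def mult_ac)
    have "unit_ball_vol (real (d - m)) * intrinsic_volume m K = c (d - m)"
      using m by (simp add: c_def d_def)
    also have "\<dots> = (\<Sum>j\<le>d. \<Lambda> (d - m) j * (\<Sum>i\<le>d. c i * real j ^ i))" by (rule L) simp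
    also have "\<dots> = (\<Sum>j\<le>d. \<Lambda> (d - m) j * measure lborel (parallel_body K (real j)))"
      by (simp add: c)
    finally have *: "unit_ball_vol (real (d - m)) * intrinsic_volume m K =
      (\<Sum>j\<le>d. \<Lambda> (d - m) j * measure lborel (parallel_body K (real j)))" .
    have "intrinsic_volume m K = (unit_ball_vol (real (d - m)) * intrinsic_volume m K) / unit_ball_vol (real (d - m))"
      by (rule nonzero_mult_div_cancel_left[symmetric], rule less_imp_neq[symmetric], rule unit_ball_vol_pos) simp
    then show "intrinsic_volume m K = (\<Sum>j\<le>DIM('a). \<Lambda> (d - m) j / unit_ball_vol (real (d - m)) * measure lborel (parallel_body K (real j)))"
      unfolding * by (simp add: d_def sum_divide_distrib)
  qed
qed

lemma intrinsic_volume_bounded_unit_ball: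
  "\<exists>C\<ge>0. \<forall>K::'a::euclidean_space set. \<forall>m\<le>DIM('a). convex_body K \<longrightarrow> K \<subseteq> cball 0 1 \<longrightarrow> \<bar>intrinsic_volume m K\<bar> \<le> C"
proof -
  obtain \<Lambda> :: "nat \<Rightarrow> nat \<Rightarrow> real" where L: "\<And>K::'a set. \<And>m. m \<le> DIM('a) \<Longrightarrow> convex_body K \<Longrightarrow>
     intrinsic_volume m K = (\<Sum>j\<le>DIM('a). \<Lambda> m j * measure lborel (parallel_body K (real j)))"
    using intrinsic_volume_from_values[where 'a='a] by blast
  define b where "b j = measure lborel (cball (0::'a) (1 + real j))" for j
  define C where "C = (\<Sum>m\<le>DIM('a). \<Sum>j\<le>DIM('a). \<bar>\<Lambda> m j\<bar> * b j)"
  have "\<bar>intrinsic_volume m K\<bar> \<le> C" if m: "m \<le> DIM('a)" and K: "convex_body K" "K \<subseteq> cball 0 1" for K :: "'a set" and m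
  proof -
    have "\<bar>intrinsic_volume m K\<bar> \<le> (\<Sum>j\<le>DIM('a). \<bar>\<Lambda> m j * measure lborel (parallel_body K (real j))\<bar>)"
      unfolding L[OF m K(1)] by (rule sum_abs)
    also have "\<dots> \<le> (\<Sum>j\<le>DIM('a). \<bar>\<Lambda> m j\<bar> * b j)"
    proof (intro sum_mono)
      fix j
      have "measure lborel (parallel_body K (real j)) \<le> b j"
        unfolding b_def using K parallel_body_cball[of K 1 "real j"] closed_parallel_body[of K "real j"]
        by (intro measure_mono_fmeasurable fmeasurable_compact) (auto simp: convex_body_def)
      then show "\<bar>\<Lambda> m j * measure lborel (parallel_body K (real j))\<bar> \<le> \<bar>\<Lambda> m j\<bar> * b j"
        by (simp add: abs_mult mult_left_mono)
    qed
    also have "\<dots> \<le> C" unfolding C_def using m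
      by (intro member_le_sum[of m "{..DIM('a)}" "\<lambda>m. \<Sum>j\<le>DIM('a). \<bar>\<Lambda> m j\<bar> * b j"])
        (auto intro!: sum_nonneg simp: b_def)
    finally show ?thesis .
  qed
  moreover have "C \<ge> 0" by (auto simp: C_def b_def intro!: sum_nonneg)
  ultimately show ?thesis by blast
qed

text \<open>Dividing by \<open>M\<close> brings both bases into the unit interval, where powers are
  Lipschitz with constant \<open>k\<close>. The remaining factor \<open>1 / M\<close> is dropped
  because \<open>M\<close> is at least 1.\<close>

lemma power_add_diff_le:
  fixes x \<delta> M :: real
  assumes "0 \<le> x" "0 \<le> \<delta>" "x + \<delta> \<le> M" "1 \<le> M"
  shows "(x + \<delta>) ^ k - x ^ k \<le> k * M ^ k * \<delta>"
proof -
  have "\<bar>((x + \<delta>) / M) ^ k - (x / M) ^ k\<bar> \<le> k * \<bar>(x + \<delta>) / M - x / M\<bar>"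
    using norm_power_diff[of "(x + \<delta>) / M" "x / M" k] assms by simp
  also have "\<dots> = k * (\<delta> / M)" using assms by (simp add: add_divide_distrib)
  also have "\<dots> \<le> k * \<delta>" using assms     using mult_left_mono[of 1 M \<delta>] by (intro mult_left_mono) (auto simp: divide_le_eq)
  finally have "((x + \<delta>) ^ k - x ^ k) / M ^ k \<le> k * \<delta>"
    by (simp add: power_divide diff_divide_distrib)
  then show ?thesis using assms by (simp add: divide_le_eq mult_ac)
qed

text \<open>If \<open>K\<close> lies within \<delta> of \<open>L\<close>, its parallel body of
  radius \<open>j\<close> lies in that of \<open>L\<close> of radius \<open>j + \<delta>\<close>.
  The difference of volumes is thus bounded by the growth of one Steiner polynomial, whose
  coefficients are bounded on the unit ball. Two nonempty subsets of that ball are always within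
  distance 2, the range allowed for \<delta>.\<close>

lemma intrinsic_volume_lipschitz_unit_ball:
  "\<exists>C\<ge>0. \<forall>(K::'a::euclidean_space set) L m \<delta>. m \<le> DIM('a) \<longrightarrow> convex_body K \<longrightarrow> convex_body L \<longrightarrow> K \<subseteq> cball 0 1 \<longrightarrow> L \<subseteq> cball 0 1 \<longrightarrow>
     0 \<le> \<delta> \<longrightarrow> \<delta> \<le> 2 \<longrightarrow> K \<subseteq> parallel_body L \<delta> \<longrightarrow> L \<subseteq> parallel_body K \<delta> \<longrightarrow>
     \<bar>intrinsic_volume m K - intrinsic_volume m L\<bar> \<le> C * \<delta>"
proof -
  define d where "d = DIM('a)"
  obtain \<Lambda> :: "nat \<Rightarrow> nat \<Rightarrow> real" where L: "\<And>K::'a set. \<And>m. m \<le> d \<Longrightarrow> convex_body K \<Longrightarrow>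
     intrinsic_volume m K = (\<Sum>j\<le>d. \<Lambda> m j * measure lborel (parallel_body K (real j)))"
    using intrinsic_volume_from_values[where 'a='a] unfolding d_def by blast
  obtain B where B: "B \<ge> 0" "\<And>(K::'a set) m. m \<le> d \<Longrightarrow> convex_body K \<Longrightarrow> K \<subseteq> cball 0 1 \<Longrightarrow> \<bar>intrinsic_volume m K\<bar> \<le> B"
    using intrinsic_volume_bounded_unit_ball[where 'a='a] unfolding d_def by blast
  \<comment> \<open>Bounds the slope of the Steiner polynomial on the radii from \<open>j\<close> to
    \<open>j + 2\<close> for bodies in the unit ball.\<close>
  define w where "w j = (\<Sum>m\<le>d. real (d - m) * (real j + 2) ^ (d - m) * unit_ball_vol (real (d - m)) * B)" for j
  have w0: "w j \<ge> 0" for j using B by (auto simp: w_def intro!: sum_nonneg mult_nonneg_nonneg)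
  have one: "measure lborel (parallel_body K (real j)) - measure lborel (parallel_body L (real j)) \<le> w j * \<delta>"
    if K: "convex_body K" and L: "convex_body L" "L \<subseteq> cball 0 1" and del: "0 \<le> \<delta>" "\<delta> \<le> 2" and KL: "K \<subseteq> parallel_body L \<delta>"
    for K L :: "'a set" and \<delta> j
  proof -
    have "measure lborel (parallel_body K (real j)) \<le> measure lborel (parallel_body L (real j + \<delta>))"
      using K L KL by (intro measure_parallel_body_mono parallel_body_parallel_body)
        (auto simp: convex_body_def compact_imp_closed compact_imp_bounded)
    then have "measure lborel (parallel_body K (real j)) - measure lborel (parallel_body L (real j)) \<le>
       (\<Sum>m\<le>d. ((real j + \<delta>) ^ (d - m) - real j ^ (d - m)) * (unit_ball_vol (real (d - m)) * intrinsic_volume m L))"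
      using del by (simp add: steiner_formula[OF L(1)] d_def sum_subtractf left_diff_distrib mult.assoc)
    also have "\<dots> \<le> (\<Sum>m\<le>d. (real (d - m) * (real j + 2) ^ (d - m) * \<delta>) * (unit_ball_vol (real (d - m)) * B))"
    proof (intro sum_mono)
      fix m assume "m \<in> {..d}"
      then have b: "\<bar>intrinsic_volume m L\<bar> \<le> B" using B L by simp
      have p: "0 \<le> (real j + \<delta>) ^ (d - m) - real j ^ (d - m)"
        using power_mono[of "real j" "real j + \<delta>" "d - m"] del by simp
      have "((real j + \<delta>) ^ (d - m) - real j ^ (d - m)) * (unit_ball_vol (real (d - m)) * intrinsic_volume m L) \<le>
        ((real j + \<delta>) ^ (d - m) - real j ^ (d - m)) * (unit_ball_vol (real (d - m)) * B)"
        using b p by (intro mult_left_mono) auto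
      also have "\<dots> \<le> (real (d - m) * (real j + 2) ^ (d - m) * \<delta>) * (unit_ball_vol (real (d - m)) * B)"
        using B del by (intro mult_right_mono power_add_diff_le) auto
      finally show "((real j + \<delta>) ^ (d - m) - real j ^ (d - m)) * (unit_ball_vol (real (d - m)) * intrinsic_volume m L) \<le>
        (real (d - m) * (real j + 2) ^ (d - m) * \<delta>) * (unit_ball_vol (real (d - m)) * B)" .
    qed
    also have "\<dots> = w j * \<delta>" by (simp add: w_def sum_distrib_left mult_ac del: of_nat_diff)
    finally show ?thesis .
  qed
  define C where "C = (\<Sum>m\<le>d. \<Sum>j\<le>d. \<bar>\<Lambda> m j\<bar> * w j)"
  have "\<bar>intrinsic_volume m K - intrinsic_volume m L'\<bar> \<le> C * \<delta>"
    if m: "m \<le> d" and K: "convex_body K" "convex_body L'" "K \<subseteq> cball 0 1" "L' \<subseteq> cball 0 1"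
      and del: "0 \<le> \<delta>" "\<delta> \<le> 2" and KL: "K \<subseteq> parallel_body L' \<delta>" "L' \<subseteq> parallel_body K \<delta>"
    for K L' :: "'a set" and m \<delta>
  proof -
    let ?D = "\<lambda>j. measure lborel (parallel_body K (real j)) - measure lborel (parallel_body L' (real j))"
    have "\<bar>intrinsic_volume m K - intrinsic_volume m L'\<bar> = \<bar>\<Sum>j\<le>d. \<Lambda> m j * ?D j\<bar>"
      by (simp add: L[OF m K(1)] L[OF m K(2)] sum_subtractf right_diff_distrib)
    also have "\<dots> \<le> (\<Sum>j\<le>d. \<bar>\<Lambda> m j * ?D j\<bar>)" by (rule sum_abs)
    also have "\<dots> \<le> (\<Sum>j\<le>d. \<bar>\<Lambda> m j\<bar> * (w j * \<delta>))"
    proof (intro sum_mono)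
      fix j
      have "\<bar>?D j\<bar> \<le> w j * \<delta>"
        using one[OF K(1,2,4) del KL(1), of j] one[OF K(2,1,3) del KL(2), of j] by (simp add: abs_le_iff)
      then show "\<bar>\<Lambda> m j * ?D j\<bar> \<le> \<bar>\<Lambda> m j\<bar> * (w j * \<delta>)" by (simp add: abs_mult mult_left_mono)
    qed
    also have "\<dots> = (\<Sum>j\<le>d. \<bar>\<Lambda> m j\<bar> * w j) * \<delta>" by (simp add: sum_distrib_left mult_ac)
    also have "\<dots> \<le> C * \<delta>" unfolding C_def using m del w0
      by (intro mult_right_mono member_le_sum[of m "{..d}" "\<lambda>m. \<Sum>j\<le>d. \<bar>\<Lambda> m j\<bar> * w j"])
        (auto intro!: sum_nonneg)
    finally show ?thesis .
  qed
  moreover have "C \<ge> 0" using w0 by (auto simp: C_def intro!: sum_nonneg)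
  ultimately show ?thesis unfolding d_def[symmetric] by blast
qed

lemma scaleR_image_subset_cball:
  fixes K :: "'a::euclidean_space set"
  assumes "K \<subseteq> cball 0 R" "R > 0"
  shows "(*\<^sub>R) (1 / R) ` K \<subseteq> cball 0 1"
  using assms by (auto simp: divide_le_eq)

lemma intrinsic_volume_unscale:
  fixes K :: "'a::euclidean_space set"
  assumes K: "convex_body K" and R: "R > 0" and m: "m \<le> DIM('a)"
  shows "intrinsic_volume m K = R ^ m * intrinsic_volume m ((*\<^sub>R) (1 / R) ` K)"
  using intrinsic_volume_scaleR[OF K, of "1 / R" m] R m by (simp add: power_divide)

lemma intrinsic_volume_bound:
  assumes m: "m \<le> DIM('a::euclidean_space)"
  obtains C where "C \<ge> 0" "\<And>(K::'a set) R. convex_body K \<Longrightarrow> R > 0 \<Longrightarrow> K \<subseteq> cball 0 R \<Longrightarrow> \<bar>intrinsic_volume m K\<bar> \<le> C * R ^ m"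
proof -
  obtain C where C: "C \<ge> 0" "\<And>(K::'a set) m. m \<le> DIM('a) \<Longrightarrow> convex_body K \<Longrightarrow> K \<subseteq> cball 0 1 \<Longrightarrow> \<bar>intrinsic_volume m K\<bar> \<le> C"
    using intrinsic_volume_bounded_unit_ball[where 'a='a] by blast
  show thesis
  proof (rule that[OF C(1)])
    fix K :: "'a set" and R :: real assume K: "convex_body K" "R > 0" "K \<subseteq> cball 0 R"
    have "\<bar>intrinsic_volume m ((*\<^sub>R) (1 / R) ` K)\<bar> \<le> C"
      by (intro C m convex_body_scaleR K scaleR_image_subset_cball)
    then show "\<bar>intrinsic_volume m K\<bar> \<le> C * R ^ m"
      unfolding intrinsic_volume_unscale[OF K(1,2) m] using K by (simp add: abs_mult mult.commute)
  qed
qed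

text \<open>Rescaling to the unit ball changes the distance \<delta> into \<delta> / R, while
  homogeneity contributes \<open>R ^ m\<close>. This accounts for the exponent
  \<open>m - 1\<close>.\<close>

lemma intrinsic_volume_lipschitz:
  assumes m: "1 \<le> m" "m \<le> DIM('a::euclidean_space)"
  obtains C where "C \<ge> 0" "\<And>(K::'a set) L R \<delta>. convex_body K \<Longrightarrow> convex_body L \<Longrightarrow> R > 0 \<Longrightarrow> K \<subseteq> cball 0 R \<Longrightarrow> L \<subseteq> cball 0 R \<Longrightarrow>
    0 \<le> \<delta> \<Longrightarrow> \<delta> \<le> 2 * R \<Longrightarrow> K \<subseteq> parallel_body L \<delta> \<Longrightarrow> L \<subseteq> parallel_body K \<delta> \<Longrightarrow>
    \<bar>intrinsic_volume m K - intrinsic_volume m L\<bar> \<le> C * R ^ (m - 1) * \<delta>"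
proof -
  obtain C where C: "C \<ge> 0" "\<And>(K::'a set) L m \<delta>. m \<le> DIM('a) \<Longrightarrow> convex_body K \<Longrightarrow> convex_body L \<Longrightarrow> K \<subseteq> cball 0 1 \<Longrightarrow> L \<subseteq> cball 0 1 \<Longrightarrow>
     0 \<le> \<delta> \<Longrightarrow> \<delta> \<le> 2 \<Longrightarrow> K \<subseteq> parallel_body L \<delta> \<Longrightarrow> L \<subseteq> parallel_body K \<delta> \<Longrightarrow>
     \<bar>intrinsic_volume m K - intrinsic_volume m L\<bar> \<le> C * \<delta>"
    using intrinsic_volume_lipschitz_unit_ball[where 'a='a] by blast
  show thesis
  proof (rule that[OF C(1)])
    fix K L :: "'a set" and R \<delta> :: real
    assume K: "convex_body K" "convex_body L" "R > 0" "K \<subseteq> cball 0 R" "L \<subseteq> cball 0 R"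
      and del: "0 \<le> \<delta>" "\<delta> \<le> 2 * R" and KL: "K \<subseteq> parallel_body L \<delta>" "L \<subseteq> parallel_body K \<delta>"
    have ne: "K \<noteq> {}" "L \<noteq> {}" using K by (auto simp: convex_body_def)
    have pb: "(*\<^sub>R) (1 / R) ` A \<subseteq> parallel_body ((*\<^sub>R) (1 / R) ` B) (\<delta> / R)"
      if "A \<subseteq> parallel_body B \<delta>" "B \<noteq> {}" for A B :: "'a set"
      using parallel_body_scaleR[OF that(2), of "1 / R" \<delta>] that(1) K(3) by auto
    have "\<bar>intrinsic_volume m ((*\<^sub>R) (1 / R) ` K) - intrinsic_volume m ((*\<^sub>R) (1 / R) ` L)\<bar> \<le> C * (\<delta> / R)"
      using K del by (intro C m convex_body_scaleR scaleR_image_subset_cball pb KL ne) (auto simp: divide_le_eq)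
    then have "R ^ m * \<bar>intrinsic_volume m ((*\<^sub>R) (1 / R) ` K) - intrinsic_volume m ((*\<^sub>R) (1 / R) ` L)\<bar> \<le> R ^ m * (C * (\<delta> / R))"
      using K by (intro mult_left_mono) auto
    moreover have "R ^ m = R ^ (m - 1) * R" using m by (cases m) auto
    ultimately show "\<bar>intrinsic_volume m K - intrinsic_volume m L\<bar> \<le> C * R ^ (m - 1) * \<delta>"
      unfolding intrinsic_volume_unscale[OF K(1,3) m(2)] intrinsic_volume_unscale[OF K(2,3) m(2)]
      using K(3) by (simp add: abs_mult mult_ac flip: right_diff_distrib)
  qed
qed

lemma convex_parallel_body:
  fixes A :: "'a::euclidean_space set"
  assumes A: "closed A" "convex A" "A \<noteq> {}"
  shows "convex (parallel_body A r)"
proof (rule convexI)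
  fix x y :: 'a and u v :: real
  assume x: "x \<in> parallel_body A r" and y: "y \<in> parallel_body A r" and uv: "0 \<le> u" "0 \<le> v" "u + v = 1"
  obtain p where p: "p \<in> A" "infdist x A = dist x p" using infdist_attains_inf[OF A(1,3)] by blast
  obtain q where q: "q \<in> A" "infdist y A = dist y q" using infdist_attains_inf[OF A(1,3)] by blast
  have "infdist (u *\<^sub>R x + v *\<^sub>R y) A \<le> dist (u *\<^sub>R x + v *\<^sub>R y) (u *\<^sub>R p + v *\<^sub>R q)"
    by (intro infdist_le convexD[OF A(2)] p q uv)
  also have "\<dots> = norm (u *\<^sub>R (x - p) + v *\<^sub>R (y - q))" by (simp add: dist_norm algebra_simps)
  also have "\<dots> \<le> u * norm (x - p) + v * norm (y - q)"
    using norm_triangle_ineq[of "u *\<^sub>R (x - p)" "v *\<^sub>R (y - q)"] uv by simp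
  also have "\<dots> \<le> u * r + v * r"
    using x y p q uv by (intro add_mono mult_left_mono) (auto simp: parallel_body_def dist_norm)
  also have "\<dots> = r" using uv by (simp flip: distrib_right)
  finally show "u *\<^sub>R x + v *\<^sub>R y \<in> parallel_body A r" by (simp add: parallel_body_def)
qed

lemma convex_body_hull:
  fixes S :: "'a::euclidean_space set"
  shows "compact S \<Longrightarrow> S \<noteq> {} \<Longrightarrow> convex_body (convex hull S)"
  by (simp add: convex_body_def compact_convex_hull)

text \<open>The parallel body of a convex set is convex, so it contains the hull of \<open>S\<close>
  once it contains \<open>S\<close>. Estimates on generating points are therefore enough for
  hulls.\<close>

lemma hull_subset_parallel_body_hull:
  fixes S T :: "'a::euclidean_space set"
  assumes T: "compact T" and ST: "\<And>x. x \<in> S \<Longrightarrow> \<exists>y\<in>T. dist x y \<le> \<delta>"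
  shows "convex hull S \<subseteq> parallel_body (convex hull T) \<delta>"
proof (cases "T = {}")
  case True
  then have "S = {}" using ST by auto
  then show ?thesis by simp
next
  case False
  have "S \<subseteq> parallel_body (convex hull T) \<delta>"
  proof
    fix x assume "x \<in> S"
    then obtain y where y: "y \<in> T" "dist x y \<le> \<delta>" using ST by blast
    have "y \<in> convex hull T" using y(1) by (rule hull_inc)
    from infdist_le[OF this, of x] show "x \<in> parallel_body (convex hull T) \<delta>"
      using y by (simp add: parallel_body_def)
  qed
  then show ?thesis
    using False T by (intro hull_minimal convex_parallel_body) (auto simp: compact_imp_closed compact_convex_hull)
qed

section \<open>Weak convergence from characteristic functions\<close>

text \<open>Real trigonometric polynomials with arbitrary frequencies; the phase \<open>b\<close>
  covers the sines. Expectations of these functions are governed by characteristic functions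
  alone.\<close>

inductive trig_sum :: "'i set \<Rightarrow> (('i \<Rightarrow> real) \<Rightarrow> real) \<Rightarrow> bool" for I where
  wave: "trig_sum I (\<lambda>x. c * cos ((\<Sum>i\<in>I. u i * x i) + b))"
| add: "trig_sum I g \<Longrightarrow> trig_sum I h \<Longrightarrow> trig_sum I (\<lambda>x. g x + h x)"

text \<open>The product-to-sum formula for two cosines.\<close>

lemma trig_sum_mult_wave:
  assumes "trig_sum I h"
  shows "trig_sum I (\<lambda>x. c * cos ((\<Sum>i\<in>I. u i * x i) + b) * h x)"
  using assms
proof induction
  case (wave c' u' b')
  have "c * cos ((\<Sum>i\<in>I. u i * x i) + b) * (c' * cos ((\<Sum>i\<in>I. u' i * x i) + b')) =
      (c * c' / 2) * cos ((\<Sum>i\<in>I. (u i - u' i) * x i) + (b - b')) +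
      (c * c' / 2) * cos ((\<Sum>i\<in>I. (u i + u' i) * x i) + (b + b'))" for x
  proof -
    have "(\<Sum>i\<in>I. (u i - u' i) * x i) + (b - b') = ((\<Sum>i\<in>I. u i * x i) + b) - ((\<Sum>i\<in>I. u' i * x i) + b')"
      "(\<Sum>i\<in>I. (u i + u' i) * x i) + (b + b') = ((\<Sum>i\<in>I. u i * x i) + b) + ((\<Sum>i\<in>I. u' i * x i) + b')"
      by (simp_all add: left_diff_distrib distrib_right sum_subtractf sum.distrib)
    then show ?thesis by (simp only: cos_diff cos_add) (simp add: algebra_simps)
  qed
  then show ?case by (simp only:) (intro trig_sum.intros)
next
  case (add g h)
  then show ?case by (simp only: distrib_left) (intro trig_sum.intros)
qed

lemma trig_sum_mult:
  assumes "trig_sum I g" "trig_sum I h"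
  shows "trig_sum I (\<lambda>x. g x * h x)"
  using assms(1)
proof induction
  case (wave c u b)
  then show ?case by (rule trig_sum_mult_wave[OF assms(2)])
next
  case (add g g')
  then show ?case by (simp only: distrib_right) (intro trig_sum.intros)
qed

text \<open>Polynomials in \<open>sin (\<omega> x\<^sub>i)\<close>. Since \<open>sin\<close> maps \<open>[-\<pi>/2, \<pi>/2]\<close> onto its range, their supremum
  over the whole space equals the one over the cube of half-width \<open>\<pi> / (2 * \<omega>)\<close>.\<close>

inductive sin_poly :: "real \<Rightarrow> 'i set \<Rightarrow> (('i \<Rightarrow> real) \<Rightarrow> real) \<Rightarrow> bool" for w I where
  const: "sin_poly w I (\<lambda>x. c)"
| sin: "i \<in> I \<Longrightarrow> sin_poly w I (\<lambda>x. sin (w * x i))"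
| add: "sin_poly w I g \<Longrightarrow> sin_poly w I h \<Longrightarrow> sin_poly w I (\<lambda>x. g x + h x)"
| mult: "sin_poly w I g \<Longrightarrow> sin_poly w I h \<Longrightarrow> sin_poly w I (\<lambda>x. g x * h x)"

lemma sin_poly_trig_sum:
  assumes "finite I" "sin_poly w I h"
  shows "trig_sum I h"
  using assms(2)
proof induction
  case (const c)
  show ?case using trig_sum.wave[of I c "\<lambda>_. 0" 0] by simp
next
  case (sin i)
  have "(\<Sum>j\<in>I. (if j = i then w else 0) * x j) = w * x i" for x
    using sin assms(1) by (simp add: if_distrib if_distribR cong: if_cong)
  then have "(\<lambda>x. sin (w * x i)) = (\<lambda>x. 1 * cos ((\<Sum>j\<in>I. (if j = i then w else 0) * x j) + (- (pi / 2))))"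
    by (simp add: fun_eq_iff cos_diff)
  then show ?case by (simp only:) (rule trig_sum.wave)
qed (auto intro: trig_sum.add trig_sum_mult)

lemma sin_poly_cong:
  assumes "sin_poly w I h" "\<And>i. i \<in> I \<Longrightarrow> sin (w * x i) = sin (w * y i)"
  shows "h x = h y"
  using assms by induction auto

lemma continuous_on_sin_poly:
  fixes S :: "('i::countable \<Rightarrow> real) set"
  shows "sin_poly w I h \<Longrightarrow> continuous_on S h"
proof (induction rule: sin_poly.induct)
  case (sin i)
  have "continuous_on S (\<lambda>x. x i)"
    using continuous_on_product_coordinates by (rule continuous_on_subset) simp
  then show ?case by (rule continuous_on_sin[OF continuous_on_mult_left])
qed (auto intro!: continuous_intros)

text \<open>Coordinates outside \<open>I\<close> are pinned to 0. Then two different points differ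
  in a coordinate of \<open>I\<close>, which a sine can separate, and the set stays compact in the
  product topology.\<close>

definition cube :: "'i set \<Rightarrow> real \<Rightarrow> ('i \<Rightarrow> real) set" where
  "cube I L = Pi\<^sub>E UNIV (\<lambda>i. if i \<in> I then {-L..L} else {0})"

lemma compact_cube: "compact (cube I L)"
proof -
  have "compactin (product_topology (\<lambda>i. euclidean) UNIV) (Pi\<^sub>E UNIV (\<lambda>i. if i \<in> I then {-L..L::real} else {0}))"
    by (subst compactin_PiE) (auto simp: compactin_euclidean_iff)
  then show ?thesis by (simp add: cube_def euclidean_product_topology flip: compactin_euclidean_iff)
qed

text \<open>Stone-Weierstrass. The frequency is chosen so that the cube of half-width
  \<open>L\<close> corresponds to angles between -pi/2 and pi/2, where the sine is injective and
  hence separates points.\<close>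

lemma sin_poly_dense:
  fixes f :: "('i::countable \<Rightarrow> real) \<Rightarrow> real"
  assumes L: "L > 0" and f: "continuous_on UNIV f" and e: "e > 0"
  obtains h where "sin_poly (pi / (2 * L)) I h" "\<And>x. x \<in> cube I L \<Longrightarrow> \<bar>f x - h x\<bar> < e"
proof -
  let ?w = "pi / (2 * L)"
  interpret function_ring_on "Collect (sin_poly ?w I)" "cube I L"
  proof
    show "compact (cube I L)" by (rule compact_cube)
    fix x y :: "'i \<Rightarrow> real" assume x: "x \<in> cube I L" and y: "y \<in> cube I L" and "x \<noteq> y"
    then obtain i where i: "x i \<noteq> y i" by auto
    have "i \<in> I" using i x y by (auto simp: cube_def PiE_def Pi_def split: if_splits) (metis singletonD)
    have rng: "- (pi / 2) \<le> ?w * z i \<and> ?w * z i \<le> pi / 2" if "z \<in> cube I L" for z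
    proof -
      have "\<bar>z i\<bar> \<le> L" using that \<open>i \<in> I\<close> by (auto simp: cube_def PiE_def Pi_def abs_le_iff dest!: spec[of _ i])
      then have "\<bar>?w * z i\<bar> \<le> ?w * L" using L by (simp add: abs_mult divide_simps)
      also have "?w * L = pi / 2" using L by simp
      finally show ?thesis unfolding abs_le_iff by linarith
    qed
    have "?w * x i \<noteq> ?w * y i" using i L by simp
    then have "sin (?w * x i) \<noteq> sin (?w * y i)"
      using sin_inj_pi[of "?w * x i" "?w * y i"] rng[OF x] rng[OF y] by auto
    then show "\<exists>f\<in>Collect (sin_poly ?w I). f x \<noteq> f y"
      using sin_poly.sin[OF \<open>i \<in> I\<close>, of ?w] by (intro bexI[of _ "\<lambda>x. sin (?w * x i)"]) auto
  qed (auto intro: sin_poly.intros continuous_on_sin_poly)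
  have "continuous_on (cube I L) f" using f by (rule continuous_on_subset) simp
  from Stone_Weierstrass_basic[OF this e] that show thesis by blast
qed

lemma sin_poly_global_bound:
  assumes L: "L > 0" and h: "sin_poly (pi / (2 * L)) I h" and B: "\<And>x. x \<in> cube I L \<Longrightarrow> \<bar>h x\<bar> \<le> B"
  shows "\<bar>h x\<bar> \<le> B"
proof -
  let ?w = "pi / (2 * L)"
  \<comment> \<open>Folds \<open>x\<close> into the cube without changing any of the sines that
    \<open>h\<close> depends on.\<close>
  define y where "y i = (if i \<in> I then (1 / ?w) * arcsin (sin (?w * x i)) else 0)" for i
  have w: "?w > 0" using L by simp
  have "y \<in> cube I L"
  proof -
    have "\<bar>y i\<bar> \<le> L" if "i \<in> I" for i
    proof -
      have "\<bar>arcsin (sin (?w * x i))\<bar> \<le> pi / 2"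
        using arcsin_lbound[of "sin (?w * x i)"] arcsin_ubound[of "sin (?w * x i)"]
        by (intro abs_leI) simp_all
      then have "(1 / ?w) * \<bar>arcsin (sin (?w * x i))\<bar> \<le> (1 / ?w) * (pi / 2)"
        using w L by (intro mult_left_mono) auto
      then show ?thesis using that L by (simp add: y_def abs_mult)
    qed
    moreover have "y i = 0" if "i \<notin> I" for i using that by (simp add: y_def)
    ultimately show ?thesis by (auto simp: cube_def abs_le_iff minus_le_iff)
  qed
  moreover have "h x = h y"
  proof (rule sin_poly_cong[OF h])
    fix i assume "i \<in> I"
    have "?w * y i = arcsin (sin (?w * x i))" using \<open>i \<in> I\<close> w unfolding y_def by simp
    then show "sin (?w * x i) = sin (?w * y i)" by simp
  qed
  ultimately show ?thesis using B by simp
qed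

lemma trig_sum_continuous_bounded:
  fixes I :: "'i::countable set"
  assumes "trig_sum I h"
  shows "continuous_on UNIV h \<and> (\<exists>B. \<forall>x. \<bar>h x\<bar> \<le> B)"
  using assms
proof induction
  case (wave c u b)
  have "\<bar>c * cos ((\<Sum>i\<in>I. u i * x i) + b)\<bar> \<le> \<bar>c\<bar>" for x
    by (simp add: abs_mult mult_left_le)
  moreover have "continuous_on UNIV (\<lambda>x. c * cos ((\<Sum>i\<in>I. u i * x i) + b))"
    by (intro continuous_on_mult_left continuous_on_cos continuous_on_add continuous_on_sum continuous_on_const)
      (rule continuous_on_product_coordinates)
  ultimately show ?case by blast
next
  case (add g h)
  then obtain B C where "\<And>x. \<bar>g x\<bar> \<le> B" "\<And>x. \<bar>h x\<bar> \<le> C" by auto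
  then have "\<bar>g x + h x\<bar> \<le> B + C" for x using abs_triangle_ineq[of "g x" "h x"] add_mono by (meson order_trans)
  then show ?case using add by (auto intro!: continuous_intros)
qed

lemma (in prob_space) integrable_continuous_function:
  fixes f :: "('i::countable \<Rightarrow> real) \<Rightarrow> real"
  assumes f: "continuous_on UNIV f" "\<And>x. \<bar>f x\<bar> \<le> B"
    and Z: "\<And>i. (\<lambda>\<omega>. Z \<omega> i) \<in> borel_measurable M"
  shows "integrable M (\<lambda>\<omega>. f (Z \<omega>))"
proof (rule integrable_const_bound[of _ B])
  have "Z \<in> borel_measurable M" using Z by (rule measurable_coordinatewise_then_product)
  then show "(\<lambda>\<omega>. f (Z \<omega>)) \<in> borel_measurable M"
    using borel_measurable_continuous_onI[OF f(1)] by (rule measurable_compose)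
qed (use f in auto)

lemma trig_sum_expectation_tendsto:
  fixes \<xi> :: "nat \<Rightarrow> 'w \<Rightarrow> 'i::countable \<Rightarrow> real" and \<zeta> :: "'v \<Rightarrow> 'i \<Rightarrow> real"
  assumes M: "prob_space M" and N: "prob_space N"
    and xi: "\<And>n i. (\<lambda>\<omega>. \<xi> n \<omega> i) \<in> borel_measurable M"
    and zeta: "\<And>i. (\<lambda>\<omega>. \<zeta> \<omega> i) \<in> borel_measurable N"
    and cos: "\<And>u b. (\<lambda>n. \<integral>\<omega>. cos ((\<Sum>i\<in>I. u i * \<xi> n \<omega> i) + b) \<partial>M) \<longlonglongrightarrow> (\<integral>\<omega>. cos ((\<Sum>i\<in>I. u i * \<zeta> \<omega> i) + b) \<partial>N)"
    and h: "trig_sum I h"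
  shows "(\<lambda>n. \<integral>\<omega>. h (\<xi> n \<omega>) \<partial>M) \<longlonglongrightarrow> (\<integral>\<omega>. h (\<zeta> \<omega>) \<partial>N)"
  using h
proof induction
  case (wave c u b)
  show ?case using tendsto_mult_left[OF cos, of c u b] by simp
next
  case (add g h)
  have "integrable M (\<lambda>\<omega>. k (\<xi> n \<omega>))" "integrable N (\<lambda>\<omega>. k (\<zeta> \<omega>))" if "trig_sum I k" for k n
  proof -
    from trig_sum_continuous_bounded[OF that] obtain B where *: "continuous_on UNIV k" "\<And>x. \<bar>k x\<bar> \<le> B"
      by blast
    show "integrable M (\<lambda>\<omega>. k (\<xi> n \<omega>))" "integrable N (\<lambda>\<omega>. k (\<zeta> \<omega>))"
      by (rule prob_space.integrable_continuous_function[OF M * xi],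
          rule prob_space.integrable_continuous_function[OF N * zeta])
  qed
  then show ?case using add by (simp add: tendsto_add)
qed

lemma (in prob_space) expectation_difference_off_event:
  fixes f g :: "'a \<Rightarrow> real"
  assumes int: "integrable M f" "integrable M g" and A: "A \<in> events"
    and close: "\<And>\<omega>. \<omega> \<in> space M \<Longrightarrow> \<omega> \<notin> A \<Longrightarrow> \<bar>f \<omega> - g \<omega>\<bar> \<le> e"
    and B: "\<And>\<omega>. \<omega> \<in> space M \<Longrightarrow> \<bar>f \<omega> - g \<omega>\<bar> \<le> B" and e: "0 \<le> e"
  shows "\<bar>expectation f - expectation g\<bar> \<le> e + B * prob A"
proof -
  have "\<bar>expectation f - expectation g\<bar> = \<bar>expectation (\<lambda>\<omega>. f \<omega> - g \<omega>)\<bar>" using int by simp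
  also have "\<dots> \<le> expectation (\<lambda>\<omega>. \<bar>f \<omega> - g \<omega>\<bar>)" by (rule integral_abs_bound)
  also have "\<dots> \<le> expectation (\<lambda>\<omega>. e + B * indicator A \<omega>)"
  proof (rule integral_mono)
    show "integrable M (\<lambda>\<omega>. e + B * indicator A \<omega>)"
      using A by (intro Bochner_Integration.integrable_add integrable_const integrable_mult_right) (auto simp: emeasure_eq_measure)
    fix \<omega> assume "\<omega> \<in> space M"
    then show "\<bar>f \<omega> - g \<omega>\<bar> \<le> e + B * indicator A \<omega>"
      using close[of \<omega>] B[of \<omega>] e by (cases "\<omega> \<in> A") auto
  qed (use int in auto)
  also have "\<dots> = e + B * prob A"
    using A by (subst Bochner_Integration.integral_add) (auto simp: prob_space emeasure_eq_measure)
  finally show ?thesis .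
qed

text \<open>Levy's continuity theorem for finitely many coordinates, with tightness supplied by
  second moments. On a large cube \<open>f\<close> is approximated by a trigonometric polynomial;
  choosing it among polynomials in sines keeps it bounded off the cube by a constant independent of
  the cube, so rare large values cost little.\<close>

theorem weak_convergence_of_characteristic_functions:
  fixes \<xi> :: "nat \<Rightarrow> 'w \<Rightarrow> 'i::countable \<Rightarrow> real" and \<zeta> :: "'v \<Rightarrow> 'i \<Rightarrow> real"
    and f :: "('i \<Rightarrow> real) \<Rightarrow> real"
  assumes M: "prob_space M" and N: "prob_space N" and I: "finite I"
    and xi: "\<And>n i. (\<lambda>\<omega>. \<xi> n \<omega> i) \<in> borel_measurable M"
    and zeta: "\<And>i. (\<lambda>\<omega>. \<zeta> \<omega> i) \<in> borel_measurable N"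
    and sq: "\<And>n i. i \<in> I \<Longrightarrow> integrable M (\<lambda>\<omega>. (\<xi> n \<omega> i)\<^sup>2)"
      "\<And>n i. i \<in> I \<Longrightarrow> (\<integral>\<omega>. (\<xi> n \<omega> i)\<^sup>2 \<partial>M) \<le> C"
    and cos: "\<And>u b. (\<lambda>n. \<integral>\<omega>. cos ((\<Sum>i\<in>I. u i * \<xi> n \<omega> i) + b) \<partial>M) \<longlonglongrightarrow> (\<integral>\<omega>. cos ((\<Sum>i\<in>I. u i * \<zeta> \<omega> i) + b) \<partial>N)"
    and f: "continuous_on UNIV f" "\<And>x. \<bar>f x\<bar> \<le> B" "\<And>x y. (\<And>i. i \<in> I \<Longrightarrow> x i = y i) \<Longrightarrow> f x = f y"
  shows "(\<lambda>n. \<integral>\<omega>. f (\<xi> n \<omega>) \<partial>M) \<longlonglongrightarrow> (\<integral>\<omega>. f (\<zeta> \<omega>) \<partial>N)"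
proof (rule LIMSEQ_I)
  fix r :: real assume r: "r > 0"
  interpret M: prob_space M by fact
  interpret N: prob_space N by fact
  have B0: "B \<ge> 0" using f(2)[of undefined] by linarith
  \<comment> \<open>The two approximation errors are \<open>2 * e\<close> each and the convergence
    error is below \<open>e\<close>, five in all. The cap at 1 makes \<open>B + 1\<close> a bound
    for the approximant.\<close>
  define e where "e = min 1 (r / 5)"
  have e: "e > 0" "e \<le> 1" "e \<le> r / 5" using r by (auto simp: e_def)
  \<comment> \<open>\<open>D\<close> bounds the difference of \<open>f\<close> and its approximant
    everywhere: \<open>B\<close> plus \<open>B + 1\<close>. An exceptional event of probability
    \<open>e / D\<close> then contributes at most \<open>e\<close>.\<close>
  define D where "D = 2 * B + 1"
  have D: "D > 0" using B0 by (simp add: D_def)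
  define \<eta> where "\<eta> = e / D"
  have eta: "\<eta> > 0" using e D by (simp add: \<eta>_def)
  define A where "A n L = {\<omega> \<in> space M. \<exists>i\<in>I. \<bar>\<xi> n \<omega> i\<bar> > L}" for n and L :: real
  define A' where "A' L = {\<omega> \<in> space N. \<exists>i\<in>I. \<bar>\<zeta> \<omega> i\<bar> > L}" for L :: real
  have [measurable]: "A n L \<in> sets M" "A' L \<in> sets N" for n L
  proof -
    have "A n L = (\<Union>i\<in>I. {\<omega> \<in> space M. \<bar>\<xi> n \<omega> i\<bar> > L})" "A' L = (\<Union>i\<in>I. {\<omega> \<in> space N. \<bar>\<zeta> \<omega> i\<bar> > L})"
      by (auto simp: A_def A'_def)
    then show "A n L \<in> sets M" "A' L \<in> sets N" using I xi zeta by (auto intro!: sets.finite_UN borel_measurable_less borel_measurable_abs)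
  qed
  have A: "M.prob (A n L) \<le> real (card I) * C / L\<^sup>2" if L: "L > 0" for n L
  proof -
    have "M.prob (A n L) \<le> (\<Sum>i\<in>I. M.prob {\<omega> \<in> space M. \<bar>\<xi> n \<omega> i\<bar> > L})"
    proof -
      have "A n L = (\<Union>i\<in>I. {\<omega> \<in> space M. \<bar>\<xi> n \<omega> i\<bar> > L})" by (auto simp: A_def)
      then show ?thesis using I xi by (auto intro!: M.finite_measure_subadditive_finite borel_measurable_less borel_measurable_abs)
    qed
    also have "\<dots> \<le> (\<Sum>i\<in>I. C / L\<^sup>2)"
    proof (rule sum_mono)
      fix i assume i: "i \<in> I"
      have "M.prob {\<omega> \<in> space M. \<bar>\<xi> n \<omega> i\<bar> > L} \<le> M.prob {\<omega> \<in> space M. (\<xi> n \<omega> i)\<^sup>2 \<ge> L\<^sup>2}"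
        using L xi by (intro M.finite_measure_mono) (auto simp flip: abs_le_square_iff)
      also have "\<dots> \<le> (\<integral>\<omega>. (\<xi> n \<omega> i)\<^sup>2 \<partial>M) / L\<^sup>2"
        using L by (intro integral_Markov_inequality_measure[where A="{}"] sq i) auto
      also have "\<dots> \<le> C / L\<^sup>2" using sq(2)[OF i] by (intro divide_right_mono) auto
      finally show "M.prob {\<omega> \<in> space M. \<bar>\<xi> n \<omega> i\<bar> > L} \<le> C / L\<^sup>2" .
    qed
    finally show ?thesis by simp
  qed
  have "(\<lambda>k. real (card I) * C / (real k)\<^sup>2) \<longlonglongrightarrow> 0" by real_asymp
  then have ev1: "\<forall>\<^sub>F k in sequentially. real (card I) * C / (real k)\<^sup>2 < \<eta>" using eta by (rule order_tendstoD)
  \<comment> \<open>The prelimit tails were bounded by Chebyshev; for the single vector \<zeta>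
    continuity from above takes its place.\<close>
  have "(\<lambda>k. N.prob (A' (real k))) \<longlonglongrightarrow> N.prob (\<Inter>k. A' (real k))"
  proof (intro N.finite_Lim_measure_decseq)
    show "decseq (\<lambda>k. A' (real k))" unfolding decseq_def
    proof (intro allI impI subsetI)
      fix m n :: nat and \<omega> assume "m \<le> n" "\<omega> \<in> A' (real n)"
      then obtain i where "i \<in> I" "\<bar>\<zeta> \<omega> i\<bar> > real n" "\<omega> \<in> space N" by (auto simp: A'_def)
      then have "i \<in> I \<and> \<bar>\<zeta> \<omega> i\<bar> > real m" "\<omega> \<in> space N" using \<open>m \<le> n\<close> by auto
      then show "\<omega> \<in> A' (real m)" unfolding A'_def by blast
    qed
  qed auto
  moreover have "(\<Inter>k. A' (real k)) = {}"
  proof -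
    have False if w: "\<And>k. \<omega> \<in> A' (real k)" for \<omega>
    proof -
      obtain k where k: "(\<Sum>i\<in>I. \<bar>\<zeta> \<omega> i\<bar>) \<le> real k" using real_arch_simple by blast
      obtain i where "i \<in> I" "\<bar>\<zeta> \<omega> i\<bar> > real k" using w[of k] by (auto simp: A'_def)
      then show False using k member_le_sum[of i I "\<lambda>i. \<bar>\<zeta> \<omega> i\<bar>"] I by force
    qed
    then show ?thesis by blast
  qed
  ultimately have "(\<lambda>k. N.prob (A' (real k))) \<longlonglongrightarrow> 0" by simp
  then have ev2: "\<forall>\<^sub>F k in sequentially. N.prob (A' (real k)) < \<eta>" using eta by (rule order_tendstoD)
  from eventually_happens[OF eventually_conj[OF eventually_conj[OF ev1 ev2] eventually_gt_at_top[of 0]]]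
  obtain k :: nat where k: "real (card I) * C / (real k)\<^sup>2 < \<eta>" "N.prob (A' (real k)) < \<eta>" "k > 0" by auto
  define L where "L = real k"
  have L: "L > 0" using k by (simp add: L_def)
  have P: "M.prob (A n L) \<le> \<eta>" "N.prob (A' L) \<le> \<eta>" for n using A[OF L, of n] k by (auto simp: L_def)
  obtain h where h: "sin_poly (pi / (2 * L)) I h" "\<And>x. x \<in> cube I L \<Longrightarrow> \<bar>f x - h x\<bar> < e"
    using sin_poly_dense[OF L f(1) e(1)] by blast
  \<comment> \<open>On the cube the bound comes from closeness to \<open>f\<close>; the folding
    argument extends it to the whole space.\<close>
  have hb: "\<bar>h x\<bar> \<le> B + 1" for x
  proof (rule sin_poly_global_bound[OF L h(1)])
    fix y assume "y \<in> cube I L"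
    then show "\<bar>h y\<bar> \<le> B + 1" using h(2)[of y] f(2)[of y] e by linarith
  qed
  have trig: "trig_sum I h" by (rule sin_poly_trig_sum[OF I h(1)])
  have hc: "continuous_on UNIV h" using trig_sum_continuous_bounded[OF trig] by blast
  have close: "\<bar>f x - h x\<bar> \<le> e" if "\<And>i. i \<in> I \<Longrightarrow> \<bar>x i\<bar> \<le> L" for x
  proof -
    define y where "y i = (if i \<in> I then x i else 0)" for i
    have "y \<in> cube I L" using that by (auto simp: cube_def y_def abs_le_iff minus_le_iff)
    moreover have "f x = f y" by (rule f(3)) (simp add: y_def)
    moreover have "h x = h y" by (rule sin_poly_cong[OF h(1)]) (simp add: y_def)
    ultimately show ?thesis using h(2)[of y] by simp
  qed
  have fh: "\<bar>f x - h x\<bar> \<le> D" for x using f(2)[of x] hb[of x] by (simp add: D_def)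
  have in_A: "\<omega> \<in> A n L \<longleftrightarrow> \<omega> \<in> space M \<and> (\<exists>i\<in>I. \<bar>\<xi> n \<omega> i\<bar> > L)" for n \<omega> by (simp add: A_def)
  have in_A': "\<omega> \<in> A' L \<longleftrightarrow> \<omega> \<in> space N \<and> (\<exists>i\<in>I. \<bar>\<zeta> \<omega> i\<bar> > L)" for \<omega> by (simp add: A'_def)
  have 1: "\<bar>(\<integral>\<omega>. f (\<xi> n \<omega>) \<partial>M) - (\<integral>\<omega>. h (\<xi> n \<omega>) \<partial>M)\<bar> \<le> 2 * e" for n
  proof -
    have "\<bar>(\<integral>\<omega>. f (\<xi> n \<omega>) \<partial>M) - (\<integral>\<omega>. h (\<xi> n \<omega>) \<partial>M)\<bar> \<le> e + D * M.prob (A n L)"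
      using e by (intro M.expectation_difference_off_event M.integrable_continuous_function[OF f(1,2)]
        M.integrable_continuous_function[OF hc hb] xi fh close)
        (use \<open>A n L \<in> sets M\<close> in \<open>auto simp: in_A not_less\<close>)
    also have "\<dots> \<le> e + D * \<eta>" using P D by (intro add_left_mono mult_left_mono) auto
    finally show ?thesis using D by (simp add: \<eta>_def)
  qed
  have 2: "\<bar>(\<integral>\<omega>. f (\<zeta> \<omega>) \<partial>N) - (\<integral>\<omega>. h (\<zeta> \<omega>) \<partial>N)\<bar> \<le> 2 * e"
  proof -
    have "\<bar>(\<integral>\<omega>. f (\<zeta> \<omega>) \<partial>N) - (\<integral>\<omega>. h (\<zeta> \<omega>) \<partial>N)\<bar> \<le> e + D * N.prob (A' L)"
      using e by (intro N.expectation_difference_off_event N.integrable_continuous_function[OF f(1,2)]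
        N.integrable_continuous_function[OF hc hb] zeta fh close)
        (use \<open>A' L \<in> sets N\<close> in \<open>auto simp: in_A' not_less\<close>)
    also have "\<dots> \<le> e + D * \<eta>" using P D by (intro add_left_mono mult_left_mono) auto
    finally show ?thesis using D by (simp add: \<eta>_def)
  qed
  have "(\<lambda>n. \<integral>\<omega>. h (\<xi> n \<omega>) \<partial>M) \<longlonglongrightarrow> (\<integral>\<omega>. h (\<zeta> \<omega>) \<partial>N)"
    by (rule trig_sum_expectation_tendsto[OF M N xi zeta cos trig])
  from LIMSEQ_D[OF this e(1)] obtain n0 where n0: "\<And>n. n \<ge> n0 \<Longrightarrow> \<bar>(\<integral>\<omega>. h (\<xi> n \<omega>) \<partial>M) - (\<integral>\<omega>. h (\<zeta> \<omega>) \<partial>N)\<bar> < e"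
    by auto
  show "\<exists>no. \<forall>n\<ge>no. norm ((\<integral>\<omega>. f (\<xi> n \<omega>) \<partial>M) - (\<integral>\<omega>. f (\<zeta> \<omega>) \<partial>N)) < r"
  proof (intro exI[of _ n0] allI impI)
    fix n assume "n \<ge> n0"
    then show "norm ((\<integral>\<omega>. f (\<xi> n \<omega>) \<partial>M) - (\<integral>\<omega>. f (\<zeta> \<omega>) \<partial>N)) < r"
      using n0[OF \<open>n \<ge> n0\<close>] 1[of n] 2 e unfolding real_norm_def by linarith
  qed
qed

section \<open>Characteristic functions of block sums\<close>

text \<open>The analytic core of the central limit theorem, for a power \<open>s n\<close>
  proportional to \<open>n\<close> as needed for one block. The characteristic function is compared
  with its quadratic expansion: powers of two numbers in the unit disc differ by at most the
  exponent times their distance, which is small compared with \<open>1 / n\<close>. The variance may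
  be 0.\<close>

lemma (in prob_space) char_power_tendsto:
  fixes X :: "'a \<Rightarrow> real" and s :: "nat \<Rightarrow> nat"
  assumes rv: "X \<in> borel_measurable M" and sq: "integrable M (\<lambda>\<omega>. (X \<omega>)\<^sup>2)" and mean: "expectation X = 0"
    and s: "(\<lambda>n. real (s n) / real n) \<longlonglongrightarrow> \<tau>"
  shows "(\<lambda>n. char (distr M borel X) (1 / sqrt (real n)) ^ s n) \<longlonglongrightarrow>
    complex_of_real (exp (- (\<tau> * expectation (\<lambda>\<omega>. (X \<omega>)\<^sup>2) / 2)))"
proof -
  define \<sigma>2 where "\<sigma>2 = expectation (\<lambda>\<omega>. (X \<omega>)\<^sup>2)"
  have s2: "\<sigma>2 \<ge> 0" by (simp add: \<sigma>2_def)
  have int: "integrable M X" using square_integrable_imp_integrable[OF rv sq] .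
  define \<phi> where "\<phi> n = char (distr M borel X) (1 / sqrt (real n))" for n
  define \<psi> where "\<psi> n = 1 - \<sigma>2 / (2 * real n)" for n
  \<comment> \<open>The remainder of the second-order expansion after extracting
    \<open>1 / n\<close>. The minimum tends to 0 pointwise and is dominated by six times the square,
    so no third moment enters.\<close>
  define \<rho> where "\<rho> n = expectation (\<lambda>x. min (6 * (X x)\<^sup>2) (\<bar>1 / sqrt (real n)\<bar> * \<bar>X x\<bar> ^ 3))" for n
  interpret D: real_distribution "distr M borel X" using rv by simp
  have bound: "norm (\<phi> n - complex_of_real (\<psi> n)) \<le> 1 / (6 * real n) * \<rho> n" for n
  proof -
    have "variance X = \<sigma>2" by (simp add: mean \<sigma>2_def)
    from char_approx3'[OF rv int sq mean this refl, of "1 / sqrt (real n)"]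
    show ?thesis by (simp add: \<phi>_def \<psi>_def \<rho>_def power_divide mult.commute)
  qed
  have rho: "\<rho> \<longlonglongrightarrow> 0"
  proof -
    have "(\<lambda>n. min (6 * x\<^sup>2) (\<bar>1 / sqrt (real n)\<bar> * \<bar>x\<bar> ^ 3)) \<longlonglongrightarrow> 0" for x :: real
    proof -
      have "(\<lambda>n. \<bar>1 / sqrt (real n)\<bar> * \<bar>x\<bar> ^ 3) \<longlonglongrightarrow> 0" by real_asymp
      then have "(\<lambda>n. min (6 * x\<^sup>2) (\<bar>1 / sqrt (real n)\<bar> * \<bar>x\<bar> ^ 3)) \<longlonglongrightarrow> min (6 * x\<^sup>2) 0"
        by (intro tendsto_min tendsto_const)
      then show ?thesis by (simp add: min_absorb2)
    qed
    then have "\<rho> \<longlonglongrightarrow> expectation (\<lambda>x. 0)"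
      unfolding \<rho>_def using rv sq
      by (intro integral_dominated_convergence[where w = "\<lambda>x. 6 * (X x)\<^sup>2"]) auto
    then show ?thesis by simp
  qed
  \<comment> \<open>From here on \<psi> lies between 1/2 and 1: in the unit disc, as the comparison
    of powers requires, and positive, so that its logarithm makes sense.\<close>
  have ev: "\<forall>\<^sub>F n in sequentially. \<sigma>2 \<le> real n \<and> n > 0"
    by (intro eventually_conj eventually_gt_at_top)
      (use filterlim_real_sequentially in \<open>auto simp: filterlim_at_top\<close>)
  have diff: "(\<lambda>n. \<phi> n ^ s n - complex_of_real (\<psi> n) ^ s n) \<longlonglongrightarrow> 0"
  proof (rule Lim_null_comparison)
    show "\<forall>\<^sub>F n in sequentially. norm (\<phi> n ^ s n - complex_of_real (\<psi> n) ^ s n) \<le> (real (s n) / real n) * (\<rho> n / 6)"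
      using ev
    proof eventually_elim
      case (elim n)
      have "norm (complex_of_real (\<psi> n)) \<le> 1"
        using elim s2 by (auto simp: \<psi>_def abs_le_iff divide_le_eq simp del: of_real_diff)
      then have "norm (\<phi> n ^ s n - complex_of_real (\<psi> n) ^ s n) \<le> s n * norm (\<phi> n - complex_of_real (\<psi> n))"
        by (intro norm_power_diff) (auto simp: \<phi>_def D.cmod_char_le_1)
      also have "\<dots> \<le> s n * (1 / (6 * real n) * \<rho> n)" by (intro mult_left_mono bound) simp
      finally show ?case by simp
    qed
    have "(\<lambda>n. (real (s n) / real n) * (\<rho> n / 6)) \<longlonglongrightarrow> \<tau> * (0 / 6)"
      by (intro tendsto_intros s rho) simp
    then show "(\<lambda>n. (real (s n) / real n) * (\<rho> n / 6)) \<longlonglongrightarrow> 0" by simp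
  qed
  have "(\<lambda>n. \<psi> n ^ s n) \<longlonglongrightarrow> exp (- (\<tau> * \<sigma>2 / 2))"
  proof -
    have "(\<lambda>n. real n * ln (1 - \<sigma>2 / (2 * real n))) \<longlonglongrightarrow> - (\<sigma>2 / 2)"
      by real_asymp
    then have "(\<lambda>n. exp ((real (s n) / real n) * (real n * ln (\<psi> n)))) \<longlonglongrightarrow> exp (\<tau> * (- (\<sigma>2 / 2)))"
      unfolding \<psi>_def by (intro tendsto_intros s)
    moreover have "\<forall>\<^sub>F n in sequentially. exp ((real (s n) / real n) * (real n * ln (\<psi> n))) = \<psi> n ^ s n"
      using ev
    proof eventually_elim
      case (elim n)
      have "\<psi> n > 0" using elim s2 by (auto simp: \<psi>_def divide_less_eq)
      then show ?case using elim by (simp add: exp_of_nat_mult)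
    qed
    ultimately show ?thesis by (simp add: tendsto_cong)
  qed
  then have "(\<lambda>n. complex_of_real (\<psi> n ^ s n)) \<longlonglongrightarrow> complex_of_real (exp (- (\<tau> * \<sigma>2 / 2)))"
    by (rule tendsto_of_real)
  then have "(\<lambda>n. (\<phi> n ^ s n - complex_of_real (\<psi> n) ^ s n) + complex_of_real (\<psi> n ^ s n)) \<longlonglongrightarrow>
      0 + complex_of_real (exp (- (\<tau> * \<sigma>2 / 2)))"
    by (intro tendsto_add diff)
  then show ?thesis by (simp add: \<phi>_def \<sigma>2_def)
qed

lemma char_centered_normal:
  assumes "v \<ge> 0"
  shows "char (centered_normal v) t = complex_of_real (exp (- (v * t\<^sup>2 / 2)))"
proof (cases "v = 0")
  case True
  have "char (return borel 0) t = 1" unfolding char_def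
    by (subst integral_return) auto
  then show ?thesis using True by (simp add: centered_normal_def)
next
  case False
  then have v: "sqrt v > 0" using assms by simp
  interpret S: prob_space std_normal_distribution
    using prob_space_normal_density[of 1 0] by simp
  have "distributed std_normal_distribution lborel (\<lambda>x. x) (\<lambda>x. ennreal (std_normal_density x))"
    by (auto simp: distributed_def distr_id2 intro!: measure_eqI simp: emeasure_density)
  then have "distributed std_normal_distribution lborel (\<lambda>x. 0 + sqrt v * x) (\<lambda>x. ennreal (normal_density (0 + sqrt v * 0) (\<bar>sqrt v\<bar> * 1) x))"
    by (rule S.normal_density_affine) (use v in auto)
  then have d: "distr std_normal_distribution borel (\<lambda>x. sqrt v * x) = centered_normal v"
    using v assms False by (simp add: distributed_def centered_normal_def distr_cong[OF refl sets_lborel refl])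
  have "char (centered_normal v) t = (CLINT x|std_normal_distribution. iexp (t * (sqrt v * x)))"
    unfolding d[symmetric] char_def by (subst integral_distr) auto
  also have "\<dots> = char std_normal_distribution (t * sqrt v)" by (simp add: char_def mult.assoc)
  also have "\<dots> = complex_of_real (exp (- ((t * sqrt v)\<^sup>2 / 2)))"
    by (simp add: char_std_normal_distribution)
  finally show ?thesis using assms by (simp add: power_mult_distrib mult.commute)
qed

definition grid :: "nat \<Rightarrow> nat \<Rightarrow> nat \<Rightarrow> nat" where
  "grid J n j = n * j div J"

lemma grid_0 [simp]: "grid J n 0 = 0" by (simp add: grid_def)

lemma grid_last [simp]: "J > 0 \<Longrightarrow> grid J n J = n" by (simp add: grid_def)

lemma grid_mono: "i \<le> j \<Longrightarrow> grid J n i \<le> grid J n j"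
  by (auto simp: grid_def intro: div_le_mono)

lemma grid_le: "j \<le> J \<Longrightarrow> grid J n j \<le> n"
  using grid_mono[of j J J n] by (cases "J = 0") auto

lemma grid_bounds:
  assumes "J > 0"
  shows "real (grid J n j) \<le> real n * real j / real J" "real n * real j / real J < real (grid J n j) + 1"
proof -
  show "real (grid J n j) \<le> real n * real j / real J"
    using of_nat_div_le_of_nat[of "n * j" J, where 'a=real] by (simp add: grid_def)
  have "n * j < (grid J n j + 1) * J"
    using assms dividend_less_div_times[of J "n * j"] by (simp add: grid_def algebra_simps)
  then have "real (n * j) < real ((grid J n j + 1) * J)" by (rule of_nat_less_iff[THEN iffD2])
  then show "real n * real j / real J < real (grid J n j) + 1"
    using assms by (simp add: divide_less_eq algebra_simps)
qed

lemma grid_block_tendsto: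
  assumes J: "J > 0"
  shows "(\<lambda>n. real (grid J n (Suc j) - grid J n j) / real n) \<longlonglongrightarrow> 1 / real J"
proof -
  have *: "(\<lambda>n. real (grid J n i) / real n) \<longlonglongrightarrow> real i / real J" for i
  proof (rule tendsto_sandwich)
    show "\<forall>\<^sub>F n in sequentially. real (grid J n i) / real n \<le> real i / real J"
      using eventually_gt_at_top[of 0]
      by eventually_elim (use grid_bounds(1)[OF J, of _ i] in \<open>auto simp: divide_le_eq mult_ac\<close>)
    show "\<forall>\<^sub>F n in sequentially. real i / real J - 1 / real n \<le> real (grid J n i) / real n"
      using eventually_gt_at_top[of 0]
    proof eventually_elim
      case (elim n)
      have "real n * real i / real J - 1 \<le> real (grid J n i)" using grid_bounds(2)[OF J, of n i] by simp
      then have "(real n * real i / real J - 1) / real n \<le> real (grid J n i) / real n"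
        by (intro divide_right_mono) auto
      then show ?case using elim by (simp add: diff_divide_distrib)
    qed
    show "(\<lambda>n. real i / real J - 1 / real n) \<longlonglongrightarrow> real i / real J" by real_asymp
  qed simp
  have "(\<lambda>n. real (grid J n (Suc j)) / real n - real (grid J n j) / real n) \<longlonglongrightarrow> real (Suc j) / real J - real j / real J"
    by (intro tendsto_diff *)
  moreover have "real (grid J n (Suc j)) / real n - real (grid J n j) / real n = real (grid J n (Suc j) - grid J n j) / real n" for n
    using grid_mono[of j "Suc j" J n] by (simp add: of_nat_diff diff_divide_distrib)
  moreover have "real (Suc j) / real J - real j / real J = 1 / real J"
    by (simp flip: diff_divide_distrib)
  ultimately show ?thesis by (simp only:)
qed

lemma prod_blocks:
  fixes k :: "nat \<Rightarrow> nat"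
  assumes "\<And>j. k j \<le> k (Suc j)"
  shows "(\<Prod>j<J. \<Prod>i\<in>{k j<..k (Suc j)}. g i) = (\<Prod>i\<in>{k 0<..k J}. g i :: 'b::comm_monoid_mult)"
proof (induction J)
  case (Suc J)
  have "k 0 \<le> k J" by (rule lift_Suc_mono_le[of k, OF assms]) simp
  then have "{k 0<..k (Suc J)} = {k 0<..k J} \<union> {k J<..k (Suc J)}" using assms[of J] by auto
  then have "(\<Prod>i\<in>{k 0<..k (Suc J)}. g i) = (\<Prod>i\<in>{k 0<..k J}. g i) * (\<Prod>i\<in>{k J<..k (Suc J)}. g i)"
    by (simp add: prod.union_disjoint)
  then show ?case using Suc by simp
qed simp

lemma sum_blocks:
  fixes k :: "nat \<Rightarrow> nat"
  assumes "\<And>j. k j \<le> k (Suc j)"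
  shows "(\<Sum>j<J. \<Sum>i\<in>{k j<..k (Suc j)}. g i) = (\<Sum>i\<in>{k 0<..k J}. g i :: 'b::comm_monoid_add)"
proof (induction J)
  case (Suc J)
  have "k 0 \<le> k J" by (rule lift_Suc_mono_le[of k, OF assms]) simp
  then have "{k 0<..k (Suc J)} = {k 0<..k J} \<union> {k J<..k (Suc J)}" using assms[of J] by auto
  then have "(\<Sum>i\<in>{k 0<..k (Suc J)}. g i) = (\<Sum>i\<in>{k 0<..k J}. g i) + (\<Sum>i\<in>{k J<..k (Suc J)}. g i)"
    by (simp add: sum.union_disjoint)
  then show ?case using Suc by simp
qed simp

section \<open>Random walks with centered square integrable steps\<close>

locale centered_walk = prob_space M for M :: "'w measure" +
  fixes \<xi> :: "nat \<Rightarrow> 'w \<Rightarrow> real ^ 'n"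
  assumes indep: "indep_vars (\<lambda>_. borel) \<xi> {1..}"
    and ident: "\<And>i. i \<ge> 1 \<Longrightarrow> distr M borel (\<xi> i) = distr M borel (\<xi> 1)"
    and square_integrable: "integrable M (\<lambda>\<omega>. (norm (\<xi> 1 \<omega>))\<^sup>2)"
    and mean: "expectation (\<xi> 1) = 0"
begin

text \<open>Half-open index sets make consecutive blocks disjoint and let them concatenate.\<close>

definition W :: "nat \<Rightarrow> 'w \<Rightarrow> real ^ 'n" where
  "W k \<omega> = (\<Sum>i\<in>{0<..k}. \<xi> i \<omega>)"

lemma xi_measurable: "i \<ge> 1 \<Longrightarrow> \<xi> i \<in> borel_measurable M"
  using indep by (auto simp: indep_vars_def2)

lemma W_measurable [measurable]: "W k \<in> borel_measurable M"
  unfolding W_def using xi_measurable by (intro borel_measurable_sum) auto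

lemma W_diff: "k \<le> l \<Longrightarrow> W l \<omega> - W k \<omega> = (\<Sum>i\<in>{k<..l}. \<xi> i \<omega>)"
proof -
  assume "k \<le> l"
  then have "{0<..l} = {0<..k} \<union> {k<..l}" by auto
  then show ?thesis by (simp add: W_def sum.union_disjoint)
qed

lemma integral_xi:
  fixes h :: "real ^ 'n \<Rightarrow> 'b::{banach, second_countable_topology}"
  assumes "i \<ge> 1" "h \<in> borel_measurable borel"
  shows "integral\<^sup>L M (\<lambda>\<omega>. h (\<xi> i \<omega>)) = integral\<^sup>L M (\<lambda>\<omega>. h (\<xi> 1 \<omega>))"
  using integral_distr[OF xi_measurable[OF assms(1)] assms(2)] integral_distr[OF xi_measurable[of 1] assms(2)]
    ident[OF assms(1)] by simp

lemma integrable_xi: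
  fixes h :: "real ^ 'n \<Rightarrow> 'b::{banach, second_countable_topology}"
  assumes "i \<ge> 1" "h \<in> borel_measurable borel"
  shows "integrable M (\<lambda>\<omega>. h (\<xi> i \<omega>)) \<longleftrightarrow> integrable M (\<lambda>\<omega>. h (\<xi> 1 \<omega>))"
  using integrable_distr_eq[OF xi_measurable[OF assms(1)] assms(2)] integrable_distr_eq[OF xi_measurable[of 1] assms(2)]
    ident[OF assms(1)] by simp

lemma xi_integrable: "i \<ge> 1 \<Longrightarrow> integrable M (\<xi> i)"
proof -
  have [measurable]: "\<xi> 1 \<in> borel_measurable M" by (rule xi_measurable) simp
  have "integrable M (\<lambda>\<omega>. norm (\<xi> 1 \<omega>))"
    by (rule square_integrable_imp_integrable[OF _ square_integrable]) measurable
  then have "integrable M (\<xi> 1)" using integrable_norm_iff[OF xi_measurable[of 1]] by simp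
  then show "i \<ge> 1 \<Longrightarrow> integrable M (\<xi> i)" using integrable_xi[of i "\<lambda>x. x"] by simp
qed

lemma xi_mean: "i \<ge> 1 \<Longrightarrow> expectation (\<xi> i) = 0"
  using integral_xi[of i "\<lambda>x. x"] mean by simp

lemma xi_square_integrable: "i \<ge> 1 \<Longrightarrow> integrable M (\<lambda>\<omega>. (norm (\<xi> i \<omega>))\<^sup>2)"
  using integrable_xi[of i "\<lambda>x. (norm x)\<^sup>2"] square_integrable by simp

lemma inner_square_integrable: "i \<ge> 1 \<Longrightarrow> integrable M (\<lambda>\<omega>. (v \<bullet> \<xi> i \<omega>)\<^sup>2)"
proof (rule Bochner_Integration.integrable_bound)
  assume i: "i \<ge> 1"
  show "integrable M (\<lambda>\<omega>. (norm v)\<^sup>2 * (norm (\<xi> i \<omega>))\<^sup>2)"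
    by (intro integrable_mult_right xi_square_integrable i)
  show "(\<lambda>\<omega>. (v \<bullet> \<xi> i \<omega>)\<^sup>2) \<in> borel_measurable M" using xi_measurable[OF i] by measurable
  have "\<bar>v \<bullet> x\<bar>\<^sup>2 \<le> (norm v * norm x)\<^sup>2" for x
    by (intro power_mono Cauchy_Schwarz_ineq2) simp
  then show "AE \<omega> in M. norm ((v \<bullet> \<xi> i \<omega>)\<^sup>2) \<le> norm ((norm v)\<^sup>2 * (norm (\<xi> i \<omega>))\<^sup>2)"
    by (simp add: power_mult_distrib)
qed

lemma char_weighted_sum:
  fixes v :: "nat \<Rightarrow> real ^ 'n"
  shows "char (distr M borel (\<lambda>\<omega>. \<Sum>k\<in>{0<..n}. v k \<bullet> \<xi> k \<omega>)) t =
    (\<Prod>k\<in>{0<..n}. char (distr M borel (\<lambda>\<omega>. v k \<bullet> \<xi> 1 \<omega>)) t)"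
proof -
  have "indep_vars (\<lambda>_. borel) (\<lambda>k \<omega>. v k \<bullet> \<xi> k \<omega>) {0<..n}"
    by (rule indep_vars_compose2[where Y="\<lambda>k x. v k \<bullet> x" and X=\<xi> and M'="\<lambda>_. borel"], rule indep_vars_subset[OF indep]) auto
  from char_distr_sum[OF this] have "char (distr M borel (\<lambda>\<omega>. \<Sum>k\<in>{0<..n}. v k \<bullet> \<xi> k \<omega>)) t =
    (\<Prod>k\<in>{0<..n}. char (distr M borel (\<lambda>\<omega>. v k \<bullet> \<xi> k \<omega>)) t)" .
  also have "char (distr M borel (\<lambda>\<omega>. v k \<bullet> \<xi> k \<omega>)) t = char (distr M borel (\<lambda>\<omega>. v k \<bullet> \<xi> 1 \<omega>)) t" if "k \<in> {0<..n}" for k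
    using that xi_measurable[of k] xi_measurable[of 1] integral_xi[of k "\<lambda>x. iexp (t * (v k \<bullet> x))"]
    by (simp add: char_def integral_distr)
  then have "(\<Prod>k\<in>{0<..n}. char (distr M borel (\<lambda>\<omega>. v k \<bullet> \<xi> k \<omega>)) t) = (\<Prod>k\<in>{0<..n}. char (distr M borel (\<lambda>\<omega>. v k \<bullet> \<xi> 1 \<omega>)) t)"
    by (intro prod.cong) auto
  finally show ?thesis .
qed

text \<open>Give each step the weight of its block. The linear combination of block sums is then one
  weighted sum of independent steps, whose characteristic function factors step by step and regroups
  into one power per block.\<close>

lemma char_blocks_tendsto:
  fixes v :: "nat \<Rightarrow> real ^ 'n"
  assumes J: "J > 0"
  shows "(\<lambda>n. CLINT \<omega>|M. iexp (\<Sum>j<J. v j \<bullet> ((W (grid J n (Suc j)) \<omega> - W (grid J n j) \<omega>) /\<^sub>R sqrt (real n)))) \<longlonglongrightarrow>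
    (\<Prod>j<J. complex_of_real (exp (- (1 / real J * expectation (\<lambda>\<omega>. (v j \<bullet> \<xi> 1 \<omega>)\<^sup>2) / 2))))"
proof -
  have "(CLINT \<omega>|M. iexp (\<Sum>j<J. v j \<bullet> ((W (grid J n (Suc j)) \<omega> - W (grid J n j) \<omega>) /\<^sub>R sqrt (real n)))) =
    (\<Prod>j<J. char (distr M borel (\<lambda>\<omega>. v j \<bullet> \<xi> 1 \<omega>)) (1 / sqrt (real n)) ^ (grid J n (Suc j) - grid J n j))" for n
  proof -
    \<comment> \<open>Recovers the block of a step. If \<open>n < J\<close> some blocks are empty,
      but each step from 1 to \<open>n\<close> lies in exactly one.\<close>
    define b where "b k = (LEAST j. k \<le> grid J n (Suc j))" for k
    have b: "b k = j" if "k \<in> {grid J n j<..grid J n (Suc j)}" for j k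
      unfolding b_def
    proof (rule Least_equality)
      show "k \<le> grid J n (Suc j)" using that by simp
      fix i assume i: "k \<le> grid J n (Suc i)"
      show "j \<le> i"
      proof (rule ccontr)
        assume "\<not> j \<le> i"
        then have "grid J n (Suc i) \<le> grid J n j" by (intro grid_mono) simp
        then show False using i that by simp
      qed
    qed
    have gm: "\<And>j. grid J n j \<le> grid J n (Suc j)" by (rule grid_mono) simp
    have "(\<Sum>j<J. v j \<bullet> ((W (grid J n (Suc j)) \<omega> - W (grid J n j) \<omega>) /\<^sub>R sqrt (real n))) =
      1 / sqrt (real n) * (\<Sum>k\<in>{0<..n}. v (b k) \<bullet> \<xi> k \<omega>)" for \<omega>
    proof -
      have "(\<Sum>j<J. v j \<bullet> ((W (grid J n (Suc j)) \<omega> - W (grid J n j) \<omega>) /\<^sub>R sqrt (real n))) =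
        1 / sqrt (real n) * (\<Sum>j<J. \<Sum>k\<in>{grid J n j<..grid J n (Suc j)}. v j \<bullet> \<xi> k \<omega>)"
        by (simp add: W_diff[OF gm] inner_sum_right sum_distrib_left divide_inverse)
      also have "(\<Sum>j<J. \<Sum>k\<in>{grid J n j<..grid J n (Suc j)}. v j \<bullet> \<xi> k \<omega>) =
        (\<Sum>j<J. \<Sum>k\<in>{grid J n j<..grid J n (Suc j)}. v (b k) \<bullet> \<xi> k \<omega>)"
        by (intro sum.cong refl) (simp add: b)
      also have "\<dots> = (\<Sum>k\<in>{0<..n}. v (b k) \<bullet> \<xi> k \<omega>)" 
        using sum_blocks[where k="grid J n" and J=J and g="\<lambda>k. v (b k) \<bullet> \<xi> k \<omega>", OF gm]
        by (simp only: grid_0 grid_last[OF J])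
      finally show ?thesis .
    qed
    then have "(CLINT \<omega>|M. iexp (\<Sum>j<J. v j \<bullet> ((W (grid J n (Suc j)) \<omega> - W (grid J n j) \<omega>) /\<^sub>R sqrt (real n)))) =
      char (distr M borel (\<lambda>\<omega>. \<Sum>k\<in>{0<..n}. v (b k) \<bullet> \<xi> k \<omega>)) (1 / sqrt (real n))"
      unfolding char_def by (subst integral_distr) (auto intro!: borel_measurable_sum borel_measurable_inner xi_measurable)
    also have "\<dots> = (\<Prod>j<J. \<Prod>k\<in>{grid J n j<..grid J n (Suc j)}. char (distr M borel (\<lambda>\<omega>. v (b k) \<bullet> \<xi> 1 \<omega>)) (1 / sqrt (real n)))"
      unfolding char_weighted_sum
      using prod_blocks[where k="grid J n" and J=J and g="\<lambda>k. char (distr M borel (\<lambda>\<omega>. v (b k) \<bullet> \<xi> 1 \<omega>)) (1 / sqrt (real n))", OF gm]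
      by (simp only: grid_0 grid_last[OF J])
    also have "\<dots> = (\<Prod>j<J. \<Prod>k\<in>{grid J n j<..grid J n (Suc j)}. char (distr M borel (\<lambda>\<omega>. v j \<bullet> \<xi> 1 \<omega>)) (1 / sqrt (real n)))"
      by (intro prod.cong refl) (simp add: b)
    finally show ?thesis by simp
  qed
  moreover have "(\<lambda>n. \<Prod>j<J. char (distr M borel (\<lambda>\<omega>. v j \<bullet> \<xi> 1 \<omega>)) (1 / sqrt (real n)) ^ (grid J n (Suc j) - grid J n j)) \<longlonglongrightarrow>
    (\<Prod>j<J. complex_of_real (exp (- (1 / real J * expectation (\<lambda>\<omega>. (v j \<bullet> \<xi> 1 \<omega>)\<^sup>2) / 2))))"
    using xi_measurable[of 1] xi_integrable[of 1] mean
    by (intro tendsto_prod char_power_tendsto grid_block_tendsto J inner_square_integrable)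
      (auto simp: integral_inner_right)
  ultimately show ?thesis by simp
qed

end

section \<open>Moment and maximal inequalities\<close>

text \<open>A second-order upper bound on the whole interval from -1 to 3, which is the range of
  relative changes of a squared norm when the added vector is shorter than the given one. Away from
  0 a crude bound suffices; near 0 the difference of the two sides is convex.\<close>

lemma powr_one_plus_le:
  fixes r :: real
  assumes r: "r \<ge> 1"
  obtains K where "K \<ge> 0" "\<And>t. -1 \<le> t \<Longrightarrow> t \<le> 3 \<Longrightarrow> (1 + t) powr r \<le> 1 + r * t + K * t\<^sup>2"
proof -
  \<comment> \<open>The first summand pays for the region where \<open>t ^ 2\<close> is at least
    1/4, the second makes the second derivative of the difference nonnegative for \<open>t\<close>
    between -1/2 and 1/2.\<close>
  define K where "K = 4 * (4 powr r + r) + 2 * r * (r - 1) * 2 powr r"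
  have K: "K \<ge> 4 * (4 powr r + r)" "2 * K \<ge> 4 * r * (r - 1) * 2 powr r" "K \<ge> 0"
    using r by (auto simp: K_def intro!: add_nonneg_nonneg mult_nonneg_nonneg)
  have "(1 + t) powr r \<le> 1 + r * t + K * t\<^sup>2" if t: "-1 \<le> t" "t \<le> 3" for t
  proof (cases "\<bar>t\<bar> \<ge> 1/2")
    case True
    have "(1/2)\<^sup>2 \<le> t\<^sup>2" using True by (subst abs_le_square_iff[symmetric]) simp
    then have "4 * (4 powr r + r) * (1/4) \<le> K * t\<^sup>2"
      using K r by (intro mult_mono) (auto simp: power2_eq_square intro!: add_nonneg_nonneg)
    moreover have "(1 + t) powr r \<le> 4 powr r" using t r by (intro powr_mono2) auto
    moreover have "r * t \<ge> r * (-1)" using t r by (intro mult_left_mono) auto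
    ultimately show ?thesis by simp
  next
    case False
    define h where "h t = 1 + r * t + K * t\<^sup>2 - (1 + t) powr r" for t
    define h' where "h' t = r + 2 * K * t - r * (1 + t) powr (r - 1)" for t
    define h'' where "h'' t = 2 * K - r * (r - 1) * (1 + t) powr (r - 2)" for t
    let ?I = "{-(1/2)..1/2::real}"
    have d1: "(h has_real_derivative h' s) (at s)" if "s \<in> ?I" for s
      unfolding h_def h'_def using that by (auto intro!: derivative_eq_intros simp: algebra_simps)
    have d2: "(h' has_real_derivative h'' s) (at s)" if "s \<in> ?I" for s
      unfolding h''_def h'_def using that by (auto intro!: derivative_eq_intros simp: algebra_simps)
    have "h'' s \<ge> 0" if s: "s \<in> ?I" for s
    proof -
      \<comment> \<open>The exponent \<open>r - 2\<close> may be negative, so the power is not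
        monotone in a fixed direction; as a quotient it is bounded by its numerator at 2 and its
        denominator at 1/2.\<close>
      have "(1 + s) powr (r - 2) = (1 + s) powr r / (1 + s)\<^sup>2"
        using s by (simp add: powr_diff)
      also have "\<dots> \<le> 2 powr r / (1/2)\<^sup>2"
        using s r by (intro frac_le powr_mono2 power_mono) auto
      finally have "(1 + s) powr (r - 2) \<le> 4 * 2 powr r" by (simp add: power2_eq_square)
      then have "r * (r - 1) * (1 + s) powr (r - 2) \<le> r * (r - 1) * (4 * 2 powr r)"
        using r by (intro mult_left_mono) auto
      moreover have "r * (r - 1) * (4 * 2 powr r) = 4 * r * (r - 1) * 2 powr r" by simp
      ultimately show ?thesis using K(2) unfolding h''_def by linarith
    qed
    then have conv: "convex_on ?I h" using d1 d2 by (intro f''_ge0_imp_convex) auto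
    \<comment> \<open>The difference and its derivative both vanish at 0, so the tangent there is
      the zero line.\<close>
    have "h t - h 0 \<ge> h' 0 * (t - 0)"
      using False by (intro convex_on_imp_above_tangent[OF conv] has_field_derivative_at_within[OF d1]) auto
    then show ?thesis by (simp add: h_def h'_def)
  qed
  then show thesis using that K by blast
qed

text \<open>Made for a recursion on moments: if \<open>y\<close> is centered and independent of
  \<open>x\<close>, the linear term has expectation 0 and only terms quadratic in \<open>y\<close>,
  or of full order \<open>q\<close> in \<open>y\<close>, remain.\<close>

lemma norm_add_powr_le:
  fixes q :: real
  assumes q: "q \<ge> 2"
  obtains K where "K \<ge> 0" "\<And>x y :: 'a::real_inner. norm (x + y) powr q \<le>
    norm x powr q + q * (norm x powr (q - 2) * (x \<bullet> y)) + K * (norm x powr (q - 2) * (norm y)\<^sup>2 + norm y powr q)"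
proof -
  obtain K0 where K0: "K0 \<ge> 0" "\<And>t. -1 \<le> t \<Longrightarrow> t \<le> 3 \<Longrightarrow> (1 + t) powr (q/2) \<le> 1 + q/2 * t + K0 * t\<^sup>2"
    using powr_one_plus_le[of "q/2"] q by auto
  \<comment> \<open>\<open>2 powr q + q\<close> serves the case of short \<open>x\<close>, where
    even the linear term is at most \<open>q\<close> times the \<open>q\<close>-th power of the norm
    of \<open>y\<close>. The rest serves the other case: \<open>q / 2\<close> from the quadratic
    part of \<open>z\<close> and 9 from the bound on \<open>z ^ 2\<close>.\<close>
  define K where "K = 2 powr q + q + q / 2 + 9 * K0"
  have K: "K \<ge> 2 powr q + q" "K \<ge> q / 2 + 9 * K0" "K \<ge> 0" using q K0 by (auto simp: K_def intro!: add_nonneg_nonneg)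
  have "norm (x + y) powr q \<le>
    norm x powr q + q * (norm x powr (q - 2) * (x \<bullet> y)) + K * (norm x powr (q - 2) * (norm y)\<^sup>2 + norm y powr q)"
    for x y :: 'a
  proof (cases "norm x \<le> norm y")
    case True
    have "norm (x + y) \<le> 2 * norm y" using norm_triangle_ineq[of x y] True by simp
    then have "norm (x + y) powr q \<le> (2 * norm y) powr q" using q by (intro powr_mono2) auto
    then have 1: "norm (x + y) powr q \<le> 2 powr q * norm y powr q" by (simp add: powr_mult)
    have "norm x powr (q - 2) * \<bar>x \<bullet> y\<bar> \<le> norm y powr (q - 2) * (norm y * norm y)"
      using True q by (intro mult_mono powr_mono2 order_trans[OF Cauchy_Schwarz_ineq2] mult_right_mono) auto
    also have "\<dots> = norm y powr q"
      using q by (cases "norm y = 0") (auto simp: powr_diff power2_eq_square)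
    finally have "\<bar>norm x powr (q - 2) * (x \<bullet> y)\<bar> \<le> norm y powr q" by (simp add: abs_mult)
    then have "- (norm y powr q) \<le> norm x powr (q - 2) * (x \<bullet> y)" by linarith
    then have "q * - (norm y powr q) \<le> q * (norm x powr (q - 2) * (x \<bullet> y))"
      using q by (intro mult_left_mono) auto
    then have 2: "- (q * norm y powr q) \<le> q * (norm x powr (q - 2) * (x \<bullet> y))" by simp
    have "(2 powr q + q) * norm y powr q \<le> K * (norm x powr (q - 2) * (norm y)\<^sup>2 + norm y powr q)"
      using K by (intro mult_mono) auto
    then have "2 powr q * norm y powr q + q * norm y powr q \<le> K * (norm x powr (q - 2) * (norm y)\<^sup>2 + norm y powr q)"
      by (simp add: distrib_right)
    moreover have "0 \<le> norm x powr q" by simp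
    ultimately show ?thesis using 1 2 by linarith
  next
    case False
    define R where "R = norm x"
    have R: "R > 0" "norm y < R" using False by (auto simp: R_def order_le_less_trans[OF norm_ge_zero])
    define z where "z = 2 * (x \<bullet> y) + (norm y)\<^sup>2"
    \<comment> \<open>The squared norm of \<open>x + y\<close> is \<open>R ^ 2 * (1 + t)\<close>,
      and \<open>norm y < R\<close> forces \<open>t\<close> into the interval of
      \<open>powr_one_plus_le\<close>.\<close>
    define t where "t = z / R\<^sup>2"
    have xy: "\<bar>x \<bullet> y\<bar> \<le> R * norm y" unfolding R_def by (rule Cauchy_Schwarz_ineq2)
    have y2: "(norm y)\<^sup>2 \<le> R * norm y" using R by (simp add: power2_eq_square mult_right_mono)
    have z: "\<bar>z\<bar> \<le> 3 * R * norm y"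
      using xy y2 zero_le_power2[of "norm y"] unfolding z_def abs_le_iff by linarith
    have one: "1 + t = (norm (x + y) / R)\<^sup>2"
      using R by (simp add: t_def z_def R_def power_divide power2_norm_eq_inner inner_add_left inner_add_right inner_commute field_simps)
    have "R * norm y \<le> R\<^sup>2" using R by (simp add: power2_eq_square)
    then have "\<bar>z\<bar> \<le> 3 * R\<^sup>2" using z by simp
    then have t3: "t \<le> 3" using R by (simp add: t_def divide_le_eq abs_le_iff)
    have t1: "-1 \<le> t" using one zero_le_power2[of "norm (x + y) / R"] by linarith
    have "norm (x + y) powr q = R powr q * (1 + t) powr (q / 2)"
    proof -
      have "(1 + t) powr (q / 2) = (norm (x + y) / R) powr q"
        unfolding one using R by (simp add: powr_powr flip: powr_numeral)
      then show ?thesis using R by (simp add: powr_divide)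
    qed
    also have "\<dots> \<le> R powr q * (1 + q/2 * t + K0 * t\<^sup>2)"
      by (intro mult_left_mono K0 t1 t3) auto
    also have "\<dots> = R powr q + q/2 * (R powr q * t) + K0 * (R powr q * t\<^sup>2)" by (simp add: algebra_simps)
    finally have main: "norm (x + y) powr q \<le> R powr q + q/2 * (R powr q * t) + K0 * (R powr q * t\<^sup>2)" .
    have Rq: "R powr q = R powr (q - 2) * R\<^sup>2" using R by (simp add: powr_diff)
    then have Rt: "R powr q * t = R powr (q - 2) * z" using R by (simp add: t_def)
    have "z\<^sup>2 \<le> (3 * R * norm y)\<^sup>2"
      by (subst abs_le_square_iff[symmetric]) (use z R in simp)
    then have "z\<^sup>2 / R\<^sup>2 \<le> 9 * (norm y)\<^sup>2"
      using R by (simp add: divide_le_eq power_mult_distrib mult_ac)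
    then have "R powr (q - 2) * (z\<^sup>2 / R\<^sup>2) \<le> R powr (q - 2) * (9 * (norm y)\<^sup>2)"
      by (rule mult_left_mono) simp
    moreover have "R powr q * t\<^sup>2 = R powr (q - 2) * (z\<^sup>2 / R\<^sup>2)"
      using R Rq by (simp add: t_def power_divide field_simps power2_eq_square power4_eq_xxxx)
    ultimately have "R powr q * t\<^sup>2 \<le> R powr (q - 2) * (9 * (norm y)\<^sup>2)" by simp
    then have "K0 * (R powr q * t\<^sup>2) \<le> K0 * (R powr (q - 2) * (9 * (norm y)\<^sup>2))"
      using K0 by (intro mult_left_mono) auto
    moreover have "(q / 2 + 9 * K0) * (R powr (q - 2) * (norm y)\<^sup>2) \<le> K * (R powr (q - 2) * (norm y)\<^sup>2 + norm y powr q)"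
      using K by (intro mult_mono) auto
    ultimately show ?thesis
      using main unfolding Rt z_def R_def[symmetric] by (simp add: algebra_simps)
  qed
  then show thesis using that K by blast
qed

lemma powr_eq_nn_integral:
  fixes q s x :: real
  assumes "q \<ge> 1" "s > 0" "x \<ge> s"
  shows "ennreal (x powr q - s powr q) = (\<integral>\<^sup>+u. ennreal (q * u powr (q - 1)) * indicator {s..x} u \<partial>lborel)"
  using assms by (subst nn_integral_FTC_Icc[where F="\<lambda>u. u powr q"])
    (auto intro!: derivative_eq_intros)

text \<open>Layer cake: \<open>x\<^sup>q\<close> is the integral of \<open>q u\<^sup>q\<^sup>-\<^sup>1\<close> over \<open>u < x\<close>, so a tail comparison becomes a
  moment comparison.\<close>

lemma (in prob_space) moment_of_tail_comparison:
  fixes T V :: "'a \<Rightarrow> real" and q s0 c :: real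
  assumes T[measurable]: "T \<in> borel_measurable M" and V[measurable]: "V \<in> borel_measurable M"
    and T0: "\<And>\<omega>. T \<omega> \<ge> 0" and V0: "\<And>\<omega>. V \<omega> \<ge> 0"
    and q: "q \<ge> 1" and s0: "s0 > 0" and c: "c \<ge> 0"
    and tail: "\<And>s. s \<ge> s0 \<Longrightarrow> prob {\<omega> \<in> space M. T \<omega> > s} \<le> c * prob {\<omega> \<in> space M. V \<omega> > s}"
    and int: "integrable M (\<lambda>\<omega>. V \<omega> powr q)"
  shows "integrable M (\<lambda>\<omega>. T \<omega> powr q)"
    "expectation (\<lambda>\<omega>. T \<omega> powr q) \<le> s0 powr q + c * expectation (\<lambda>\<omega>. V \<omega> powr q)"
proof -
  \<comment> \<open>The density is cut off below \<open>s0\<close>, since tails are compared only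
    above it; the missing part contributes \<open>s0 powr q\<close>.\<close>
  let ?f = "\<lambda>u::real. ennreal (q * u powr (q - 1)) * indicator {s0..} u"
  have layer: "(\<integral>\<^sup>+\<omega>. ennreal (max (U \<omega>) s0 powr q - s0 powr q) \<partial>M) =
      (\<integral>\<^sup>+u. ?f u * ennreal (prob {\<omega> \<in> space M. U \<omega> > u}) \<partial>lborel)"
    if U[measurable]: "U \<in> borel_measurable M" for U
  proof -
    have "ennreal (max (U \<omega>) s0 powr q - s0 powr q) = (\<integral>\<^sup>+u. ?f u * indicator {u. u < U \<omega>} u \<partial>lborel)" for \<omega>
    proof -
      have "ennreal (max (U \<omega>) s0 powr q - s0 powr q) =
        (\<integral>\<^sup>+u. ennreal (q * u powr (q - 1)) * indicator {s0..max (U \<omega>) s0} u \<partial>lborel)"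
        using q s0 by (intro powr_eq_nn_integral) auto
      also have "\<dots> = (\<integral>\<^sup>+u. ?f u * indicator {u. u < U \<omega>} u \<partial>lborel)"
      proof (rule nn_integral_cong_AE)
        \<comment> \<open>The closed interval and the strict inequality disagree at one endpoint
          only.\<close>
        have "AE u in lborel. u \<noteq> max (U \<omega>) s0" by (rule AE_lborel_singleton)
        then show "AE u in lborel. ennreal (q * u powr (q - 1)) * indicator {s0..max (U \<omega>) s0} u =
          ?f u * indicator {u. u < U \<omega>} u"
          by eventually_elim (auto simp: indicator_def)
      qed
      finally show ?thesis .
    qed
    then have "(\<integral>\<^sup>+\<omega>. ennreal (max (U \<omega>) s0 powr q - s0 powr q) \<partial>M) =
        (\<integral>\<^sup>+\<omega>. (\<integral>\<^sup>+u. ?f u * indicator {u. u < U \<omega>} u \<partial>lborel) \<partial>M)" by simp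
    also have "\<dots> = (\<integral>\<^sup>+u. (\<integral>\<^sup>+\<omega>. ?f u * indicator {u. u < U \<omega>} u \<partial>M) \<partial>lborel)"
    proof -
      interpret P: pair_sigma_finite lborel M ..
      have "(\<lambda>(u, \<omega>). ?f u * indicator {u. u < U \<omega>} u) \<in> borel_measurable (lborel \<Otimes>\<^sub>M M)"
        by (simp add: indicator_def[abs_def])
      from P.Fubini'[OF this] show ?thesis by simp
    qed
    also have "\<dots> = (\<integral>\<^sup>+u. ?f u * ennreal (prob {\<omega> \<in> space M. U \<omega> > u}) \<partial>lborel)"
    proof (rule nn_integral_cong)
      fix u :: real
      have "(\<integral>\<^sup>+\<omega>. ?f u * indicator {u. u < U \<omega>} u \<partial>M) = (\<integral>\<^sup>+\<omega>. ?f u * indicator {\<omega> \<in> space M. U \<omega> > u} \<omega> \<partial>M)"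
        by (intro nn_integral_cong) (auto simp: indicator_def)
      also have "\<dots> = ?f u * emeasure M {\<omega> \<in> space M. U \<omega> > u}"
        by (subst nn_integral_cmult_indicator) auto
      finally show "(\<integral>\<^sup>+\<omega>. ?f u * indicator {u. u < U \<omega>} u \<partial>M) = ?f u * ennreal (prob {\<omega> \<in> space M. U \<omega> > u})"
        by (simp add: emeasure_eq_measure)
    qed
    finally show ?thesis .
  qed
  have "(\<integral>\<^sup>+\<omega>. ennreal (T \<omega> powr q) \<partial>M) \<le> (\<integral>\<^sup>+\<omega>. ennreal (s0 powr q) + ennreal (max (T \<omega>) s0 powr q - s0 powr q) \<partial>M)"
  proof (intro nn_integral_mono)
    fix \<omega>
    have "s0 powr q \<le> max (T \<omega>) s0 powr q" "T \<omega> powr q \<le> max (T \<omega>) s0 powr q"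
      using s0 q T0[of \<omega>] by (intro powr_mono2; simp)+
    then show "ennreal (T \<omega> powr q) \<le> ennreal (s0 powr q) + ennreal (max (T \<omega>) s0 powr q - s0 powr q)"
      by (subst ennreal_plus[symmetric]) (auto intro!: ennreal_leI)
  qed
  also have "\<dots> = ennreal (s0 powr q) + (\<integral>\<^sup>+\<omega>. ennreal (max (T \<omega>) s0 powr q - s0 powr q) \<partial>M)"
    by (subst nn_integral_add) (auto simp: emeasure_space_1)
  finally have A: "(\<integral>\<^sup>+\<omega>. ennreal (T \<omega> powr q) \<partial>M) \<le>
    ennreal (s0 powr q) + (\<integral>\<^sup>+\<omega>. ennreal (max (T \<omega>) s0 powr q - s0 powr q) \<partial>M)" .
  have "(\<integral>\<^sup>+\<omega>. ennreal (max (T \<omega>) s0 powr q - s0 powr q) \<partial>M) \<le>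
      (\<integral>\<^sup>+u. ennreal c * (?f u * ennreal (prob {\<omega> \<in> space M. V \<omega> > u})) \<partial>lborel)"
    unfolding layer[OF T]
  proof (intro nn_integral_mono)
    fix u :: real
    show "?f u * ennreal (prob {\<omega> \<in> space M. T \<omega> > u}) \<le> ennreal c * (?f u * ennreal (prob {\<omega> \<in> space M. V \<omega> > u}))"
    proof (cases "u \<ge> s0")
      case True
      have "ennreal (prob {\<omega> \<in> space M. T \<omega> > u}) \<le> ennreal c * ennreal (prob {\<omega> \<in> space M. V \<omega> > u})"
        using tail[OF True] c by (subst ennreal_mult[symmetric]) (auto intro: ennreal_leI)
      then have "?f u * ennreal (prob {\<omega> \<in> space M. T \<omega> > u}) \<le> ?f u * (ennreal c * ennreal (prob {\<omega> \<in> space M. V \<omega> > u}))"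
        by (intro mult_left_mono) auto
      then show ?thesis by (simp add: mult_ac)
    qed simp
  qed
  also have "\<dots> = ennreal c * (\<integral>\<^sup>+u. ?f u * ennreal (prob {\<omega> \<in> space M. V \<omega> > u}) \<partial>lborel)"
  proof (rule nn_integral_cmult)
    have "(\<lambda>u. emeasure M {\<omega> \<in> space M. V \<omega> > u}) \<in> borel_measurable lborel"
      by measurable
    then show "(\<lambda>u. ?f u * ennreal (prob {\<omega> \<in> space M. V \<omega> > u})) \<in> borel_measurable lborel"
      by (simp add: emeasure_eq_measure)
  qed
  also have "\<dots> = ennreal c * (\<integral>\<^sup>+\<omega>. ennreal (max (V \<omega>) s0 powr q - s0 powr q) \<partial>M)"
    unfolding layer[OF V] ..
  finally have B: "(\<integral>\<^sup>+\<omega>. ennreal (max (T \<omega>) s0 powr q - s0 powr q) \<partial>M) \<le>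
    ennreal c * (\<integral>\<^sup>+\<omega>. ennreal (max (V \<omega>) s0 powr q - s0 powr q) \<partial>M)" .
  have "(\<integral>\<^sup>+\<omega>. ennreal (max (V \<omega>) s0 powr q - s0 powr q) \<partial>M) \<le> (\<integral>\<^sup>+\<omega>. ennreal (V \<omega> powr q) \<partial>M)"
    by (intro nn_integral_mono ennreal_leI) (auto simp: max_def)
  also have "(\<integral>\<^sup>+\<omega>. ennreal (V \<omega> powr q) \<partial>M) = ennreal (expectation (\<lambda>\<omega>. V \<omega> powr q))"
    using int by (intro nn_integral_eq_integral) auto
  finally have C: "(\<integral>\<^sup>+\<omega>. ennreal (max (V \<omega>) s0 powr q - s0 powr q) \<partial>M) \<le> ennreal (expectation (\<lambda>\<omega>. V \<omega> powr q))" .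
  have "(\<integral>\<^sup>+\<omega>. ennreal (T \<omega> powr q) \<partial>M) \<le> ennreal (s0 powr q) + ennreal c * ennreal (expectation (\<lambda>\<omega>. V \<omega> powr q))"
    by (rule order_trans[OF A add_left_mono[OF order_trans[OF B mult_left_mono[OF C]]]]) simp
  also have "\<dots> = ennreal (s0 powr q + c * expectation (\<lambda>\<omega>. V \<omega> powr q))"
    using c by (simp add: ennreal_mult ennreal_plus)
  finally have *: "(\<integral>\<^sup>+\<omega>. ennreal (T \<omega> powr q) \<partial>M) \<le> ennreal (s0 powr q + c * expectation (\<lambda>\<omega>. V \<omega> powr q))" .
  show i: "integrable M (\<lambda>\<omega>. T \<omega> powr q)"
    by (rule integrableI_bounded) (auto intro: order_le_less_trans[OF *])
  have "ennreal (expectation (\<lambda>\<omega>. T \<omega> powr q)) \<le> ennreal (s0 powr q + c * expectation (\<lambda>\<omega>. V \<omega> powr q))"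
    using * nn_integral_eq_integral[OF i] by simp
  then show "expectation (\<lambda>\<omega>. T \<omega> powr q) \<le> s0 powr q + c * expectation (\<lambda>\<omega>. V \<omega> powr q)"
    using c by (subst (asm) ennreal_le_iff) auto
qed

lemma borel_measurable_vec_nth' [measurable]: "(\<lambda>x::real ^ 'n. x $ i) \<in> borel_measurable borel"
  by (intro borel_measurable_continuous_onI continuous_intros)

lemma powr_le_one_plus:
  fixes u :: real
  assumes "0 \<le> u" "0 \<le> r" "r \<le> q"
  shows "u powr r \<le> 1 + u powr q"
proof (cases "u \<le> 1")
  case True
  then have "u powr r \<le> 1" using assms by (simp add: powr_le1)
  then show ?thesis by (smt (verit) powr_ge_zero)
next
  case False
  then have "u powr r \<le> u powr q" using assms by (intro powr_mono) auto
  then show ?thesis by simp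
qed

section \<open>Moments of increments and of the running maximum\<close>

context centered_walk
begin

lemma indep_functions:
  assumes "A \<inter> B = {}" "A \<subseteq> {1..}" "B \<subseteq> {1..}"
    and "F \<in> PiM A (\<lambda>_. borel) \<rightarrow>\<^sub>M S" "G \<in> PiM B (\<lambda>_. borel) \<rightarrow>\<^sub>M T"
  shows "indep_var S (\<lambda>\<omega>. F (restrict (\<lambda>i. \<xi> i \<omega>) A)) T (\<lambda>\<omega>. G (restrict (\<lambda>i. \<xi> i \<omega>) B))"
  using indep_var_compose[OF indep_var_restrict[OF indep assms(1-3)] assms(4,5)] by (simp add: comp_def)

lemma block_sum_measurable: "C \<subseteq> A \<Longrightarrow> (\<lambda>x. \<Sum>i\<in>C. x i) \<in> PiM A (\<lambda>_. borel :: (real ^ 'n) measure) \<rightarrow>\<^sub>M borel"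
  by (intro borel_measurable_sum measurable_component_singleton) auto

lemma indep_increment_next:
  fixes g h :: "real ^ 'n \<Rightarrow> real"
  assumes g: "g \<in> borel_measurable borel" and h: "h \<in> borel_measurable borel"
  shows "indep_var borel (\<lambda>\<omega>. g (W (k + n) \<omega> - W k \<omega>)) borel (\<lambda>\<omega>. h (\<xi> (Suc (k + n)) \<omega>))"
proof -
  have F: "(\<lambda>x. g (\<Sum>i\<in>{k<..k + n}. x i)) \<in> PiM {k<..k + n} (\<lambda>_. borel) \<rightarrow>\<^sub>M borel"
    by (rule measurable_compose[OF block_sum_measurable g]) simp
  have G: "(\<lambda>x. h (\<Sum>i\<in>{Suc (k + n)}. x i)) \<in> PiM {Suc (k + n)} (\<lambda>_. borel) \<rightarrow>\<^sub>M borel"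
    by (rule measurable_compose[OF block_sum_measurable h]) simp
  have "indep_var borel (\<lambda>\<omega>. g (\<Sum>i\<in>{k<..k + n}. restrict (\<lambda>i. \<xi> i \<omega>) {k<..k + n} i))
     borel (\<lambda>\<omega>. h (\<Sum>i\<in>{Suc (k + n)}. restrict (\<lambda>i. \<xi> i \<omega>) {Suc (k + n)} i))"
    by (rule indep_functions[OF _ _ _ F G]) auto
  then show ?thesis by (simp add: W_diff)
qed

text \<open>A Rosenthal-type bound by induction on the number of steps. Adding a step to an
  increment \<open>D\<close> costs a term with the \<open>(q - 2)\<close>-th moment of
  \<open>D\<close>; truncating at a level proportional to \<open>sqrt n\<close> bounds it by a
  constant of the right order plus a small multiple of the \<open>q\<close>-th moment, which the
  induction hypothesis controls.\<close>

lemma increment_moment_bound: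
  assumes q: "q \<ge> 2" and int: "integrable M (\<lambda>\<omega>. norm (\<xi> 1 \<omega>) powr q)"
  obtains A where "A \<ge> 0"
    "\<And>k n. integrable M (\<lambda>\<omega>. norm (W (k + n) \<omega> - W k \<omega>) powr q)"
    "\<And>k n. expectation (\<lambda>\<omega>. norm (W (k + n) \<omega> - W k \<omega>) powr q) \<le> A * real n powr (q / 2)"
proof -
  obtain K where K: "K \<ge> 0" "\<And>x y :: real ^ 'n. norm (x + y) powr q \<le>
    norm x powr q + q * (norm x powr (q - 2) * (x \<bullet> y)) + K * (norm x powr (q - 2) * (norm y)\<^sup>2 + norm y powr q)"
    using norm_add_powr_le[OF q, where 'a="real ^ 'n"] by blast
  define \<beta> where "\<beta> = expectation (\<lambda>\<omega>. norm (\<xi> 1 \<omega>) powr q)"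
  define \<sigma>2 where "\<sigma>2 = expectation (\<lambda>\<omega>. (norm (\<xi> 1 \<omega>))\<^sup>2)"
  have b0: "\<beta> \<ge> 0" "\<sigma>2 \<ge> 0" by (simp_all add: \<beta>_def \<sigma>2_def)
  \<comment> \<open>Large enough that \<open>K * \<sigma>2 / l\<close> is at most 1/2: the part fed
    back from the induction hypothesis uses only half of the growth available in one step.\<close>
  define l where "l = 2 * K * \<sigma>2 + 1"
  have l: "l > 0" using K b0 by (simp add: l_def add_nonneg_pos)
  \<comment> \<open>The doubled bracket lets the remaining terms fit into the other half; the
    summand \<beta> covers the first step.\<close>
  define A where "A = 2 * (K * \<sigma>2 * l powr (q / 2 - 1) + K * \<beta>) + \<beta>"
  have A: "A \<ge> \<beta>" "K * \<sigma>2 * l powr (q / 2 - 1) + K * \<beta> \<le> A / 2" "A \<ge> 0"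
    using K b0 by (auto simp: A_def)
  have xi_int: "integrable M (\<lambda>\<omega>. norm (\<xi> i \<omega>) powr q)" and xi_exp: "expectation (\<lambda>\<omega>. norm (\<xi> i \<omega>) powr q) = \<beta>"
    and xi_exp2: "expectation (\<lambda>\<omega>. (norm (\<xi> i \<omega>))\<^sup>2) = \<sigma>2" if "i \<ge> 1" for i
    using that int integrable_xi[of i "\<lambda>x. norm x powr q"] integral_xi[of i "\<lambda>x. norm x powr q"] integral_xi[of i "\<lambda>x. (norm x)\<^sup>2"]
    by (auto simp: \<beta>_def \<sigma>2_def)
  have main: "integrable M (\<lambda>\<omega>. norm (W (k + n) \<omega> - W k \<omega>) powr q) \<and>
     expectation (\<lambda>\<omega>. norm (W (k + n) \<omega> - W k \<omega>) powr q) \<le> A * real n powr (q / 2)" for k n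
  proof (induction n)
    case 0
    then show ?case by simp
  next
    case (Suc n)
    define D where "D \<omega> = W (k + n) \<omega> - W k \<omega>" for \<omega>
    define x where "x = \<xi> (Suc (k + n))"
    have [measurable]: "D \<in> borel_measurable M" unfolding D_def by measurable
    have [measurable]: "x \<in> borel_measurable M" unfolding x_def by (rule xi_measurable) simp
    have Dx: "W (k + Suc n) \<omega> - W k \<omega> = D \<omega> + x \<omega>" for \<omega>
    proof -
      have "{0<..Suc (k + n)} = insert (Suc (k + n)) {0<..k + n}" by auto
      then show ?thesis by (simp add: D_def x_def W_def)
    qed
    define a where "a = expectation (\<lambda>\<omega>. norm (D \<omega>) powr q)"
    have Dint: "integrable M (\<lambda>\<omega>. norm (D \<omega>) powr q)" and a: "a \<le> A * real n powr (q / 2)"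
      using Suc by (simp_all add: D_def a_def)
    have D1: "integrable M (\<lambda>\<omega>. 1 + norm (D \<omega>) powr q)" using Dint by simp
    have D2: "integrable M (\<lambda>\<omega>. norm (D \<omega>) powr (q - 2))"
      by (rule Bochner_Integration.integrable_bound[OF D1])
        (use q in \<open>auto intro!: AE_I2 order_trans[OF powr_le_one_plus[of _ "q - 2" q]]\<close>)
    have D3: "integrable M (\<lambda>\<omega>. norm (D \<omega>) powr (q - 2) * D \<omega> $ i)" for i
    proof (rule Bochner_Integration.integrable_bound[OF D1])
      have "\<bar>norm d powr (q - 2) * d $ i\<bar> \<le> 1 + norm d powr q" for d :: "real ^ 'n"
      proof -
        have "\<bar>norm d powr (q - 2) * d $ i\<bar> \<le> norm d powr (q - 2) * norm d"
          by (simp add: abs_mult mult_left_mono component_le_norm_cart)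
        also have "\<dots> = norm d powr (q - 1)"
          by (cases "norm d = 0") (auto simp: powr_diff power2_eq_square)
        also have "\<dots> \<le> 1 + norm d powr q" using q by (intro powr_le_one_plus) auto
        finally show ?thesis .
      qed
      then show "AE \<omega> in M. norm (norm (D \<omega>) powr (q - 2) * D \<omega> $ i) \<le> norm (1 + norm (D \<omega>) powr q)"
        by (auto intro!: AE_I2 order_trans[OF _ abs_ge_self])
    qed measurable
    have xint: "integrable M (\<lambda>\<omega>. x \<omega> $ i)" "expectation (\<lambda>\<omega>. x \<omega> $ i) = 0" for i
    proof -
      have i: "integrable M x" unfolding x_def by (rule xi_integrable) simp
      have "expectation x = 0" unfolding x_def by (rule xi_mean) simp
      moreover show "integrable M (\<lambda>\<omega>. x \<omega> $ i)" using i integrable_inner_left[of "axis i 1" M x] by (simp add: inner_axis)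
      moreover have "expectation (\<lambda>\<omega>. x \<omega> $ i) = expectation x $ i"
        using integral_inner_left[of "axis i 1" M x] i by (simp add: inner_axis)
      ultimately show "expectation (\<lambda>\<omega>. x \<omega> $ i) = 0" by simp
    qed
    have ind1: "indep_var borel (\<lambda>\<omega>. norm (D \<omega>) powr (q - 2) * D \<omega> $ i) borel (\<lambda>\<omega>. x \<omega> $ i)" for i
      unfolding D_def x_def using indep_increment_next[of "\<lambda>d. norm d powr (q - 2) * d $ i" "\<lambda>y. y $ i" k n] by simp
    have cross: "integrable M (\<lambda>\<omega>. norm (D \<omega>) powr (q - 2) * (D \<omega> \<bullet> x \<omega>))"
      "expectation (\<lambda>\<omega>. norm (D \<omega>) powr (q - 2) * (D \<omega> \<bullet> x \<omega>)) = 0"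
    proof -
      \<comment> \<open>The inner product is expanded because the product rule for expectations is
        applied to real independent variables, coordinate by coordinate.\<close>
      have eq: "(\<lambda>\<omega>. norm (D \<omega>) powr (q - 2) * (D \<omega> \<bullet> x \<omega>)) = (\<lambda>\<omega>. \<Sum>i\<in>UNIV. (norm (D \<omega>) powr (q - 2) * D \<omega> $ i) * x \<omega> $ i)"
        by (simp add: inner_vec_def sum_distrib_left mult.assoc)
      have int: "integrable M (\<lambda>\<omega>. (norm (D \<omega>) powr (q - 2) * D \<omega> $ i) * x \<omega> $ i)" for i
        by (rule indep_var_integrable[OF ind1 D3 xint(1)])
      then show "integrable M (\<lambda>\<omega>. norm (D \<omega>) powr (q - 2) * (D \<omega> \<bullet> x \<omega>))" unfolding eq by simp
      have "expectation (\<lambda>\<omega>. (norm (D \<omega>) powr (q - 2) * D \<omega> $ i) * x \<omega> $ i) = 0" for i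
        using indep_var_lebesgue_integral[OF ind1 D3 xint(1), of i] xint(2)[of i] by simp
      then show "expectation (\<lambda>\<omega>. norm (D \<omega>) powr (q - 2) * (D \<omega> \<bullet> x \<omega>)) = 0"
        unfolding eq using int by (subst Bochner_Integration.integral_sum) auto
    qed
    have ind2: "indep_var borel (\<lambda>\<omega>. norm (D \<omega>) powr (q - 2)) borel (\<lambda>\<omega>. (norm (x \<omega>))\<^sup>2)"
      unfolding D_def x_def using indep_increment_next[of "\<lambda>d. norm d powr (q - 2)" "\<lambda>y. (norm y)\<^sup>2" k n] by simp
    have x2: "integrable M (\<lambda>\<omega>. (norm (x \<omega>))\<^sup>2)" unfolding x_def by (rule xi_square_integrable) simp
    have quad: "integrable M (\<lambda>\<omega>. norm (D \<omega>) powr (q - 2) * (norm (x \<omega>))\<^sup>2)"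
      "expectation (\<lambda>\<omega>. norm (D \<omega>) powr (q - 2) * (norm (x \<omega>))\<^sup>2) = expectation (\<lambda>\<omega>. norm (D \<omega>) powr (q - 2)) * \<sigma>2"
      using indep_var_integrable[OF ind2 D2 x2] indep_var_lebesgue_integral[OF ind2 D2 x2] xi_exp2[of "Suc (k + n)"]
      by (simp_all add: x_def)
    have xq: "integrable M (\<lambda>\<omega>. norm (x \<omega>) powr q)" "expectation (\<lambda>\<omega>. norm (x \<omega>) powr q) = \<beta>"
      unfolding x_def by (rule xi_int xi_exp, simp)+
    define H where "H \<omega> = norm (D \<omega>) powr q + q * (norm (D \<omega>) powr (q - 2) * (D \<omega> \<bullet> x \<omega>)) +
      K * (norm (D \<omega>) powr (q - 2) * (norm (x \<omega>))\<^sup>2 + norm (x \<omega>) powr q)" for \<omega>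
    have Hint: "integrable M H" unfolding H_def using Dint cross(1) quad(1) xq(1) by auto
    have Hexp: "expectation H = a + K * (expectation (\<lambda>\<omega>. norm (D \<omega>) powr (q - 2)) * \<sigma>2 + \<beta>)"
      unfolding H_def using Dint cross quad xq by (simp add: a_def)
    have HH: "norm (D \<omega> + x \<omega>) powr q \<le> H \<omega>" for \<omega> unfolding H_def by (rule K(2))
    have newint: "integrable M (\<lambda>\<omega>. norm (D \<omega> + x \<omega>) powr q)"
      by (rule Bochner_Integration.integrable_bound[OF Hint]) (auto intro!: AE_I2 order_trans[OF HH])
    have le: "expectation (\<lambda>\<omega>. norm (D \<omega> + x \<omega>) powr q) \<le> expectation H"
      by (rule integral_mono[OF newint Hint HH])
    have "expectation (\<lambda>\<omega>. norm (D \<omega> + x \<omega>) powr q) \<le> A * real (Suc n) powr (q / 2)"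
    proof (cases "n = 0")
      case True
      then have "D \<omega> = 0" for \<omega> by (simp add: D_def)
      then show ?thesis using xq(2) A True by simp
    next
      case False
      then have n: "real n \<ge> 1" by simp
      define r where "r = q / 2"
      have r: "r \<ge> 1" using q by (simp add: r_def)
      define S where "S = l * real n"
      have S: "S > 0" using l n by (simp add: S_def)
      \<comment> \<open>Split at \<open>u = sqrt S\<close>: below it the power is bounded by its
        value there, above it \<open>u ^ 2\<close> is at least \<open>S\<close>.\<close>
      have "u powr (q - 2) \<le> S powr (r - 1) + u powr q / S" if "u \<ge> 0" for u
      proof (cases "u \<le> sqrt S")
        case True
        have "u powr (q - 2) \<le> sqrt S powr (q - 2)" using True that q by (intro powr_mono2) auto
        also have "sqrt S powr (q - 2) = S powr (r - 1)"
          using S by (simp add: r_def powr_powr diff_divide_distrib flip: powr_half_sqrt)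
        also have "\<dots> \<le> S powr (r - 1) + u powr q / S" using S by simp
        finally show ?thesis .
      next
        case False
        have "sqrt S > 0" using S by simp
        then have u: "u > 0" using False by linarith
        have "(sqrt S)\<^sup>2 \<le> u\<^sup>2" using False S by (intro power_mono) auto
        then have "S \<le> u\<^sup>2" using S by simp
        have "u powr (q - 2) = u powr q / u\<^sup>2" using u by (simp add: powr_diff)
        also have "\<dots> \<le> u powr q / S" using \<open>S \<le> u\<^sup>2\<close> S u by (intro divide_left_mono) auto
        also have "\<dots> \<le> S powr (r - 1) + u powr q / S" by simp
        finally show ?thesis .
      qed
      then have "expectation (\<lambda>\<omega>. norm (D \<omega>) powr (q - 2)) \<le> expectation (\<lambda>\<omega>. S powr (r - 1) + norm (D \<omega>) powr q / S)"
        using D2 Dint by (intro integral_mono) auto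
      also have "\<dots> = S powr (r - 1) + a / S" using Dint by (simp add: a_def prob_space)
      finally have e: "expectation (\<lambda>\<omega>. norm (D \<omega>) powr (q - 2)) \<le> S powr (r - 1) + a / S" .
      define P where "P = real n powr (r - 1)"
      have P: "P \<ge> 1" using n r by (simp add: P_def ge_one_powr_ge_zero)
      have nP: "real n powr r = real n * P" using n by (simp add: P_def powr_diff)
      have aS: "a / S \<le> A * P / l"
        using a S l n unfolding r_def[symmetric] nP by (simp add: S_def divide_simps mult_ac)
      have SP: "S powr (r - 1) = l powr (r - 1) * P" using l n by (simp add: S_def P_def powr_mult)
      define X where "X = K * \<sigma>2 * (A * P / l)"
      define Y where "Y = K * \<sigma>2 * l powr (r - 1) * P"
      have "X \<le> A * P / 2"
      proof -
        have "2 * K * \<sigma>2 \<le> l" by (simp add: l_def)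
        then have "2 * K * \<sigma>2 * (A * P) \<le> l * (A * P)" using A P by (intro mult_right_mono) auto
        then show ?thesis using l by (simp add: X_def divide_simps mult_ac)
      qed
      moreover have "(K * \<sigma>2 * l powr (r - 1) + K * \<beta>) * P \<le> A / 2 * P"
        using A P unfolding r_def by (intro mult_right_mono) auto
      then have "Y + K * \<beta> * P \<le> A * P / 2" by (simp add: Y_def distrib_right)
      moreover have "K * \<beta> \<le> K * \<beta> * P" using mult_left_mono[of 1 P "K * \<beta>"] P K(1) b0 by simp
      moreover have "K * (expectation (\<lambda>\<omega>. norm (D \<omega>) powr (q - 2)) * \<sigma>2) \<le> K * ((l powr (r - 1) * P + A * P / l) * \<sigma>2)"
        using e aS SP K b0 by (intro mult_left_mono mult_right_mono) auto
      then have "K * (expectation (\<lambda>\<omega>. norm (D \<omega>) powr (q - 2)) * \<sigma>2) \<le> Y + X"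
        by (simp add: X_def Y_def algebra_simps)
      moreover have "a \<le> A * (real n * P)" using a unfolding r_def[symmetric] nP .
      moreover have "expectation H = a + (K * (expectation (\<lambda>\<omega>. norm (D \<omega>) powr (q - 2)) * \<sigma>2) + K * \<beta>)"
        using Hexp by (simp add: distrib_left)
      \<comment> \<open>With \<open>P = n powr (r - 1)\<close> the bound is
        \<open>A * (n + 1) * P\<close>, and enlarging \<open>n\<close> to \<open>n + 1\<close>
        inside \<open>P\<close> closes the induction.\<close>
      ultimately have "expectation H \<le> A * (real n * P) + A * P" by linarith
      also have "\<dots> = A * (real (Suc n) * P)" by (simp add: algebra_simps)
      also have "\<dots> \<le> A * (real (Suc n) * real (Suc n) powr (r - 1))"
        using A r unfolding P_def by (intro mult_left_mono powr_mono2) auto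
      also have "real (Suc n) * real (Suc n) powr (r - 1) = real (Suc n) powr r" by (simp add: powr_diff)
      finally show ?thesis using le by (simp add: r_def)
    qed
    then show ?case using newint unfolding Dx by simp
  qed
  show thesis using that[OF A(3)] main by blast
qed

text \<open>Ottaviani's inequality, simultaneously for blocks that start at \<open>b k\<close> and end at \<open>c k\<close>:
  at the first \<open>k\<close> with a large deviation, the rest of the block is independent of the past.\<close>

lemma ottaviani:
  assumes b: "\<And>k. k \<le> n \<Longrightarrow> b k \<le> k" and c: "\<And>k. k \<le> n \<Longrightarrow> k \<le> c k"
    and half: "\<And>k. k \<le> n \<Longrightarrow> prob {\<omega> \<in> space M. norm (W (c k) \<omega> - W k \<omega>) > s} \<le> 1 / 2"
  shows "prob {\<omega> \<in> space M. \<exists>k\<le>n. norm (W k \<omega> - W (b k) \<omega>) > 2 * s} \<le>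
    2 * prob {\<omega> \<in> space M. \<exists>k\<le>n. norm (W (c k) \<omega> - W (b k) \<omega>) > s}"
proof -
  define w where "w k x = (\<Sum>i\<in>{0<..k}. x i)" for k and x :: "nat \<Rightarrow> real ^ 'n"
  define P where "P k = {0<..k::nat}" for k
  \<comment> \<open>The event of first exceedance at \<open>k\<close>, as a set of finite sequences.
    As \<open>b l\<close> never exceeds \<open>l\<close>, it depends on the first \<open>k\<close>
    steps only, which yields independence from the rest of the block; \<open>A\<close> is its
    preimage.\<close>
  define A' where "A' k = {x \<in> space (PiM (P k) (\<lambda>_. borel)). norm (w k x - w (b k) x) > 2 * s \<and>
     (\<forall>l<k. \<not> norm (w l x - w (b l) x) > 2 * s)}" for k
  define A where "A k = {\<omega> \<in> space M. norm (W k \<omega> - W (b k) \<omega>) > 2 * s \<and> (\<forall>l<k. \<not> norm (W l \<omega> - W (b l) \<omega>) > 2 * s)}" for k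
  define E where "E k = {\<omega> \<in> space M. norm (W (c k) \<omega> - W k \<omega>) \<le> s}" for k
  define H where "H = {\<omega> \<in> space M. \<exists>k\<le>n. norm (W (c k) \<omega> - W (b k) \<omega>) > s}"
  have A_meas[measurable]: "A k \<in> events" for k unfolding A_def by measurable
  have E_meas[measurable]: "E k \<in> events" for k unfolding E_def by measurable
  have H_meas[measurable]: "H \<in> events" unfolding H_def by measurable
  have prod: "prob (A k \<inter> E k) = prob (A k) * prob (E k)" if k: "k \<le> n" for k
  proof -
    let ?F = "\<lambda>\<omega>. restrict (\<lambda>i. \<xi> i \<omega>) (P k)"
    let ?G = "\<lambda>\<omega>. restrict (\<lambda>i. \<xi> i \<omega>) {k<..c k}"
    have wm: "w l \<in> PiM (P k) (\<lambda>_. borel) \<rightarrow>\<^sub>M borel" if "l \<le> k" for l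
      unfolding w_def[abs_def] P_def using that by (intro block_sum_measurable) auto
    have A'm: "A' k \<in> sets (PiM (P k) (\<lambda>_. borel))"
    proof -
      have [measurable]: "(\<lambda>x. norm (w l x - w (b l) x)) \<in> PiM (P k) (\<lambda>_. borel) \<rightarrow>\<^sub>M borel" if "l \<le> k" for l
      proof -
        have bl: "b l \<le> k" using b[of l] that k by simp
        note [measurable] = wm[OF that] wm[OF bl]
        show ?thesis by measurable
      qed
      let ?X = "{x \<in> space (PiM (P k) (\<lambda>_. borel)). norm (w k x - w (b k) x) > 2 * s}"
      let ?Y = "{x \<in> space (PiM (P k) (\<lambda>_. borel)). \<forall>l\<in>{..<k}. \<not> norm (w l x - w (b l) x) > 2 * s}"
      have "?Y \<in> sets (PiM (P k) (\<lambda>_. borel))"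
        by (intro sets.sets_Collect_finite_All sets.sets_Collect_neg) auto
      moreover have "?X \<in> sets (PiM (P k) (\<lambda>_. borel))" by measurable
      moreover have "A' k = ?X \<inter> ?Y" unfolding A'_def by auto
      ultimately show ?thesis by (simp only: sets.Int)
    qed
    have ind: "indep_var (PiM (P k) (\<lambda>_. borel)) ?F (PiM {k<..c k} (\<lambda>_. borel)) ?G"
      by (rule indep_var_restrict[OF indep]) (auto simp: P_def)
    define E' where "E' = {x \<in> space (PiM {k<..c k} (\<lambda>_. borel :: (real ^ 'n) measure)). norm (\<Sum>i\<in>{k<..c k}. x i) \<le> s}"
    have E'm: "E' \<in> sets (PiM {k<..c k} (\<lambda>_. borel))"
    proof -
      note [measurable] = block_sum_measurable[OF order_refl, of "{k<..c k}"]
      show ?thesis unfolding E'_def by measurable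
    qed
    have wW: "w l (?F \<omega>) = W l \<omega>" if "l \<le> k" for l \<omega>
      unfolding w_def W_def using that by (intro sum.cong) (auto simp: P_def)
    have wWb: "w (b l) (?F \<omega>) = W (b l) \<omega>" if "l \<le> k" for l \<omega>
      using wW[of "b l" \<omega>] b[of l] that k by simp
    have GW: "(\<Sum>i\<in>{k<..c k}. ?G \<omega> i) = W (c k) \<omega> - W k \<omega>" for \<omega> using W_diff[OF c[OF k]] by simp
    have Gs: "?G \<omega> \<in> space (PiM {k<..c k} (\<lambda>_. borel))" for \<omega> by (auto simp: space_PiM)
    have Fs: "?F \<omega> \<in> space (PiM (P k) (\<lambda>_. borel))" for \<omega> by (auto simp: space_PiM)
    have 1: "?F -` A' k \<inter> space M = A k"
      using Fs by (auto simp: A'_def A_def wW wWb)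
    have 2: "?G -` E' \<inter> space M = E k"
    proof -
      have "?G \<omega> \<in> E' \<longleftrightarrow> norm (W (c k) \<omega> - W k \<omega>) \<le> s" for \<omega>
        unfolding E'_def mem_Collect_eq GW using Gs by simp
      then show ?thesis by (auto simp: E_def)
    qed
    have "prob ((\<lambda>\<omega>. (?F \<omega>, ?G \<omega>)) -` (A' k \<times> E') \<inter> space M) = prob (?F -` A' k \<inter> space M) * prob (?G -` E' \<inter> space M)"
      by (rule indep_varD[OF ind A'm E'm])
    also have "(\<lambda>\<omega>. (?F \<omega>, ?G \<omega>)) -` (A' k \<times> E') \<inter> space M = (?F -` A' k \<inter> space M) \<inter> (?G -` E' \<inter> space M)"
      by auto
    also have "\<dots> = A k \<inter> E k" unfolding 1 2 ..
    finally show ?thesis unfolding 1 2 .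
  qed
  have half': "prob (E k) \<ge> 1 / 2" if "k \<le> n" for k
  proof -
    have "E k = space M - {\<omega> \<in> space M. norm (W (c k) \<omega> - W k \<omega>) > s}" by (auto simp: E_def)
    then have "prob (E k) = 1 - prob {\<omega> \<in> space M. norm (W (c k) \<omega> - W k \<omega>) > s}"
      by (simp add: prob_compl)
    then show ?thesis using half[OF that] by simp
  qed
  have disj: "disjoint_family_on A {..n}"
    unfolding disjoint_family_on_def
  proof (intro ballI impI)
    fix k l :: nat assume "k \<noteq> l"
    then consider "k < l" | "l < k" by linarith
    then show "A k \<inter> A l = {}" by cases (auto simp: A_def)
  qed
  have "{\<omega> \<in> space M. \<exists>k\<le>n. norm (W k \<omega> - W (b k) \<omega>) > 2 * s} = (\<Union>k\<in>{..n}. A k)"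
  proof (intro set_eqI iffI)
    fix \<omega> assume w: "\<omega> \<in> {\<omega> \<in> space M. \<exists>k\<le>n. norm (W k \<omega> - W (b k) \<omega>) > 2 * s}"
    define k where "k = (LEAST k. norm (W k \<omega> - W (b k) \<omega>) > 2 * s)"
    have "norm (W k \<omega> - W (b k) \<omega>) > 2 * s" unfolding k_def using w by (auto intro: LeastI)
    moreover have "k \<le> n" unfolding k_def using w by (auto intro: order_trans[OF Least_le])
    moreover have "\<not> norm (W l \<omega> - W (b l) \<omega>) > 2 * s" if "l < k" for l
      using not_less_Least[OF that[unfolded k_def]] .
    ultimately show "\<omega> \<in> (\<Union>k\<in>{..n}. A k)" using w by (auto simp: A_def)
  qed (auto simp: A_def)
  then have "prob {\<omega> \<in> space M. \<exists>k\<le>n. norm (W k \<omega> - W (b k) \<omega>) > 2 * s} = (\<Sum>k\<le>n. prob (A k))"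
    using finite_measure_finite_Union[OF _ _ disj] A_meas by (simp add: image_subset_iff)
  also have "\<dots> \<le> (\<Sum>k\<le>n. 2 * prob (A k \<inter> E k))"
  proof (rule sum_mono)
    fix k assume "k \<in> {..n}"
    then have k: "k \<le> n" by simp
    have "prob (A k) * (1 / 2) \<le> prob (A k) * prob (E k)" by (intro mult_left_mono half'[OF k]) simp
    then show "prob (A k) \<le> 2 * prob (A k \<inter> E k)" using prod[OF k] by simp
  qed
  also have "\<dots> = 2 * prob (\<Union>k\<in>{..n}. A k \<inter> E k)"
  proof -
    have "disjoint_family_on (\<lambda>k. A k \<inter> E k) {..n}"
      using disj unfolding disjoint_family_on_def by blast
    then have "prob (\<Union>k\<in>{..n}. A k \<inter> E k) = (\<Sum>k\<le>n. prob (A k \<inter> E k))"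
      by (intro finite_measure_finite_Union) auto
    then show ?thesis by (simp add: sum_distrib_left)
  qed
  also have "prob (\<Union>k\<in>{..n}. A k \<inter> E k) \<le> prob H"
  proof (rule finite_measure_mono[OF _ H_meas], rule subsetI)
    fix \<omega> assume "\<omega> \<in> (\<Union>k\<in>{..n}. A k \<inter> E k)"
    then obtain k where k: "k \<le> n" "\<omega> \<in> space M" "norm (W k \<omega> - W (b k) \<omega>) > 2 * s" "norm (W (c k) \<omega> - W k \<omega>) \<le> s"
      by (auto simp: A_def E_def)
    have "norm (W k \<omega> - W (b k) \<omega>) \<le> norm (W (c k) \<omega> - W (b k) \<omega>) + norm (W (c k) \<omega> - W k \<omega>)"
      using norm_triangle_ineq4[of "W (c k) \<omega> - W (b k) \<omega>" "W (c k) \<omega> - W k \<omega>"] by simp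
    then have "norm (W (c k) \<omega> - W (b k) \<omega>) > s" using k by linarith
    then show "\<omega> \<in> H" using k by (auto simp: H_def)
  qed
  finally show ?thesis by (simp add: H_def)
qed

lemma increment_tail:
  obtains A where "A > 0" "\<And>k l s. k \<le> l \<Longrightarrow> s > 0 \<Longrightarrow>
    prob {\<omega> \<in> space M. norm (W l \<omega> - W k \<omega>) > s} \<le> A * real (l - k) / s\<^sup>2"
    "\<And>k l. k \<le> l \<Longrightarrow> integrable M (\<lambda>\<omega>. (norm (W l \<omega> - W k \<omega>))\<^sup>2)"
    "\<And>k l. k \<le> l \<Longrightarrow> expectation (\<lambda>\<omega>. (norm (W l \<omega> - W k \<omega>))\<^sup>2) \<le> A * real (l - k)"
proof -
  have p2: "(x::real) powr 2 = x\<^sup>2" if "x \<ge> 0" for x using that by simp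
  have "integrable M (\<lambda>\<omega>. norm (\<xi> 1 \<omega>) powr 2)" using square_integrable by (simp add: p2)
  from increment_moment_bound[OF order_refl this]
  obtain A where A: "A \<ge> 0" "\<And>k n. integrable M (\<lambda>\<omega>. norm (W (k + n) \<omega> - W k \<omega>) powr 2)"
    "\<And>k n. expectation (\<lambda>\<omega>. norm (W (k + n) \<omega> - W k \<omega>) powr 2) \<le> A * real n powr (2 / 2)" by blast
  have sq: "integrable M (\<lambda>\<omega>. (norm (W l \<omega> - W k \<omega>))\<^sup>2)"
    "expectation (\<lambda>\<omega>. (norm (W l \<omega> - W k \<omega>))\<^sup>2) \<le> (A + 1) * real (l - k)" if "k \<le> l" for k l
  proof -
    show "integrable M (\<lambda>\<omega>. (norm (W l \<omega> - W k \<omega>))\<^sup>2)"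
      using A(2)[of k "l - k"] that by (simp add: p2)
    have "expectation (\<lambda>\<omega>. (norm (W l \<omega> - W k \<omega>))\<^sup>2) \<le> A * real (l - k)"
      using A(3)[of k "l - k"] that by (simp add: p2 del: of_nat_diff)
    then show "expectation (\<lambda>\<omega>. (norm (W l \<omega> - W k \<omega>))\<^sup>2) \<le> (A + 1) * real (l - k)"
      by (simp add: distrib_right del: of_nat_diff)
  qed
  show thesis
  proof (rule that[of "A + 1"])
    fix k l :: nat and s :: real assume kl: "k \<le> l" and s: "s > 0"
    have "prob {\<omega> \<in> space M. norm (W l \<omega> - W k \<omega>) > s} \<le> prob {\<omega> \<in> space M. (norm (W l \<omega> - W k \<omega>))\<^sup>2 \<ge> s\<^sup>2}"
      using s by (intro finite_measure_mono) (auto intro: power_mono)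
    also have "\<dots> \<le> expectation (\<lambda>\<omega>. (norm (W l \<omega> - W k \<omega>))\<^sup>2) / s\<^sup>2"
      using s by (intro integral_Markov_inequality_measure[where A="{}"] sq kl) auto
    also have "\<dots> \<le> (A + 1) * real (l - k) / s\<^sup>2" by (intro divide_right_mono sq kl) simp
    finally show "prob {\<omega> \<in> space M. norm (W l \<omega> - W k \<omega>) > s} \<le> (A + 1) * real (l - k) / s\<^sup>2" .
  qed (use A sq in auto)
qed

definition maxW :: "nat \<Rightarrow> 'w \<Rightarrow> real" where
  "maxW n \<omega> = Max ((\<lambda>k. norm (W k \<omega>)) ` {..n})"

lemma maxW_ge: "k \<le> n \<Longrightarrow> norm (W k \<omega>) \<le> maxW n \<omega>"
  unfolding maxW_def by (intro Max_ge) auto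

lemma maxW_nonneg: "0 \<le> maxW n \<omega>"
  using order_trans[OF norm_ge_zero maxW_ge[of 0 n \<omega>]] by simp

lemma maxW_measurable [measurable]: "maxW n \<in> borel_measurable M"
  unfolding maxW_def[abs_def] by (intro borel_measurable_Max) auto

text \<open>Above the level \<open>s0\<close> of order \<open>sqrt n\<close>, Chebyshev supplies the
  probability 1/2 that Ottaviani requires, with start 0 and end \<open>n\<close> for all indices.
  The tail of half the maximum is then dominated by that of the end point, and the part below
  \<open>s0\<close> already has order \<open>n powr (q / 2)\<close>.\<close>

lemma maxW_moment_bound:
  assumes q: "q \<ge> 2" and int: "integrable M (\<lambda>\<omega>. norm (\<xi> 1 \<omega>) powr q)"
  obtains C where "C \<ge> 0" "\<And>n. integrable M (\<lambda>\<omega>. maxW n \<omega> powr q)"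
    "\<And>n. expectation (\<lambda>\<omega>. maxW n \<omega> powr q) \<le> C * real n powr (q / 2)"
proof -
  obtain A where A: "A \<ge> 0" "\<And>k n. integrable M (\<lambda>\<omega>. norm (W (k + n) \<omega> - W k \<omega>) powr q)"
    "\<And>k n. expectation (\<lambda>\<omega>. norm (W (k + n) \<omega> - W k \<omega>) powr q) \<le> A * real n powr (q / 2)"
    using increment_moment_bound[OF assms] by blast
  obtain B where B: "B > 0" "\<And>k l s. k \<le> l \<Longrightarrow> s > 0 \<Longrightarrow>
    prob {\<omega> \<in> space M. norm (W l \<omega> - W k \<omega>) > s} \<le> B * real (l - k) / s\<^sup>2"
    "\<And>k l. k \<le> l \<Longrightarrow> integrable M (\<lambda>\<omega>. (norm (W l \<omega> - W k \<omega>))\<^sup>2)"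
    "\<And>k l. k \<le> l \<Longrightarrow> expectation (\<lambda>\<omega>. (norm (W l \<omega> - W k \<omega>))\<^sup>2) \<le> B * real (l - k)"
    by (rule increment_tail) (rule that)
  define C where "C = 2 powr q * ((2 * B) powr (q / 2) + 2 * A)"
  have W0: "W 0 \<omega> = 0" for \<omega> by (simp add: W_def)
  have main: "integrable M (\<lambda>\<omega>. maxW n \<omega> powr q) \<and> expectation (\<lambda>\<omega>. maxW n \<omega> powr q) \<le> C * real n powr (q / 2)" for n
  proof (cases "n = 0")
    case True
    then have "maxW n \<omega> = 0" for \<omega> by (simp add: maxW_def W0)
    then show ?thesis using True by simp
  next
    case False
    define s0 where "s0 = sqrt (2 * B * real n)"
    have s0: "s0 > 0" using False B by (simp add: s0_def)
    have tail: "prob {\<omega> \<in> space M. maxW n \<omega> / 2 > s} \<le> 2 * prob {\<omega> \<in> space M. norm (W n \<omega>) > s}" if s: "s \<ge> s0" for s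
    proof -
      have "s > 0" using s s0 by simp
      have "s0\<^sup>2 \<le> s\<^sup>2" using s s0 by (intro power_mono) auto
      then have sB: "2 * B * real n \<le> s\<^sup>2" using B by (simp add: s0_def)
      have "prob {\<omega> \<in> space M. norm (W n \<omega> - W k \<omega>) > s} \<le> 1 / 2" if "k \<le> n" for k
      proof -
        have "prob {\<omega> \<in> space M. norm (W n \<omega> - W k \<omega>) > s} \<le> B * real (n - k) / s\<^sup>2"
          using B(2)[OF that \<open>s > 0\<close>] .
        also have "\<dots> \<le> B * real n / s\<^sup>2" using B by (intro divide_right_mono mult_left_mono) auto
        also have "\<dots> \<le> 1 / 2" using sB \<open>s > 0\<close> by (simp add: divide_le_eq)
        finally show ?thesis .
      qed
      note * = ottaviani[of n "\<lambda>_. 0" "\<lambda>_. n" s, OF _ _ this]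
      have "prob {\<omega> \<in> space M. \<exists>k\<le>n. norm (W k \<omega>) > 2 * s} \<le> 2 * prob {\<omega> \<in> space M. norm (W n \<omega>) > s}"
      proof -
        have "\<exists>k. k \<le> n" by blast
        then show ?thesis using *[OF le0] by (simp add: W0)
      qed
      moreover have "maxW n \<omega> / 2 > s \<longleftrightarrow> (\<exists>k\<le>n. norm (W k \<omega>) > 2 * s)" for \<omega>
        unfolding maxW_def by (subst less_divide_eq_numeral1, subst Max_gr_iff) (auto simp: mult.commute)
      ultimately show ?thesis by simp
    qed
    have Wint: "integrable M (\<lambda>\<omega>. norm (W n \<omega>) powr q)" and Wexp: "expectation (\<lambda>\<omega>. norm (W n \<omega>) powr q) \<le> A * real n powr (q / 2)"
      using A(2,3)[of 0 n] by (simp_all add: W0)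
    have T: "integrable M (\<lambda>\<omega>. (maxW n \<omega> / 2) powr q)"
      "expectation (\<lambda>\<omega>. (maxW n \<omega> / 2) powr q) \<le> s0 powr q + 2 * expectation (\<lambda>\<omega>. norm (W n \<omega>) powr q)"
      using moment_of_tail_comparison[of "\<lambda>\<omega>. maxW n \<omega> / 2" "\<lambda>\<omega>. norm (W n \<omega>)" q s0 2] maxW_nonneg q s0 tail Wint
      by auto
    have split: "maxW n \<omega> powr q = 2 powr q * (maxW n \<omega> / 2) powr q" for \<omega>
      using powr_mult[of 2 "maxW n \<omega> / 2" q] maxW_nonneg by simp
    have s0q: "s0 powr q = (2 * B) powr (q / 2) * real n powr (q / 2)"
      using B by (simp add: s0_def powr_powr powr_mult flip: powr_half_sqrt)
    have "expectation (\<lambda>\<omega>. maxW n \<omega> powr q) = 2 powr q * expectation (\<lambda>\<omega>. (maxW n \<omega> / 2) powr q)"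
      unfolding split by simp
    also have "\<dots> \<le> 2 powr q * (s0 powr q + 2 * (A * real n powr (q / 2)))"
      using T(2) Wexp by (intro mult_left_mono) auto
    also have "\<dots> = C * real n powr (q / 2)" by (simp add: C_def s0q algebra_simps)
    finally show ?thesis using T(1) unfolding split by simp
  qed
  have "C \<ge> 0" using A by (simp add: C_def)
  then show thesis using that main by blast
qed

end

section \<open>Finite-dimensional convergence and oscillation\<close>

lemma (in prob_space) expectation_cos_shift:
  assumes Z: "Z \<in> borel_measurable M"
  shows "expectation (\<lambda>\<omega>. cos (Z \<omega> + b)) = Re (iexp b * (CLINT \<omega>|M. iexp (Z \<omega>)))"
proof -
  have int: "integrable M (\<lambda>\<omega>. iexp (Z \<omega>))"
    using Z by (intro integrable_iexp) auto
  have "cos (Z \<omega> + b) = Re (iexp b * iexp (Z \<omega>))" for \<omega>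
    by (simp add: exp_Euler cos_add cos_of_real sin_of_real)
  then have "expectation (\<lambda>\<omega>. cos (Z \<omega> + b)) = expectation (\<lambda>\<omega>. Re (iexp b * iexp (Z \<omega>)))" by simp
  also have "\<dots> = Re (CLINT \<omega>|M. iexp b * iexp (Z \<omega>))"
    using int by (intro integral_Re integrable_mult_right) auto
  also have "\<dots> = Re (iexp b * (CLINT \<omega>|M. iexp (Z \<omega>)))" by simp
  finally show ?thesis .
qed

definition increments :: "(real \<Rightarrow> 'v \<Rightarrow> 'a::real_vector) \<Rightarrow> nat \<Rightarrow> 'v \<Rightarrow> nat \<Rightarrow> 'a" where
  "increments X J \<omega> j = X (real (Suc j) / real J) \<omega> - X (real j / real J) \<omega>"

lemma brownian_increments_char:
  fixes X :: "real \<Rightarrow> 'v \<Rightarrow> real ^ 'n"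
  assumes X: "brownian_motion N C X" and J: "J > 0" and C: "\<And>v. 0 \<le> v \<bullet> (C *v v)"
  shows "(CLINT \<omega>|N. iexp (\<Sum>j<J. v j \<bullet> increments X J \<omega> j)) =
    (\<Prod>j<J. complex_of_real (exp (- (1 / real J * (v j \<bullet> (C *v v j)) / 2))))"
proof -
  interpret N: prob_space N using X by (simp add: brownian_motion_def)
  define t where "t j = real j / real J" for j
  have "0 \<le> t 0 \<and> (\<forall>i<J. t i \<le> t (Suc i))" by (auto simp: t_def divide_right_mono)
  then have "N.indep_vars (\<lambda>_. borel) (\<lambda>i \<omega>. X (t (Suc i)) \<omega> - X (t i) \<omega>) {..<J}"
    using X unfolding brownian_motion_def by blast
  then have ind: "N.indep_vars (\<lambda>_. borel) (\<lambda>i \<omega>. v i \<bullet> (X (t (Suc i)) \<omega> - X (t i) \<omega>)) {..<J}"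
    by (rule N.indep_vars_compose2[where Y="\<lambda>i x. v i \<bullet> x" and M'="\<lambda>_. borel"]) auto
  have m: "X s \<in> borel_measurable N" if "s \<ge> 0" for s using X that by (auto simp: brownian_motion_def)
  have [measurable]: "X (t i) \<in> borel_measurable N" for i by (rule m) (simp add: t_def)
  have inc: "increments X J \<omega> j = X (t (Suc j)) \<omega> - X (t j) \<omega>" for \<omega> j
    by (simp only: increments_def t_def)
  have "(CLINT \<omega>|N. iexp (\<Sum>j<J. v j \<bullet> increments X J \<omega> j)) =
    char (distr N borel (\<lambda>\<omega>. \<Sum>j<J. v j \<bullet> (X (t (Suc j)) \<omega> - X (t j) \<omega>))) 1"
    unfolding char_def by (subst integral_distr) (auto simp: inc)
  also have "\<dots> = (\<Prod>j<J. char (distr N borel (\<lambda>\<omega>. v j \<bullet> (X (t (Suc j)) \<omega> - X (t j) \<omega>))) 1)"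
    by (rule N.char_distr_sum[OF ind])
  also have "\<dots> = (\<Prod>j<J. complex_of_real (exp (- (1 / real J * (v j \<bullet> (C *v v j)) / 2))))"
  proof (rule prod.cong)
    fix j
    have "0 \<le> t j \<and> t j < t (Suc j)" using J by (simp add: t_def divide_strict_right_mono)
    then have "centered_gaussian N ((t (Suc j) - t j) *\<^sub>R C) (\<lambda>\<omega>. X (t (Suc j)) \<omega> - X (t j) \<omega>)"
      using X unfolding brownian_motion_def by blast
    then have "distr N borel (\<lambda>\<omega>. v j \<bullet> (X (t (Suc j)) \<omega> - X (t j) \<omega>)) =
      centered_normal (v j \<bullet> (((t (Suc j) - t j) *\<^sub>R C) *v v j))"
      by (simp add: centered_gaussian_def)
    also have "t (Suc j) - t j = 1 / real J" by (simp add: t_def flip: diff_divide_distrib)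
    also have "v j \<bullet> (((1 / real J) *\<^sub>R C) *v v j) = 1 / real J * (v j \<bullet> (C *v v j))"
      by (simp flip: scaleR_matrix_vector_assoc)
    finally show "char (distr N borel (\<lambda>\<omega>. v j \<bullet> (X (t (Suc j)) \<omega> - X (t j) \<omega>))) 1 =
      complex_of_real (exp (- (1 / real J * (v j \<bullet> (C *v v j)) / 2)))"
      using C[of "v j"] by (simp add: char_centered_normal)
  qed simp
  finally show ?thesis .
qed

text \<open>A step \<open>k > 0\<close> belongs to the block that it ends or lies inside, never to
  an empty one; the starting point \<open>k = 0\<close> is put into block 0.\<close>

definition block :: "nat \<Rightarrow> nat \<Rightarrow> nat \<Rightarrow> nat" where
  "block J n k = (LEAST j. k \<le> grid J n (Suc j))"

lemma block_bounds:
  assumes J: "J > 0" and k: "k \<le> n"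
  shows "block J n k < J" "grid J n (block J n k) \<le> k" "k \<le> grid J n (Suc (block J n k))"
proof -
  have "k \<le> grid J n (Suc (J - 1))" using J k by simp
  then have "block J n k \<le> J - 1" unfolding block_def by (rule Least_le)
  then show "block J n k < J" using J by simp
  show "k \<le> grid J n (Suc (block J n k))" unfolding block_def
    by (rule LeastI[of "\<lambda>j. k \<le> grid J n (Suc j)" "J - 1"]) (use J k in simp)
  show "grid J n (block J n k) \<le> k"
  proof (cases "block J n k")
    case (Suc i)
    then have "\<not> k \<le> grid J n (Suc i)" using not_less_Least[of i "\<lambda>j. k \<le> grid J n (Suc j)"] by (simp add: block_def)
    then show ?thesis using Suc by simp
  qed simp
qed

context centered_walk
begin

definition block_increments :: "nat \<Rightarrow> nat \<Rightarrow> 'w \<Rightarrow> nat \<Rightarrow> real ^ 'n" where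
  "block_increments J n \<omega> j = (W (grid J n (Suc j)) \<omega> - W (grid J n j) \<omega>) /\<^sub>R sqrt (real n)"

text \<open>The vectors of increments are flattened to real coordinates indexed by block and
  component. Linear combinations of these are sums of inner products over the blocks, for which both
  characteristic functions are known.\<close>

lemma fidi_convergence:
  fixes X :: "real \<Rightarrow> 'v \<Rightarrow> real ^ 'n" and g :: "(nat \<Rightarrow> real ^ 'n) \<Rightarrow> real"
  assumes X: "brownian_motion N C X" and C: "\<And>v. v \<bullet> (C *v v) = expectation (\<lambda>\<omega>. (v \<bullet> \<xi> 1 \<omega>)\<^sup>2)"
    and J: "J > 0" and g: "continuous_on UNIV g" "\<And>x. \<bar>g x\<bar> \<le> B" "\<And>x y. (\<And>j. j < J \<Longrightarrow> x j = y j) \<Longrightarrow> g x = g y"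
  shows "(\<lambda>n. expectation (\<lambda>\<omega>. g (block_increments J n \<omega>))) \<longlonglongrightarrow> (\<integral>\<omega>. g (increments X J \<omega>) \<partial>N)"
proof -
  have N: "prob_space N" using X by (simp add: brownian_motion_def)
  have mX: "X s \<in> borel_measurable N" if "s \<ge> 0" for s using X that by (auto simp: brownian_motion_def)
  define I where "I = {..<J} \<times> (UNIV :: 'n set)"
  define f where "f x = g (\<lambda>j. \<chi> i. x (j, i))" for x :: "nat \<times> 'n \<Rightarrow> real"
  define z where "z n \<omega> p = block_increments J n \<omega> (fst p) $ snd p" for n \<omega> and p :: "nat \<times> 'n"
  define y where "y \<omega> p = increments X J \<omega> (fst p) $ snd p" for \<omega> and p :: "nat \<times> 'n"
  have fz: "f (z n \<omega>) = g (block_increments J n \<omega>)" for n \<omega> by (simp add: f_def z_def)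
  have fy: "f (y \<omega>) = g (increments X J \<omega>)" for \<omega> by (simp add: f_def y_def)
  have sumz: "(\<Sum>p\<in>I. u p * z n \<omega> p) = (\<Sum>j<J. (\<chi> i. u (j, i)) \<bullet> block_increments J n \<omega> j)" for u n \<omega>
    unfolding I_def by (simp add: inner_vec_def z_def sum.cartesian_product split_beta)
  have sumy: "(\<Sum>p\<in>I. u p * y \<omega> p) = (\<Sum>j<J. (\<chi> i. u (j, i)) \<bullet> increments X J \<omega> j)" for u \<omega>
    unfolding I_def by (simp add: inner_vec_def y_def sum.cartesian_product split_beta)
  have z_meas: "(\<lambda>\<omega>. z n \<omega> p) \<in> borel_measurable M" for n p
    unfolding z_def block_increments_def by measurable
  have y_meas: "(\<lambda>\<omega>. y \<omega> p) \<in> borel_measurable N" for p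
  proof -
    have [measurable]: "X (real (Suc (fst p)) / real J) \<in> borel_measurable N" "X (real (fst p) / real J) \<in> borel_measurable N"
      by (rule mX; simp)+
    show ?thesis unfolding y_def increments_def by measurable
  qed
  obtain A where A: "A > 0" "\<And>k l s. k \<le> l \<Longrightarrow> s > 0 \<Longrightarrow>
    prob {\<omega> \<in> space M. norm (W l \<omega> - W k \<omega>) > s} \<le> A * real (l - k) / s\<^sup>2"
    "\<And>k l. k \<le> l \<Longrightarrow> integrable M (\<lambda>\<omega>. (norm (W l \<omega> - W k \<omega>))\<^sup>2)"
    "\<And>k l. k \<le> l \<Longrightarrow> expectation (\<lambda>\<omega>. (norm (W l \<omega> - W k \<omega>))\<^sup>2) \<le> A * real (l - k)"
    by (rule increment_tail) (rule that)
  \<comment> \<open>A block has at most \<open>n\<close> steps, so after division by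
    \<open>sqrt n\<close> its second moment is bounded uniformly in \<open>n\<close>.\<close>
  have sq: "integrable M (\<lambda>\<omega>. (z n \<omega> p)\<^sup>2)" "expectation (\<lambda>\<omega>. (z n \<omega> p)\<^sup>2) \<le> A" if "p \<in> I" for n p
  proof -
    let ?k = "grid J n (fst p)" and ?l = "grid J n (Suc (fst p))"
    have kl: "?k \<le> ?l" by (rule grid_mono) simp
    have ln: "?l \<le> n" using that by (intro grid_le) (auto simp: I_def)
    have le: "(z n \<omega> p)\<^sup>2 \<le> (norm (W ?l \<omega> - W ?k \<omega>))\<^sup>2 / real n" for \<omega>
    proof -
      have "\<bar>z n \<omega> p\<bar> \<le> norm (block_increments J n \<omega> (fst p))" unfolding z_def by (rule component_le_norm_cart)
      then have "\<bar>z n \<omega> p\<bar>\<^sup>2 \<le> (norm (block_increments J n \<omega> (fst p)))\<^sup>2" by (intro power_mono) auto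
      then show ?thesis by (simp add: block_increments_def power_mult_distrib power_inverse divide_inverse mult.commute)
    qed
    have int: "integrable M (\<lambda>\<omega>. (norm (W ?l \<omega> - W ?k \<omega>))\<^sup>2 / real n)" using A(3)[OF kl] by simp
    show i: "integrable M (\<lambda>\<omega>. (z n \<omega> p)\<^sup>2)"
      by (rule Bochner_Integration.integrable_bound[OF int]) (use z_meas le in \<open>auto intro!: AE_I2 borel_measurable_power\<close>)
    have "expectation (\<lambda>\<omega>. (z n \<omega> p)\<^sup>2) \<le> expectation (\<lambda>\<omega>. (norm (W ?l \<omega> - W ?k \<omega>))\<^sup>2 / real n)"
      by (rule integral_mono[OF i int le])
    also have "\<dots> \<le> A * real (?l - ?k) / real n" using A(4)[OF kl] by (simp add: divide_right_mono del: of_nat_diff)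
    also have "\<dots> \<le> A * real n / real n" using ln A by (intro divide_right_mono mult_left_mono) auto
    also have "\<dots> \<le> A" using A by (cases "n = 0") auto
    finally show "expectation (\<lambda>\<omega>. (z n \<omega> p)\<^sup>2) \<le> A" .
  qed
  have cosconv: "(\<lambda>n. expectation (\<lambda>\<omega>. cos ((\<Sum>p\<in>I. u p * z n \<omega> p) + b))) \<longlonglongrightarrow>
    (\<integral>\<omega>. cos ((\<Sum>p\<in>I. u p * y \<omega> p) + b) \<partial>N)" for u b
  proof -
    define v where "v j = (\<chi> i. u (j, i))" for j
    have C0: "0 \<le> w \<bullet> (C *v w)" for w unfolding C by simp
    have "(\<lambda>n. CLINT \<omega>|M. iexp (\<Sum>j<J. v j \<bullet> block_increments J n \<omega> j)) \<longlonglongrightarrow>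
      (CLINT \<omega>|N. iexp (\<Sum>j<J. v j \<bullet> increments X J \<omega> j))"
      using char_blocks_tendsto[OF J, of v] unfolding brownian_increments_char[OF X J C0] C block_increments_def .
    then have "(\<lambda>n. CLINT \<omega>|M. iexp (\<Sum>p\<in>I. u p * z n \<omega> p)) \<longlonglongrightarrow> (CLINT \<omega>|N. iexp (\<Sum>p\<in>I. u p * y \<omega> p))"
      unfolding sumz sumy v_def .
    then have "(\<lambda>n. Re (iexp b * (CLINT \<omega>|M. iexp (\<Sum>p\<in>I. u p * z n \<omega> p)))) \<longlonglongrightarrow>
      Re (iexp b * (CLINT \<omega>|N. iexp (\<Sum>p\<in>I. u p * y \<omega> p)))"
      by (intro tendsto_Re tendsto_mult_left)
    moreover have "(\<lambda>\<omega>. \<Sum>p\<in>I. u p * z n \<omega> p) \<in> borel_measurable M" for n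
      by (intro borel_measurable_sum borel_measurable_times borel_measurable_const z_meas)
    moreover have "(\<lambda>\<omega>. \<Sum>p\<in>I. u p * y \<omega> p) \<in> borel_measurable N"
      by (intro borel_measurable_sum borel_measurable_times borel_measurable_const y_meas)
    ultimately show ?thesis
      by (simp only: expectation_cos_shift prob_space.expectation_cos_shift[OF N])
  qed
  have fin: "finite I" by (simp add: I_def)
  have fc: "continuous_on UNIV f"
  proof -
    have "continuous_on UNIV (\<lambda>x :: nat \<times> 'n \<Rightarrow> real. x p)" for p by (rule continuous_on_product_coordinates)
    then have "continuous_on UNIV (\<lambda>x :: nat \<times> 'n \<Rightarrow> real. (\<lambda>j. \<chi> i. x (j, i)))"
      by (intro continuous_on_coordinatewise_then_product continuous_on_vec_lambda)
    then show ?thesis unfolding f_def by (rule continuous_on_compose2[OF g(1)]) simp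
  qed
  have "(\<lambda>n. expectation (\<lambda>\<omega>. f (z n \<omega>))) \<longlonglongrightarrow> (\<integral>\<omega>. f (y \<omega>) \<partial>N)"
  proof (rule weak_convergence_of_characteristic_functions[OF prob_space_axioms N fin z_meas y_meas sq cosconv fc])
    show "\<bar>f x\<bar> \<le> B" for x unfolding f_def by (rule g(2))
    show "f x = f x'" if "\<And>p. p \<in> I \<Longrightarrow> x p = x' p" for x x'
      unfolding f_def by (rule g(3)) (use that in \<open>auto simp: I_def vec_eq_iff\<close>)
  qed
  then show ?thesis unfolding fz fy .
qed

text \<open>The upper half of the portmanteau theorem, made quantitative: a continuous function is
  squeezed between the indicators for the levels \<open>s\<close> and \<open>s / 2\<close>, hence
  the loss of a factor 2 in the level.\<close>

lemma block_sup_probability: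
  fixes X :: "real \<Rightarrow> 'v \<Rightarrow> real ^ 'n"
  assumes X: "brownian_motion N C X" and C: "\<And>v. v \<bullet> (C *v v) = expectation (\<lambda>\<omega>. (v \<bullet> \<xi> 1 \<omega>)\<^sup>2)"
    and J: "J > 0" and s: "s > 0" and e: "e > 0"
  shows "\<forall>\<^sub>F n in sequentially. prob {\<omega> \<in> space M. \<exists>j<J. norm (block_increments J n \<omega> j) > s} \<le>
    measure N {\<omega> \<in> space N. \<exists>j<J. norm (increments X J \<omega> j) > s / 2} + e"
proof -
  have N: "prob_space N" using X by (simp add: brownian_motion_def)
  interpret N: prob_space N by (rule N)
  have mX: "X s \<in> borel_measurable N" if "s \<ge> 0" for s using X that by (auto simp: brownian_motion_def)
  have inc_meas[measurable]: "(\<lambda>\<omega>. increments X J \<omega> j) \<in> borel_measurable N" for j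
  proof -
    have [measurable]: "X (real (Suc j) / real J) \<in> borel_measurable N" "X (real j / real J) \<in> borel_measurable N"
      by (rule mX; simp)+
    show ?thesis unfolding increments_def by measurable
  qed
  have blk_meas[measurable]: "(\<lambda>\<omega>. block_increments J n \<omega> j) \<in> borel_measurable M" for n j
    unfolding block_increments_def by measurable
  \<comment> \<open>Zero up to norm \<open>s / 2\<close>, and at least 1 from norm \<open>s\<close>
    on.\<close>
  define \<psi> where "\<psi> v = max 0 (2 * norm v / s - 1)" for v :: "real ^ 'n"
  define g where "g x = min 1 (\<Sum>j<J. \<psi> (x j))" for x :: "nat \<Rightarrow> real ^ 'n"
  have g0: "0 \<le> g x" for x by (simp add: g_def \<psi>_def sum_nonneg)
  have g1: "g x \<le> 1" for x by (simp add: g_def)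
  have gc: "continuous_on UNIV g"
  proof -
    have "continuous_on UNIV (\<lambda>x :: nat \<Rightarrow> real ^ 'n. x j)" for j by (rule continuous_on_product_coordinates)
    then show ?thesis unfolding g_def \<psi>_def using s
      by (intro continuous_on_min continuous_on_const continuous_on_sum continuous_on_max continuous_on_diff continuous_on_divide continuous_on_mult continuous_on_norm) auto
  qed
  have low: "1 \<le> g x" if large: "\<exists>j<J. norm (x j) > s" for x
  proof -
    obtain j where j: "j < J" "norm (x j) > s" using large by blast
    have "1 \<le> \<psi> (x j)" using j s by (simp add: \<psi>_def le_max_iff_disj pos_le_divide_eq)
    also have "\<dots> \<le> (\<Sum>j<J. \<psi> (x j))" using j by (intro member_le_sum) (auto simp: \<psi>_def)
    finally show ?thesis by (simp add: g_def)
  qed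
  have up: "g x = 0" if small: "\<not> (\<exists>j<J. norm (x j) > s / 2)" for x
  proof -
    have "\<psi> (x j) = 0" if "j < J" for j
    proof -
      have "\<not> norm (x j) > s / 2" using small that by blast
      then have "2 * norm (x j) / s \<le> 1" using s by (simp add: divide_le_eq not_less)
      then show ?thesis by (simp add: \<psi>_def)
    qed
    then show ?thesis by (simp add: g_def)
  qed
  have "(\<lambda>n. expectation (\<lambda>\<omega>. g (block_increments J n \<omega>))) \<longlonglongrightarrow> (\<integral>\<omega>. g (increments X J \<omega>) \<partial>N)"
  proof (rule fidi_convergence[OF X C J gc])
    show "\<bar>g x\<bar> \<le> 1" for x using g0[of x] g1[of x] by simp
    show "g x = g y" if "\<And>j. j < J \<Longrightarrow> x j = y j" for x y unfolding g_def using that by simp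
  qed
  moreover have "(\<integral>\<omega>. g (increments X J \<omega>) \<partial>N) < (\<integral>\<omega>. g (increments X J \<omega>) \<partial>N) + e" using e by simp
  ultimately have ev: "\<forall>\<^sub>F n in sequentially. expectation (\<lambda>\<omega>. g (block_increments J n \<omega>)) < (\<integral>\<omega>. g (increments X J \<omega>) \<partial>N) + e"
    by (rule order_tendstoD)
  have gm: "g \<in> borel_measurable borel" by (rule borel_measurable_continuous_onI[OF gc])
  have intN: "integrable N (\<lambda>\<omega>. g (increments X J \<omega>))"
    using g0 g1 by (intro N.integrable_const_bound[of _ 1] measurable_compose[OF _ gm] measurable_coordinatewise_then_product) auto
  have intM: "integrable M (\<lambda>\<omega>. g (block_increments J n \<omega>))" for n
    using g0 g1 by (intro integrable_const_bound[of _ 1] measurable_compose[OF _ gm] measurable_coordinatewise_then_product) auto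
  have upN: "(\<integral>\<omega>. g (increments X J \<omega>) \<partial>N) \<le> measure N {\<omega> \<in> space N. \<exists>j<J. norm (increments X J \<omega> j) > s / 2}"
  proof -
    let ?S = "{\<omega> \<in> space N. \<exists>j<J. norm (increments X J \<omega> j) > s / 2}"
    have S: "?S \<in> sets N" by measurable
    have "(\<integral>\<omega>. g (increments X J \<omega>) \<partial>N) \<le> (\<integral>\<omega>. indicator ?S \<omega> \<partial>N)"
    proof (rule integral_mono[OF intN])
      show "integrable N (indicator ?S :: 'v \<Rightarrow> real)" using S by (simp add: N.emeasure_eq_measure)
      fix \<omega> assume w: "\<omega> \<in> space N"
      show "g (increments X J \<omega>) \<le> indicator ?S \<omega>"
      proof (cases "\<exists>j<J. norm (increments X J \<omega> j) > s / 2")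
        case True
        then show ?thesis using w g1 by (simp add: indicator_def)
      next
        case False
        then show ?thesis using up[OF False] by (simp add: indicator_def)
      qed
    qed
    also have "\<dots> = measure N ?S" using S by simp
    finally show ?thesis .
  qed
  have lowM: "prob {\<omega> \<in> space M. \<exists>j<J. norm (block_increments J n \<omega> j) > s} \<le> expectation (\<lambda>\<omega>. g (block_increments J n \<omega>))" for n
  proof -
    let ?S = "{\<omega> \<in> space M. \<exists>j<J. norm (block_increments J n \<omega> j) > s}"
    have S: "?S \<in> sets M" by measurable
    have "prob ?S = expectation (indicator ?S)" using S by simp
    also have "\<dots> \<le> expectation (\<lambda>\<omega>. g (block_increments J n \<omega>))"
    proof (rule integral_mono[OF _ intM])
      show "integrable M (indicator ?S :: 'w \<Rightarrow> real)" using S by (simp add: emeasure_eq_measure)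
      fix \<omega> assume "\<omega> \<in> space M"
      then show "indicator ?S \<omega> \<le> g (block_increments J n \<omega>)"
        using low[of "block_increments J n \<omega>"] g0[of "block_increments J n \<omega>"] by (cases "\<omega> \<in> ?S") auto
    qed
    finally show ?thesis .
  qed
  show ?thesis using ev
  proof eventually_elim
    case (elim n)
    then show ?case using lowM[of n] upN by linarith
  qed
qed

text \<open>Each path is uniformly continuous on the unit interval, so for every single outcome the
  event fails from some \<open>J\<close> on; dominated convergence turns this into
  probabilities.\<close>

lemma brownian_grid_oscillation:
  fixes X :: "real \<Rightarrow> 'v \<Rightarrow> real ^ 'n"
  assumes X: "brownian_motion N C X" and s: "s > 0"
  shows "(\<lambda>J. measure N {\<omega> \<in> space N. \<exists>j<J. norm (increments X J \<omega> j) > s}) \<longlonglongrightarrow> 0"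
proof -
  have N: "prob_space N" using X by (simp add: brownian_motion_def)
  interpret N: prob_space N by (rule N)
  have mX: "X s \<in> borel_measurable N" if "s \<ge> 0" for s using X that by (auto simp: brownian_motion_def)
  have inc_meas[measurable]: "(\<lambda>\<omega>. increments X J \<omega> j) \<in> borel_measurable N" for J j
  proof -
    have [measurable]: "X (real (Suc j) / real J) \<in> borel_measurable N" "X (real j / real J) \<in> borel_measurable N"
      by (rule mX; simp)+
    show ?thesis unfolding increments_def by measurable
  qed
  define S where "S J = {\<omega> \<in> space N. \<exists>j<J. norm (increments X J \<omega> j) > s}" for J
  have [measurable]: "S J \<in> sets N" for J unfolding S_def by measurable
  have "(\<lambda>J. \<integral>\<omega>. indicator (S J) \<omega> \<partial>N :: real) \<longlonglongrightarrow> (\<integral>\<omega>. 0 \<partial>N)"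
  proof (rule integral_dominated_convergence[where w="\<lambda>_. 1"])
    show "AE \<omega> in N. (\<lambda>J. indicator (S J) \<omega> :: real) \<longlonglongrightarrow> 0"
    proof (rule AE_I2)
      fix \<omega> assume w: "\<omega> \<in> space N"
      have "continuous_on {0..} (\<lambda>t. X t \<omega>)" using X w by (auto simp: brownian_motion_def)
      then have "continuous_on {0..1} (\<lambda>t. X t \<omega>)" by (rule continuous_on_subset) auto
      then have "uniformly_continuous_on {0..1} (\<lambda>t. X t \<omega>)" by (rule compact_uniformly_continuous) simp
      then obtain d where d: "d > 0" "\<And>t u. t \<in> {0..1} \<Longrightarrow> u \<in> {0..1} \<Longrightarrow> dist u t < d \<Longrightarrow> dist (X u \<omega>) (X t \<omega>) < s"
        unfolding uniformly_continuous_on_def using s by metis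
      obtain J0 :: nat where J0: "1 / d < real J0" using reals_Archimedean2 by blast
      have "indicator (S J) \<omega> = (0 :: real)" if "J \<ge> J0" "J > 0" for J
      proof -
        have "1 / d < real J" using J0 that by linarith
        then have dJ: "1 / real J < d" using d(1) that by (simp add: divide_less_eq mult.commute)
        have "norm (increments X J \<omega> j) < s" if "j < J" for j
        proof -
          have "dist (real (Suc j) / real J) (real j / real J) = 1 / real J"
            by (simp add: dist_real_def flip: diff_divide_distrib)
          then have "dist (X (real (Suc j) / real J) \<omega>) (X (real j / real J) \<omega>) < s"
            using that dJ by (intro d(2)) (auto simp: divide_le_eq)
          then show ?thesis by (simp add: increments_def dist_norm)
        qed
        then have "\<omega> \<notin> S J" unfolding S_def using less_asym by blast
        then show ?thesis by simp
      qed
      then have "\<forall>\<^sub>F J in sequentially. indicator (S J) \<omega> = (0 :: real)"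
        by (intro eventually_sequentiallyI[of "max 1 J0"]) auto
      then show "(\<lambda>J. indicator (S J) \<omega> :: real) \<longlonglongrightarrow> 0" by (rule tendsto_eventually)
    qed
  qed auto
  then show ?thesis by (simp add: S_def[symmetric])
qed

text \<open>Ottaviani with the two ends of the block containing \<open>k\<close>. A block has about
  \<open>n / J\<close> steps, so for large \<open>J\<close> the remaining increment exceeds
  \<open>s * sqrt n\<close> with probability at most 1/2, uniformly in \<open>k\<close>; the
  increments over full blocks are handled by their Brownian limit.\<close>

lemma oscillation:
  fixes X :: "real \<Rightarrow> 'v \<Rightarrow> real ^ 'n"
  assumes X: "brownian_motion N C X" and C: "\<And>v. v \<bullet> (C *v v) = expectation (\<lambda>\<omega>. (v \<bullet> \<xi> 1 \<omega>)\<^sup>2)"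
    and s: "s > 0" and e: "e > 0"
  shows "\<forall>\<^sub>F J in sequentially. \<forall>\<^sub>F n in sequentially.
    prob {\<omega> \<in> space M. \<exists>k\<le>n. norm (W k \<omega> - W (grid J n (block J n k)) \<omega>) > 2 * (s * sqrt (real n))} \<le> e"
proof -
  obtain A where A: "A > 0" "\<And>k l s. k \<le> l \<Longrightarrow> s > 0 \<Longrightarrow>
    prob {\<omega> \<in> space M. norm (W l \<omega> - W k \<omega>) > s} \<le> A * real (l - k) / s\<^sup>2"
    "\<And>k l. k \<le> l \<Longrightarrow> integrable M (\<lambda>\<omega>. (norm (W l \<omega> - W k \<omega>))\<^sup>2)"
    "\<And>k l. k \<le> l \<Longrightarrow> expectation (\<lambda>\<omega>. (norm (W l \<omega> - W k \<omega>))\<^sup>2) \<le> A * real (l - k)"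
    by (rule increment_tail) (rule that)
  \<comment> \<open>With \<open>J\<close> and \<open>n\<close> both above \<open>T\<close>, each of
    the two terms in the Chebyshev bound is at most 1/4.\<close>
  define T where "T = 4 * A / s\<^sup>2"
  have ev1: "\<forall>\<^sub>F J in sequentially. measure N {\<omega> \<in> space N. \<exists>j<J. norm (increments X J \<omega> j) > s / 2} < e / 4"
    using brownian_grid_oscillation[OF X, of "s / 2"] s e by (intro order_tendstoD) auto
  have big: "\<forall>\<^sub>F n in sequentially. T < real n"
    using filterlim_real_sequentially by (simp add: filterlim_at_top_dense)
  show ?thesis using ev1 big eventually_gt_at_top[of 0]
  proof eventually_elim
    case (elim J)
    then have J: "J > 0" by simp
    have "\<forall>\<^sub>F n in sequentially. prob {\<omega> \<in> space M. \<exists>j<J. norm (block_increments J n \<omega> j) > s} \<le>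
      measure N {\<omega> \<in> space N. \<exists>j<J. norm (increments X J \<omega> j) > s / 2} + e / 4"
      using e by (intro block_sup_probability[OF X C J s]) auto
    then show ?case using big eventually_gt_at_top[of 0]
    proof eventually_elim
      case (elim n)
      then have n: "n > 0" by simp
      define b where "b k = grid J n (block J n k)" for k
      define c where "c k = grid J n (Suc (block J n k))" for k
      have bc: "b k \<le> k" "k \<le> c k" "block J n k < J" if "k \<le> n" for k
        using block_bounds[OF J that] by (simp_all add: b_def c_def)
      have half: "prob {\<omega> \<in> space M. norm (W (c k) \<omega> - W k \<omega>) > s * sqrt (real n)} \<le> 1 / 2" if k: "k \<le> n" for k
      proof -
        have "real (c k) \<le> real n * real (Suc (block J n k)) / real J" unfolding c_def by (rule grid_bounds(1)[OF J])
        moreover have "real n * real (block J n k) / real J < real (b k) + 1" unfolding b_def by (rule grid_bounds(2)[OF J])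
        moreover have "real n * real (Suc (block J n k)) / real J = real n * real (block J n k) / real J + real n / real J"
          by (simp add: algebra_simps add_divide_distrib)
        ultimately have "real (c k) - real (b k) \<le> real n / real J + 1" by linarith
        then have size: "real (c k - k) \<le> real n / real J + 1" using bc[OF k] by (simp add: of_nat_diff)
        have "prob {\<omega> \<in> space M. norm (W (c k) \<omega> - W k \<omega>) > s * sqrt (real n)} \<le> A * real (c k - k) / (s * sqrt (real n))\<^sup>2"
          using bc[OF k] s n by (intro A(2)) auto
        also have "\<dots> \<le> A * (real n / real J + 1) / (s * sqrt (real n))\<^sup>2"
          using size A by (intro divide_right_mono mult_left_mono) auto
        also have "\<dots> = (A / s\<^sup>2) * (1 / real J + 1 / real n)"
          using n s J by (simp add: power_mult_distrib field_simps)
        also have "\<dots> = T / 4 * (1 / real J) + T / 4 * (1 / real n)" by (simp add: T_def algebra_simps)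
        also have "\<dots> \<le> 1 / 4 + 1 / 4"
          using elim \<open>T < real J\<close> J n by (intro add_mono) (simp_all add: divide_le_eq)
        finally show ?thesis by simp
      qed
      have "prob {\<omega> \<in> space M. \<exists>k\<le>n. norm (W k \<omega> - W (b k) \<omega>) > 2 * (s * sqrt (real n))} \<le>
        2 * prob {\<omega> \<in> space M. \<exists>k\<le>n. norm (W (c k) \<omega> - W (b k) \<omega>) > s * sqrt (real n)}"
        by (rule ottaviani) (use bc half in auto)
      also have "\<dots> \<le> 2 * prob {\<omega> \<in> space M. \<exists>j<J. norm (block_increments J n \<omega> j) > s}"
      proof (intro mult_left_mono finite_measure_mono)
        have [measurable]: "(\<lambda>\<omega>. block_increments J n \<omega> j) \<in> borel_measurable M" for j
          unfolding block_increments_def by measurable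
        show "{\<omega> \<in> space M. \<exists>j<J. norm (block_increments J n \<omega> j) > s} \<in> events" by measurable
        show "{\<omega> \<in> space M. \<exists>k\<le>n. norm (W (c k) \<omega> - W (b k) \<omega>) > s * sqrt (real n)} \<subseteq>
          {\<omega> \<in> space M. \<exists>j<J. norm (block_increments J n \<omega> j) > s}"
        proof
          fix \<omega> assume "\<omega> \<in> {\<omega> \<in> space M. \<exists>k\<le>n. norm (W (c k) \<omega> - W (b k) \<omega>) > s * sqrt (real n)}"
          then obtain k where k: "\<omega> \<in> space M" "k \<le> n" "norm (W (c k) \<omega> - W (b k) \<omega>) > s * sqrt (real n)" by blast
          have "norm (block_increments J n \<omega> (block J n k)) = norm (W (c k) \<omega> - W (b k) \<omega>) / sqrt (real n)"
            by (simp add: block_increments_def b_def c_def divide_inverse mult.commute)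
          also have "\<dots> > s" using k(3) n by (simp add: less_divide_eq)
          finally show "\<omega> \<in> {\<omega> \<in> space M. \<exists>j<J. norm (block_increments J n \<omega> j) > s}"
            using k(1) bc(3)[OF k(2)] by blast
        qed
      qed simp
      also have "\<dots> \<le> 2 * (e / 4 + e / 4)" using elim \<open>_ < e / 4\<close> by (intro mult_left_mono) auto
      finally show ?case by (simp add: b_def)
    qed
  qed
qed

end

section \<open>From weak convergence to expectations\<close>

text \<open>A bounded moment of order \<open>r > 1\<close> is a uniform integrability condition. The
  index starts at 1 because the moments of the rescaled walk are bounded only from there.\<close>

lemma expectation_tendsto_of_weak_convergence:
  fixes F :: "nat \<Rightarrow> 'w \<Rightarrow> real" and G :: "'v \<Rightarrow> real"
  assumes M: "prob_space M" and N: "prob_space N" and r: "r > 1"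
    and F[measurable]: "\<And>n. F n \<in> borel_measurable M" and G[measurable]: "G \<in> borel_measurable N"
    and int: "\<And>n. n \<ge> 1 \<Longrightarrow> integrable M (\<lambda>\<omega>. \<bar>F n \<omega>\<bar> powr r)"
    and bnd: "\<And>n. n \<ge> 1 \<Longrightarrow> (\<integral>\<omega>. \<bar>F n \<omega>\<bar> powr r \<partial>M) \<le> C"
    and weak: "\<And>(\<phi>::real \<Rightarrow> real) B. (\<And>x y. \<bar>\<phi> x - \<phi> y\<bar> \<le> \<bar>x - y\<bar>) \<Longrightarrow> (\<And>x. \<bar>\<phi> x\<bar> \<le> B) \<Longrightarrow>
      (\<lambda>n. \<integral>\<omega>. \<phi> (F n \<omega>) \<partial>M) \<longlonglongrightarrow> (\<integral>\<omega>. \<phi> (G \<omega>) \<partial>N)"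
  shows "integrable N G" "\<And>n. n \<ge> 1 \<Longrightarrow> integrable M (F n)"
    "(\<lambda>n. \<integral>\<omega>. F n \<omega> \<partial>M) \<longlonglongrightarrow> (\<integral>\<omega>. G \<omega> \<partial>N)"
proof -
  interpret M: prob_space M by fact
  interpret N: prob_space N by fact
  have "0 \<le> (\<integral>\<omega>. \<bar>F 1 \<omega>\<bar> powr r \<partial>M)" by simp
  then have C0: "C \<ge> 0" using bnd[OF order_refl] by linarith
  have le1: "\<bar>x\<bar> \<le> 1 + \<bar>x\<bar> powr r" for x :: real
  proof (cases "\<bar>x\<bar> \<le> 1")
    case True
    moreover have "0 \<le> \<bar>x\<bar> powr r" by simp
    ultimately show ?thesis by linarith
  next
    case False
    then have "\<bar>x\<bar> powr 1 \<le> \<bar>x\<bar> powr r" using r by (intro powr_mono) auto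
    then show ?thesis using False by simp
  qed
  show intF: "integrable M (F n)" if n: "n \<ge> 1" for n
  proof (rule Bochner_Integration.integrable_bound)
    show "integrable M (\<lambda>\<omega>. 1 + \<bar>F n \<omega>\<bar> powr r)" using int[OF n] by simp
    show "AE \<omega> in M. norm (F n \<omega>) \<le> norm (1 + \<bar>F n \<omega>\<bar> powr r)"
      using le1 by (auto intro!: AE_I2 order_trans[OF _ abs_ge_self])
  qed simp
  \<comment> \<open>The truncated absolute value is an admissible test function, so the moment bound
    of the sequence passes to truncations of the limit.\<close>
  have trunc: "(\<integral>\<omega>. min \<bar>G \<omega>\<bar> L \<partial>N) \<le> 1 + C" if L: "L \<ge> 0" for L :: real
  proof (rule LIMSEQ_le_const2)
    show "(\<lambda>n. \<integral>\<omega>. min \<bar>F n \<omega>\<bar> L \<partial>M) \<longlonglongrightarrow> (\<integral>\<omega>. min \<bar>G \<omega>\<bar> L \<partial>N)"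
      by (rule weak[of "\<lambda>x. min \<bar>x\<bar> L" L]) (use L in \<open>auto simp: min_def abs_le_iff\<close>)
    have "(\<integral>\<omega>. min \<bar>F n \<omega>\<bar> L \<partial>M) \<le> 1 + C" if n: "n \<ge> 1" for n
    proof -
      have "(\<integral>\<omega>. min \<bar>F n \<omega>\<bar> L \<partial>M) \<le> (\<integral>\<omega>. 1 + \<bar>F n \<omega>\<bar> powr r \<partial>M)"
      proof (rule integral_mono)
        show "integrable M (\<lambda>\<omega>. min \<bar>F n \<omega>\<bar> L)"
          using L by (intro M.integrable_const_bound[of _ L]) auto
        show "integrable M (\<lambda>\<omega>. 1 + \<bar>F n \<omega>\<bar> powr r)" using int[OF n] by simp
        show "min \<bar>F n \<omega>\<bar> L \<le> 1 + \<bar>F n \<omega>\<bar> powr r" for \<omega> using le1[of "F n \<omega>"] by linarith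
      qed
      also have "\<dots> \<le> 1 + C" using int[OF n] bnd[OF n] by (simp add: M.prob_space)
      finally show ?thesis .
    qed
    then show "\<exists>N. \<forall>n\<ge>N. (\<integral>\<omega>. min \<bar>F n \<omega>\<bar> L \<partial>M) \<le> 1 + C" by blast
  qed
  show intG: "integrable N G"
  proof (rule integrableI_bounded)
    \<comment> \<open>Fatou in the truncation level removes the truncation.\<close>
    have "ennreal (norm (G \<omega>)) = liminf (\<lambda>k. ennreal (min \<bar>G \<omega>\<bar> (real k)))" for \<omega>
    proof -
      obtain k0 :: nat where k0: "\<bar>G \<omega>\<bar> \<le> real k0" using real_arch_simple by blast
      have "\<forall>\<^sub>F k in sequentially. ennreal (min \<bar>G \<omega>\<bar> (real k)) = ennreal \<bar>G \<omega>\<bar>"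
        by (rule eventually_sequentiallyI[of k0]) (use k0 in \<open>auto simp: min_def\<close>)
      then have "(\<lambda>k. ennreal (min \<bar>G \<omega>\<bar> (real k))) \<longlonglongrightarrow> ennreal \<bar>G \<omega>\<bar>" by (rule tendsto_eventually)
      then show ?thesis by (simp only: lim_imp_Liminf[OF sequentially_bot] real_norm_def)
    qed
    then have "(\<integral>\<^sup>+\<omega>. ennreal (norm (G \<omega>)) \<partial>N) = (\<integral>\<^sup>+\<omega>. liminf (\<lambda>k. ennreal (min \<bar>G \<omega>\<bar> (real k))) \<partial>N)" by simp
    also have "\<dots> \<le> liminf (\<lambda>k. \<integral>\<^sup>+\<omega>. ennreal (min \<bar>G \<omega>\<bar> (real k)) \<partial>N)" by (rule nn_integral_liminf) simp
    also have "\<dots> \<le> liminf (\<lambda>k. ennreal (1 + C))"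
    proof (intro Liminf_mono always_eventually allI)
      fix k :: nat
      have "integrable N (\<lambda>\<omega>. min \<bar>G \<omega>\<bar> (real k))"
        by (intro N.integrable_const_bound[of _ "real k"]) auto
      then have "(\<integral>\<^sup>+\<omega>. ennreal (min \<bar>G \<omega>\<bar> (real k)) \<partial>N) = ennreal (\<integral>\<omega>. min \<bar>G \<omega>\<bar> (real k) \<partial>N)"
        by (intro nn_integral_eq_integral) auto
      also have "\<dots> \<le> ennreal (1 + C)" by (intro ennreal_leI trunc) simp
      finally show "(\<integral>\<^sup>+\<omega>. ennreal (min \<bar>G \<omega>\<bar> (real k)) \<partial>N) \<le> ennreal (1 + C)" .
    qed
    also have "\<dots> = ennreal (1 + C)" by (rule Liminf_const) simp
    also have "\<dots> < \<infinity>" by simp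
    finally show "(\<integral>\<^sup>+\<omega>. ennreal (norm (G \<omega>)) \<partial>N) < \<infinity>" .
  qed simp
  define cl where "cl L x = max (- L) (min L x)" for L x :: real
  have cl_lip: "\<bar>cl L x - cl L y\<bar> \<le> \<bar>x - y\<bar>" for L x y by (auto simp: cl_def min_def max_def)
  have cl_bound: "\<bar>cl L x\<bar> \<le> L" if "L \<ge> 0" for L x using that by (auto simp: cl_def min_def max_def)
  \<comment> \<open>Beyond \<open>L\<close> the absolute value is its \<open>r\<close>-th power
    times a negative power of itself, which is largest at \<open>L\<close>. As \<open>r > 1\<close>,
    the expected clipping error vanishes uniformly in \<open>n\<close> as \<open>L\<close>
    grows.\<close>
  have cl_err: "\<bar>x - cl L x\<bar> \<le> \<bar>x\<bar> powr r * L powr (1 - r)" if L: "L > 0" for L x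
  proof (cases "\<bar>x\<bar> \<le> L")
    case True
    then have "cl L x = x" by (auto simp: cl_def)
    then show ?thesis by simp
  next
    case False
    have "\<bar>x - cl L x\<bar> \<le> \<bar>x\<bar>" using L by (auto simp: cl_def min_def max_def)
    also have "\<dots> = \<bar>x\<bar> powr r * \<bar>x\<bar> powr (1 - r)" using False L by (simp flip: powr_add)
    also have "\<dots> \<le> \<bar>x\<bar> powr r * L powr (1 - r)"
      using False L r by (intro mult_left_mono powr_mono2') auto
    finally show ?thesis .
  qed
  have clm[measurable]: "cl L \<in> borel_measurable borel" for L unfolding cl_def by measurable
  have dom: "(\<lambda>k. \<integral>\<omega>. cl (real k) (G \<omega>) \<partial>N) \<longlonglongrightarrow> (\<integral>\<omega>. G \<omega> \<partial>N)"
  proof (rule integral_dominated_convergence[where w="\<lambda>\<omega>. \<bar>G \<omega>\<bar>"])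
    show "AE \<omega> in N. (\<lambda>k. cl (real k) (G \<omega>)) \<longlonglongrightarrow> G \<omega>"
    proof (rule AE_I2)
      fix \<omega>
      obtain k0 :: nat where k0: "\<bar>G \<omega>\<bar> \<le> real k0" using real_arch_simple by blast
      have "\<forall>\<^sub>F k in sequentially. cl (real k) (G \<omega>) = G \<omega>"
        by (rule eventually_sequentiallyI[of k0]) (use k0 in \<open>auto simp: cl_def\<close>)
      then show "(\<lambda>k. cl (real k) (G \<omega>)) \<longlonglongrightarrow> G \<omega>" by (rule tendsto_eventually)
    qed
    show "AE \<omega> in N. norm (cl (real k) (G \<omega>)) \<le> \<bar>G \<omega>\<bar>" for k by (auto simp: cl_def min_def max_def)
  qed (use intG in auto)
  show "(\<lambda>n. \<integral>\<omega>. F n \<omega> \<partial>M) \<longlonglongrightarrow> (\<integral>\<omega>. G \<omega> \<partial>N)"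
  proof (rule LIMSEQ_I)
    fix \<epsilon> :: real assume eps: "\<epsilon> > 0"
    have "((\<lambda>k. C * real k powr (1 - r)) \<longlongrightarrow> C * 0) sequentially"
      using r by (intro tendsto_mult_left tendsto_neg_powr filterlim_real_sequentially) auto
    then have ev1: "\<forall>\<^sub>F k in sequentially. C * real k powr (1 - r) < \<epsilon> / 3"
      using eps by (intro order_tendstoD(2)) auto
    have ev2: "\<forall>\<^sub>F k in sequentially. \<bar>(\<integral>\<omega>. cl (real k) (G \<omega>) \<partial>N) - (\<integral>\<omega>. G \<omega> \<partial>N)\<bar> < \<epsilon> / 3"
      using tendstoD[OF dom, of "\<epsilon> / 3"] eps by (simp add: dist_real_def)
    from eventually_happens[OF eventually_conj[OF eventually_conj[OF ev1 ev2] eventually_gt_at_top[of 0]]]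
    obtain k :: nat where k: "C * real k powr (1 - r) < \<epsilon> / 3"
      "\<bar>(\<integral>\<omega>. cl (real k) (G \<omega>) \<partial>N) - (\<integral>\<omega>. G \<omega> \<partial>N)\<bar> < \<epsilon> / 3" "k > 0" by auto
    have err: "\<bar>(\<integral>\<omega>. F n \<omega> \<partial>M) - (\<integral>\<omega>. cl (real k) (F n \<omega>) \<partial>M)\<bar> < \<epsilon> / 3" if n: "n \<ge> 1" for n
    proof -
      have i: "integrable M (\<lambda>\<omega>. cl (real k) (F n \<omega>))"
        using cl_bound by (intro M.integrable_const_bound[of _ "real k"]) auto
      have "\<bar>(\<integral>\<omega>. F n \<omega> \<partial>M) - (\<integral>\<omega>. cl (real k) (F n \<omega>) \<partial>M)\<bar> = \<bar>\<integral>\<omega>. F n \<omega> - cl (real k) (F n \<omega>) \<partial>M\<bar>"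
        using i intF[OF n] by simp
      also have "\<dots> \<le> (\<integral>\<omega>. \<bar>F n \<omega> - cl (real k) (F n \<omega>)\<bar> \<partial>M)" by (rule integral_abs_bound)
      also have "\<dots> \<le> (\<integral>\<omega>. \<bar>F n \<omega>\<bar> powr r * real k powr (1 - r) \<partial>M)"
        using i intF[OF n] int[OF n] cl_err k by (intro integral_mono) auto
      also have "\<dots> \<le> C * real k powr (1 - r)" using bnd[OF n] by (simp add: mult_right_mono)
      finally show ?thesis using k by simp
    qed
    have "(\<lambda>n. \<integral>\<omega>. cl (real k) (F n \<omega>) \<partial>M) \<longlonglongrightarrow> (\<integral>\<omega>. cl (real k) (G \<omega>) \<partial>N)"
      by (rule weak[of "cl (real k)" "real k"]) (use cl_lip cl_bound in auto)
    from tendstoD[OF this, of "\<epsilon> / 3"] eps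
    have "\<forall>\<^sub>F n in sequentially. \<bar>(\<integral>\<omega>. cl (real k) (F n \<omega>) \<partial>M) - (\<integral>\<omega>. cl (real k) (G \<omega>) \<partial>N)\<bar> < \<epsilon> / 3"
      by (simp add: dist_real_def)
    then have "\<forall>\<^sub>F n in sequentially. norm ((\<integral>\<omega>. F n \<omega> \<partial>M) - (\<integral>\<omega>. G \<omega> \<partial>N)) < \<epsilon>"
      using eventually_ge_at_top[of 1]
    proof eventually_elim
      case (elim n)
      show ?case using elim(1) err[OF elim(2)] k(2) unfolding real_norm_def by linarith
    qed
    then show "\<exists>no. \<forall>n\<ge>no. norm ((\<integral>\<omega>. F n \<omega> \<partial>M) - (\<integral>\<omega>. G \<omega> \<partial>N)) < \<epsilon>"
      by (simp add: eventually_sequentially)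
  qed
qed

text \<open>Points of a ball of radius \<open>R\<close> are never farther apart than
  \<open>2 * R\<close>, so \<delta> can be capped there. The upper limit on \<delta> thus
  disappears, and only distances between generating points have to be estimated.\<close>

lemma intrinsic_volume_hull_lipschitz:
  assumes m: "1 \<le> m" "m \<le> DIM('a::euclidean_space)"
  obtains C where "C \<ge> 0" "\<forall>(S::'a set) T R \<delta>. compact S \<longrightarrow> compact T \<longrightarrow> S \<noteq> {} \<longrightarrow> T \<noteq> {} \<longrightarrow> R > 0 \<longrightarrow>
    S \<subseteq> cball 0 R \<longrightarrow> T \<subseteq> cball 0 R \<longrightarrow> 0 \<le> \<delta> \<longrightarrow>
    (\<forall>x\<in>S. \<exists>y\<in>T. dist x y \<le> \<delta>) \<longrightarrow> (\<forall>y\<in>T. \<exists>x\<in>S. dist y x \<le> \<delta>) \<longrightarrow>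
    \<bar>intrinsic_volume m (convex hull S) - intrinsic_volume m (convex hull T)\<bar> \<le> C * R ^ (m - 1) * \<delta>"
proof -
  obtain C where C: "C \<ge> 0" "\<And>(K::'a set) L R \<delta>. convex_body K \<Longrightarrow> convex_body L \<Longrightarrow> R > 0 \<Longrightarrow> K \<subseteq> cball 0 R \<Longrightarrow> L \<subseteq> cball 0 R \<Longrightarrow>
    0 \<le> \<delta> \<Longrightarrow> \<delta> \<le> 2 * R \<Longrightarrow> K \<subseteq> parallel_body L \<delta> \<Longrightarrow> L \<subseteq> parallel_body K \<delta> \<Longrightarrow>
    \<bar>intrinsic_volume m K - intrinsic_volume m L\<bar> \<le> C * R ^ (m - 1) * \<delta>"
    by (rule intrinsic_volume_lipschitz[OF m]) (rule that)
  show thesis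
  proof (rule that[OF C(1)], intro allI impI)
    fix S T :: "'a set" and R \<delta> :: real
    assume *: "compact S" "compact T" "S \<noteq> {}" "T \<noteq> {}" "R > 0" "S \<subseteq> cball 0 R" "T \<subseteq> cball 0 R" "0 \<le> \<delta>"
      "\<forall>x\<in>S. \<exists>y\<in>T. dist x y \<le> \<delta>" "\<forall>y\<in>T. \<exists>x\<in>S. dist y x \<le> \<delta>"
    then have S: "compact S" "S \<noteq> {}" "S \<subseteq> cball 0 R" and T: "compact T" "T \<noteq> {}" "T \<subseteq> cball 0 R"
      and R: "R > 0" and del: "0 \<le> \<delta>"
      by blast+
    note ST = *(9)[rule_format] and TS = *(10)[rule_format]
    define \<delta>' where "\<delta>' = min \<delta> (2 * R)"
    have near: "dist x y \<le> 2 * R" if "x \<in> cball 0 R" "y \<in> cball 0 R" for x y :: 'a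
      using that norm_triangle_ineq4[of x y] by (simp add: dist_norm)
    have "\<exists>y\<in>T. dist x y \<le> \<delta>'" if xS: "x \<in> S" for x
    proof -
      obtain y where y: "y \<in> T" "dist x y \<le> \<delta>" using ST[OF xS] by blast
      then have "dist x y \<le> 2 * R" by (intro near subsetD[OF S(3)] subsetD[OF T(3)] xS)
      then show ?thesis using y by (intro bexI[of _ y]) (auto simp: \<delta>'_def)
    qed
    then have 1: "convex hull S \<subseteq> parallel_body (convex hull T) \<delta>'"
      by (intro hull_subset_parallel_body_hull T)
    have "\<exists>x\<in>S. dist y x \<le> \<delta>'" if yT: "y \<in> T" for y
    proof -
      obtain x where x: "x \<in> S" "dist y x \<le> \<delta>" using TS[OF yT] by blast
      then have "dist y x \<le> 2 * R" by (intro near subsetD[OF S(3)] subsetD[OF T(3)] yT)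
      then show ?thesis using x by (intro bexI[of _ x]) (auto simp: \<delta>'_def)
    qed
    then have 2: "convex hull T \<subseteq> parallel_body (convex hull S) \<delta>'"
      by (intro hull_subset_parallel_body_hull S)
    have "\<bar>intrinsic_volume m (convex hull S) - intrinsic_volume m (convex hull T)\<bar> \<le> C * R ^ (m - 1) * \<delta>'"
      using S T R del by (intro C(2) convex_body_hull 1 2 hull_minimal) (auto simp: \<delta>'_def)
    also have "\<dots> \<le> C * R ^ (m - 1) * \<delta>"
      using C(1) R by (intro mult_left_mono) (auto simp: \<delta>'_def)
    finally show "\<bar>intrinsic_volume m (convex hull S) - intrinsic_volume m (convex hull T)\<bar> \<le> C * R ^ (m - 1) * \<delta>" .
  qed
qed

text \<open>Near \<open>p\<close> all points stay in one ball, where the Lipschitz bound applies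
  with the summed coordinate distances. This continuity provides both the measurability of the
  volumes and an admissible function of finitely many increments.\<close>

lemma continuous_on_intrinsic_volume_hull:
  assumes m: "1 \<le> m" "m \<le> DIM('a::euclidean_space)"
  shows "continuous_on UNIV (\<lambda>p :: nat \<Rightarrow> 'a. intrinsic_volume m (convex hull (p ` {..K})))"
proof (simp add: continuous_on_eq_continuous_within, intro allI)
  fix p :: "nat \<Rightarrow> 'a"
  obtain C where C: "C \<ge> 0" "\<forall>(S::'a set) T R \<delta>. compact S \<longrightarrow> compact T \<longrightarrow> S \<noteq> {} \<longrightarrow> T \<noteq> {} \<longrightarrow> R > 0 \<longrightarrow>
    S \<subseteq> cball 0 R \<longrightarrow> T \<subseteq> cball 0 R \<longrightarrow> 0 \<le> \<delta> \<longrightarrow>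
    (\<forall>x\<in>S. \<exists>y\<in>T. dist x y \<le> \<delta>) \<longrightarrow> (\<forall>y\<in>T. \<exists>x\<in>S. dist y x \<le> \<delta>) \<longrightarrow>
    \<bar>intrinsic_volume m (convex hull S) - intrinsic_volume m (convex hull T)\<bar> \<le> C * R ^ (m - 1) * \<delta>"
    by (rule intrinsic_volume_hull_lipschitz[OF m]) (rule that)
  define d where "d q = (\<Sum>k\<le>K. dist (q k) (p k))" for q :: "nat \<Rightarrow> 'a"
  define R where "R = 1 + (\<Sum>k\<le>K. norm (p k))"
  have R: "R > 0" unfolding R_def by (intro add_pos_nonneg sum_nonneg) auto
  have dk: "dist (q k) (p k) \<le> d q" if "k \<le> K" for q k
    unfolding d_def using that by (intro member_le_sum) auto
  have pk: "norm (p k) \<le> R - 1" if "k \<le> K" for k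
    using member_le_sum[of k "{..K}" "\<lambda>k. norm (p k)"] that by (simp add: R_def)
  have "((\<lambda>q. q k) \<longlongrightarrow> p k) (at p)" for k
  proof -
    have "continuous_on UNIV (\<lambda>q :: nat \<Rightarrow> 'a. q k)" by (rule continuous_on_product_coordinates)
    then show ?thesis by (simp add: continuous_on_def)
  qed
  then have d0: "(d \<longlongrightarrow> 0) (at p)" unfolding d_def
    by (intro tendsto_null_sum) (simp add: tendsto_dist_iff[symmetric])
  have "((\<lambda>q. intrinsic_volume m (convex hull (q ` {..K})) - intrinsic_volume m (convex hull (p ` {..K}))) \<longlongrightarrow> 0) (at p)"
  proof (rule Lim_null_comparison)
    have "\<forall>\<^sub>F q in at p. d q < 1" using d0 by (rule order_tendstoD) simp
    then show "\<forall>\<^sub>F q in at p. norm (intrinsic_volume m (convex hull (q ` {..K})) - intrinsic_volume m (convex hull (p ` {..K}))) \<le> C * R ^ (m - 1) * d q"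
    proof eventually_elim
      case (elim q)
      have qk: "norm (q k) \<le> R" if "k \<le> K" for k
        using pk[OF that] dk[OF that, of q] elim norm_triangle_sub[of "q k" "p k"] by (simp add: dist_norm)
      have "\<bar>intrinsic_volume m (convex hull (q ` {..K})) - intrinsic_volume m (convex hull (p ` {..K}))\<bar> \<le> C * R ^ (m - 1) * d q"
      proof (rule C(2)[rule_format, OF _ _ _ _ R])
        show "q ` {..K} \<subseteq> cball 0 R" "p ` {..K} \<subseteq> cball 0 R" using qk pk by fastforce+
        show "0 \<le> d q" by (simp add: d_def sum_nonneg)
        show "\<exists>y\<in>p ` {..K}. dist x y \<le> d q" if "x \<in> q ` {..K}" for x using that dk by auto
        show "\<exists>x\<in>q ` {..K}. dist y x \<le> d q" if "y \<in> p ` {..K}" for y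
        proof -
          from that obtain k where "k \<le> K" "y = p k" by auto
          then show ?thesis using dk[of k q] by (intro bexI[of _ "q k"]) (auto simp: dist_commute)
        qed
      qed (auto intro: finite_imp_compact)
      then show ?case by simp
    qed
    show "((\<lambda>q. C * R ^ (m - 1) * d q) \<longlongrightarrow> 0) (at p)" using tendsto_mult_left[OF d0, of "C * R ^ (m - 1)"] by simp
  qed
  then show "isCont (\<lambda>p. intrinsic_volume m (convex hull (p ` {..K}))) p"
    unfolding isCont_def by (simp add: Lim_null[symmetric])
qed

section \<open>Hulls of the drifted walk and of the limit process\<close>

text \<open>For choosing small quantities when a constant may be 0: divide by the constant plus
  1.\<close>

lemma plus_one_times_divide: "0 \<le> K \<Longrightarrow> (K + 1) * (x / (K + 1)) = x" for K x :: real
  by simp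

text \<open>Orthonormality says that the matrix with rows \<open>e i\<close> has its transpose as
  right inverse; for square matrices it is then also a left inverse, and that gives preservation of
  norms.\<close>

lemma norm_coordinates:
  assumes e: "orthonormal_basis e"
  shows "norm (coordinates e x) = norm x"
proof -
  define E where "E = (\<chi> i j. e i $ j)"
  have Ex: "E *v y = coordinates e y" for y
    by (simp add: E_def coordinates_def matrix_vector_mult_def inner_vec_def vec_eq_iff mult.commute)
  have "E ** transpose E = mat 1"
    using e unfolding orthonormal_basis_def
    by (simp add: E_def matrix_matrix_mult_def transpose_def mat_def vec_eq_iff inner_vec_def)
  then have "transpose E ** E = mat 1" by (simp add: matrix_left_right_inverse)
  then have "x \<bullet> (transpose E *v (E *v x)) = x \<bullet> x" by (simp add: matrix_vector_mul_assoc)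
  then have "(E *v x) \<bullet> (E *v x) = x \<bullet> x" by (simp add: dot_lmul_matrix[symmetric] inner_commute)
  then show ?thesis by (simp add: Ex norm_eq)
qed

lemma linear_coordinates: "linear (coordinates e)"
  by (rule linearI) (simp_all add: coordinates_def vec_eq_iff inner_add_left)

lemma scaling_matrix_mult: "scaling_matrix a n *v x = (\<chi> i. (if i = a then 1 / real n else 1 / sqrt (real n)) * x $ i)"
proof -
  have "(\<Sum>j\<in>UNIV. (if i = j then c else 0) * x $ j) = c * x $ i" for i and c :: real
  proof -
    have "(\<Sum>j\<in>UNIV. (if i = j then c else 0) * x $ j) = (\<Sum>j\<in>UNIV. if i = j then c * x $ j else 0)"
      by (intro sum.cong) auto
    then show ?thesis by simp
  qed
  then show ?thesis by (simp add: scaling_matrix_def matrix_vector_mult_def vec_eq_iff)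
qed

lemma norm_axis_real: "norm (axis i r :: real ^ 'n) = \<bar>r\<bar>"
  by (simp add: norm_eq_sqrt_inner inner_axis_axis)

text \<open>The steps are already centered; the drift is added back in \<open>walk_point\<close>.
  The covariance matrix is given by its quadratic form, the variance of each projection, because
  this is what the characteristic functions see.\<close>

locale drifted_walk = centered_walk M \<xi> for M :: "'w measure" and \<xi> :: "nat \<Rightarrow> 'w \<Rightarrow> real ^ 'n" +
  fixes N :: "'v measure" and X :: "real \<Rightarrow> 'v \<Rightarrow> real ^ 'n" and C :: "real ^ 'n ^ 'n"
    and a :: 'n and e :: "'n \<Rightarrow> real ^ 'n" and \<mu> :: "real ^ 'n" and m :: nat
  assumes X: "brownian_motion N C X"
    and C: "\<And>v. v \<bullet> (C *v v) = expectation (\<lambda>\<omega>. (v \<bullet> \<xi> 1 \<omega>)\<^sup>2)"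
    and basis: "orthonormal_basis e" and drift: "\<mu> = norm \<mu> *\<^sub>R e a"
    and m: "1 \<le> m" "m \<le> CARD('n)"
begin

text \<open>Common shape of the limit process and, up to a vanishing error, of the rescaled walk:
  coordinate \<open>a\<close> carries time, the others the centered position.\<close>

definition spacetime :: "real \<Rightarrow> real ^ 'n \<Rightarrow> real ^ 'n" where
  "spacetime t y = (\<chi> i. if i = a then norm \<mu> * t else y \<bullet> e i)"

definition walk_point :: "nat \<Rightarrow> nat \<Rightarrow> 'w \<Rightarrow> real ^ 'n" where
  "walk_point n k \<omega> = scaling_matrix a n *v coordinates e (W k \<omega> + real k *\<^sub>R \<mu>)"

lemma prob_space_N: "prob_space N" using X by (simp add: brownian_motion_def)

lemma X_measurable: "t \<ge> 0 \<Longrightarrow> X t \<in> borel_measurable N" using X by (auto simp: brownian_motion_def)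

lemma spacetime_dist: "norm (spacetime t y - spacetime t' y') \<le> norm \<mu> * \<bar>t - t'\<bar> + norm (y - y')"
proof -
  define z where "z = (\<chi> i. if i = a then 0 else (y - y') \<bullet> e i)"
  have "spacetime t y - spacetime t' y' = axis a (norm \<mu> * (t - t')) + z"
    by (auto simp: spacetime_def z_def vec_eq_iff axis_def inner_diff_left right_diff_distrib)
  then have "norm (spacetime t y - spacetime t' y') \<le> norm (axis a (norm \<mu> * (t - t'))) + norm z"
    by (simp add: norm_triangle_ineq)
  also have "norm (axis a (norm \<mu> * (t - t'))) = norm \<mu> * \<bar>t - t'\<bar>" by (simp add: norm_axis_real abs_mult)
  also have "norm z \<le> norm (coordinates e (y - y'))"
    by (rule norm_le_componentwise_cart) (simp add: z_def coordinates_def)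
  also have "\<dots> = norm (y - y')" by (rule norm_coordinates[OF basis])
  finally show ?thesis by simp
qed

lemma spacetime_norm: "norm (spacetime t y) \<le> norm \<mu> * \<bar>t\<bar> + norm y"
proof -
  have "spacetime 0 0 = 0" by (simp add: spacetime_def vec_eq_iff)
  then show ?thesis using spacetime_dist[of t y 0 0] by simp
qed

lemma continuous_spacetime: "continuous_on S (\<lambda>p. spacetime (fst p) (snd p))"
  unfolding spacetime_def
proof (intro continuous_on_vec_lambda)
  fix i
  show "continuous_on S (\<lambda>p. if i = a then norm \<mu> * fst p else snd p \<bullet> e i)"
    by (cases "i = a") (auto intro!: continuous_intros)
qed

lemma e_inner: "e a \<bullet> e i = (if i = a then 1 else 0)"
  using basis by (auto simp: orthonormal_basis_def)

text \<open>The fluctuation along the drift is divided by \<open>n\<close> where the other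
  coordinates get \<open>sqrt n\<close>. Splitting it off as a vector along axis \<open>a\<close>
  leaves an exact space-time point, since the drift has no component in the other
  directions.\<close>

lemma walk_point_eq:
  "walk_point n k \<omega> = spacetime (real k / real n) (W k \<omega> /\<^sub>R sqrt (real n)) + axis a ((W k \<omega> \<bullet> e a) / real n)"
proof -
  have "\<mu> \<bullet> e i = (if i = a then norm \<mu> else 0)" for i
    using e_inner[of i] by (subst drift) simp
  then show ?thesis unfolding walk_point_def scaling_matrix_mult
    by (auto simp: vec_eq_iff spacetime_def axis_def coordinates_def inner_add_left field_simps)
qed

lemma norm_e: "norm (e i) = 1"
  using basis by (simp add: orthonormal_basis_def norm_eq_1)

lemma walk_point_dist:
  assumes n: "n > 0" and k: "k \<le> n"
  shows "norm (walk_point n k \<omega> - spacetime t y) \<le>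
    maxW n \<omega> / real n + norm \<mu> * \<bar>real k / real n - t\<bar> + norm (W k \<omega> /\<^sub>R sqrt (real n) - y)"
proof -
  have "\<bar>W k \<omega> \<bullet> e a\<bar> \<le> norm (W k \<omega>)" using Cauchy_Schwarz_ineq2[of "W k \<omega>" "e a"] by (simp add: norm_e)
  also have "\<dots> \<le> maxW n \<omega>" by (rule maxW_ge[OF k])
  finally have "norm (axis a ((W k \<omega> \<bullet> e a) / real n)) \<le> maxW n \<omega> / real n"
    by (simp add: norm_axis_real divide_right_mono)
  moreover have "norm (walk_point n k \<omega> - spacetime t y) \<le>
    norm (spacetime (real k / real n) (W k \<omega> /\<^sub>R sqrt (real n)) - spacetime t y) + norm (axis a ((W k \<omega> \<bullet> e a) / real n))"
    unfolding walk_point_eq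
    using norm_triangle_ineq[of "spacetime (real k / real n) (W k \<omega> /\<^sub>R sqrt (real n)) - spacetime t y" "axis a ((W k \<omega> \<bullet> e a) / real n)"]
    by (simp add: algebra_simps)
  ultimately show ?thesis
    using spacetime_dist[of "real k / real n" "W k \<omega> /\<^sub>R sqrt (real n)" t y] by linarith
qed

lemma walk_point_norm:
  assumes n: "n > 0" and k: "k \<le> n"
  shows "norm (walk_point n k \<omega>) \<le> norm \<mu> + 2 * (maxW n \<omega> / sqrt (real n))"
proof -
  have z: "spacetime 0 0 = 0" by (simp add: spacetime_def vec_eq_iff)
  have "norm (W k \<omega> /\<^sub>R sqrt (real n)) \<le> maxW n \<omega> / sqrt (real n)"
    using maxW_ge[OF k, of \<omega>] n by (simp add: divide_inverse mult.commute mult_right_mono)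
  moreover have "maxW n \<omega> / real n \<le> maxW n \<omega> / sqrt (real n)"
    using n maxW_nonneg[of n \<omega>] by (intro divide_left_mono) (auto simp: real_le_lsqrt power2_eq_square real_sqrt_le_iff)
  moreover have "norm \<mu> * \<bar>real k / real n\<bar> \<le> norm \<mu>"
    using n k mult_left_mono[of "real k" "real n" "norm \<mu>"] by (simp add: divide_le_eq)
  ultimately show ?thesis using walk_point_dist[OF n k, of \<omega> 0 0] z by simp
qed

definition walk_volume :: "nat \<Rightarrow> 'w \<Rightarrow> real" where
  "walk_volume n \<omega> = intrinsic_volume m (convex hull ((\<lambda>k. walk_point n k \<omega>) ` {..n}))"

text \<open>A function of increments rather than of positions, to fit
  \<open>fidi_convergence\<close>, where the increments over the blocks are the converging
  variables.\<close>

definition grid_volume :: "nat \<Rightarrow> (nat \<Rightarrow> real ^ 'n) \<Rightarrow> real" where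
  "grid_volume J x = intrinsic_volume m (convex hull ((\<lambda>j. spacetime (real j / real J) (\<Sum>l<j. x l)) ` {..J}))"

lemma dim_m: "m \<le> DIM(real ^ 'n)" using m by simp

lemma continuous_grid_volume: "continuous_on UNIV (grid_volume J)"
proof -
  have "continuous_on UNIV (\<lambda>x :: nat \<Rightarrow> real ^ 'n. x l)" for l by (rule continuous_on_product_coordinates)
  then have c: "continuous_on UNIV (\<lambda>x :: nat \<Rightarrow> real ^ 'n. \<Sum>l<j. x l)" for j by (intro continuous_on_sum)
  have "continuous_on UNIV (\<lambda>x. spacetime (real j / real J) (\<Sum>l<j. x l))" for j
    unfolding spacetime_def
  proof (intro continuous_on_vec_lambda)
    fix i
    show "continuous_on UNIV (\<lambda>x. if i = a then norm \<mu> * (real j / real J) else (\<Sum>l<j. x l) \<bullet> e i)"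
      by (cases "i = a") (simp_all add: continuous_on_inner[OF c continuous_on_const])
  qed
  then have "continuous_on UNIV (\<lambda>x j. spacetime (real j / real J) (\<Sum>l<j. x l))"
    by (rule continuous_on_coordinatewise_then_product)
  from continuous_on_compose2[OF continuous_on_intrinsic_volume_hull[OF m(1) dim_m, of J] this]
  show ?thesis by (simp add: grid_volume_def[abs_def])
qed

lemma grid_volume_cong: "(\<And>j. j < J \<Longrightarrow> x j = y j) \<Longrightarrow> grid_volume J x = grid_volume J y"
proof -
  assume "\<And>j. j < J \<Longrightarrow> x j = y j"
  then have "(\<lambda>j. spacetime (real j / real J) (\<Sum>l<j. x l)) ` {..J} = (\<lambda>j. spacetime (real j / real J) (\<Sum>l<j. y l)) ` {..J}"
    by (intro image_cong arg_cong2[where f=spacetime] sum.cong) auto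
  then show ?thesis by (simp add: grid_volume_def)
qed

lemma walk_volume_measurable [measurable]: "walk_volume n \<in> borel_measurable M"
proof -
  have g: "(\<lambda>p :: nat \<Rightarrow> real ^ 'n. intrinsic_volume m (convex hull (p ` {..n}))) \<in> borel_measurable borel"
    by (rule borel_measurable_continuous_onI[OF continuous_on_intrinsic_volume_hull[OF m(1) dim_m]])
  have "linear (\<lambda>x. scaling_matrix a n *v coordinates e x)"
    using linear_compose[OF linear_coordinates matrix_vector_mul_linear] by (simp add: comp_def)
  then have [measurable]: "(\<lambda>x. scaling_matrix a n *v coordinates e x) \<in> borel_measurable borel"
    by (intro borel_measurable_continuous_onI linear_continuous_on) (simp add: linear_conv_bounded_linear)
  have "(\<lambda>\<omega> k. walk_point n k \<omega>) \<in> borel_measurable M"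
    by (rule measurable_coordinatewise_then_product) (unfold walk_point_def, measurable)
  from measurable_compose[OF this g] show ?thesis by (simp add: walk_volume_def[abs_def])
qed

definition path :: "real \<Rightarrow> 'v \<Rightarrow> real ^ 'n" where
  "path t \<omega> = spacetime t (X t \<omega>)"

definition limit_volume :: "'v \<Rightarrow> real" where
  "limit_volume \<omega> = intrinsic_volume m (convex hull ((\<lambda>t. path t \<omega>) ` {0..1}))"

definition path_grid_volume :: "nat \<Rightarrow> 'v \<Rightarrow> real" where
  "path_grid_volume J \<omega> = intrinsic_volume m (convex hull ((\<lambda>j. path (real j / real J) \<omega>) ` {..J}))"

lemma continuous_path: "\<omega> \<in> space N \<Longrightarrow> continuous_on {0..1} (\<lambda>t. path t \<omega>)"
proof -
  assume "\<omega> \<in> space N"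
  then have "continuous_on {0..} (\<lambda>t. X t \<omega>)" using X by (auto simp: brownian_motion_def)
  then have "continuous_on {0..1} (\<lambda>t. X t \<omega>)" by (rule continuous_on_subset) auto
  then have "continuous_on {0..1} (\<lambda>t. (t, X t \<omega>))" by (intro continuous_intros)
  from continuous_on_compose2[OF continuous_spacetime[of UNIV] this] show ?thesis by (simp add: path_def)
qed

text \<open>By uniform continuity the grid points are Hausdorff close to the whole path. Apart from
  the comparison with the grid, this shows that the limit volume is measurable, as a pointwise
  limit.\<close>

lemma path_grid_volume_tendsto:
  assumes w: "\<omega> \<in> space N"
  shows "(\<lambda>J. path_grid_volume J \<omega>) \<longlonglongrightarrow> limit_volume \<omega>"
proof -
  obtain D where D: "D \<ge> 0" "\<forall>(S::(real ^ 'n) set) T R \<delta>. compact S \<longrightarrow> compact T \<longrightarrow> S \<noteq> {} \<longrightarrow> T \<noteq> {} \<longrightarrow> R > 0 \<longrightarrow>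
    S \<subseteq> cball 0 R \<longrightarrow> T \<subseteq> cball 0 R \<longrightarrow> 0 \<le> \<delta> \<longrightarrow>
    (\<forall>x\<in>S. \<exists>y\<in>T. dist x y \<le> \<delta>) \<longrightarrow> (\<forall>y\<in>T. \<exists>x\<in>S. dist y x \<le> \<delta>) \<longrightarrow>
    \<bar>intrinsic_volume m (convex hull S) - intrinsic_volume m (convex hull T)\<bar> \<le> D * R ^ (m - 1) * \<delta>"
    by (rule intrinsic_volume_hull_lipschitz[OF m(1) dim_m]) (rule that)
  let ?T = "(\<lambda>t. path t \<omega>) ` {0..1}"
  have T: "compact ?T" "?T \<noteq> {}" using continuous_path[OF w] by (auto intro: compact_continuous_image)
  obtain R0 where "\<forall>x\<in>?T. norm x \<le> R0" using compact_imp_bounded[OF T(1)] unfolding bounded_iff by blast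
  then have R0: "?T \<subseteq> cball 0 (max R0 1)" by (force simp: max_def)
  define R where "R = max R0 1"
  have R: "R > 0" "?T \<subseteq> cball 0 R" using R0 by (auto simp: R_def)
  show ?thesis
  proof (rule LIMSEQ_I)
    fix \<epsilon> :: real assume eps: "\<epsilon> > 0"
    define P where "P = D * R ^ (m - 1)"
    \<comment> \<open>Keeps the Lipschitz bound at most \<epsilon> / 2, hence strictly below
      \<epsilon>.\<close>
    define \<delta> where "\<delta> = (\<epsilon> / 2) / (P + 1)"
    have P: "P \<ge> 0" using D R by (simp add: P_def)
    then have "\<delta> > 0" using eps by (simp add: \<delta>_def)
    moreover have "P * \<delta> \<le> (P + 1) * \<delta>" using \<open>\<delta> > 0\<close> by (simp add: distrib_right)
    moreover have "(P + 1) * \<delta> = \<epsilon> / 2"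
      unfolding \<delta>_def by (rule plus_one_times_divide[OF P])
    ultimately have del: "\<delta> > 0" "D * R ^ (m - 1) * \<delta> < \<epsilon>" using eps unfolding P_def by linarith+
    have "uniformly_continuous_on {0..1} (\<lambda>t. path t \<omega>)"
      by (rule compact_uniformly_continuous[OF continuous_path[OF w]]) simp
    then obtain d where d: "d > 0" "\<And>t u. t \<in> {0..1} \<Longrightarrow> u \<in> {0..1} \<Longrightarrow> dist u t < d \<Longrightarrow> dist (path u \<omega>) (path t \<omega>) < \<delta>"
      unfolding uniformly_continuous_on_def using del(1) by metis
    obtain J0 :: nat where J0: "1 / d < real J0" using reals_Archimedean2 by blast
    have "norm (path_grid_volume J \<omega> - limit_volume \<omega>) < \<epsilon>" if J: "J \<ge> max 1 J0" for J
    proof -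
      have Jp: "J > 0" and "1 / d < real J" using J0 J by auto
      then have dJ: "1 / real J < d" using d(1) by (simp add: divide_less_eq mult.commute)
      let ?S = "(\<lambda>j. path (real j / real J) \<omega>) ` {..J}"
      have sub: "?S \<subseteq> ?T" using Jp by (auto simp: divide_le_eq intro!: imageI)
      have near: "\<exists>y\<in>?S. dist x y \<le> \<delta>" if x: "x \<in> ?T" for x
      proof -
        from x obtain t where t: "0 \<le> t" "t \<le> 1" "x = path t \<omega>" by auto
        define j where "j = nat \<lfloor>t * real J\<rfloor>"
        have j: "real j \<le> t * real J" "t * real J < real j + 1" using t by (simp_all add: j_def)
        have "t * real J \<le> 1 * real J" using t by (intro mult_right_mono) auto
        then have "real j \<le> real J" using j by linarith
        then have jJ: "j \<le> J" by simp
        have "real j / real J - t = (real j - t * real J) / real J"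
          using Jp by (simp add: diff_divide_distrib)
        then have "\<bar>real j / real J - t\<bar> = \<bar>real j - t * real J\<bar> / real J"
          by (simp only: abs_divide abs_of_nat)
        also have "\<dots> \<le> 1 / real J" using j by (intro divide_right_mono) (auto simp: abs_le_iff)
        finally have "\<bar>real j / real J - t\<bar> \<le> 1 / real J" .
        then have "dist t (real j / real J) < d" using dJ by (simp add: dist_real_def abs_minus_commute)
        then have "dist (path t \<omega>) (path (real j / real J) \<omega>) < \<delta>"
          using t jJ Jp by (intro d(2)) (auto simp: divide_le_eq)
        then show ?thesis using t jJ by (intro bexI[of _ "path (real j / real J) \<omega>"]) auto
      qed
      have "\<bar>path_grid_volume J \<omega> - limit_volume \<omega>\<bar> \<le> D * R ^ (m - 1) * \<delta>"
        unfolding path_grid_volume_def limit_volume_def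
      proof (rule D(2)[rule_format, OF _ T(1) _ T(2) R(1) _ R(2)])
        show "?S \<subseteq> cball 0 R" using sub R(2) by (rule subset_trans)
        show "\<exists>y\<in>?T. dist x y \<le> \<delta>" if "x \<in> ?S" for x using that sub del by (intro bexI[of _ x]) auto
        show "\<exists>y\<in>?S. dist x y \<le> \<delta>" if "x \<in> ?T" for x by (rule near[OF that])
      qed (use del in \<open>auto intro: finite_imp_compact\<close>)
      then show ?thesis using del by simp
    qed
    then show "\<exists>no. \<forall>J\<ge>no. norm (path_grid_volume J \<omega> - limit_volume \<omega>) < \<epsilon>" by blast
  qed
qed

lemma path_grid_volume_measurable [measurable]: "path_grid_volume J \<in> borel_measurable N"
proof -
  have g: "(\<lambda>p :: nat \<Rightarrow> real ^ 'n. intrinsic_volume m (convex hull (p ` {..J}))) \<in> borel_measurable borel"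
    by (rule borel_measurable_continuous_onI[OF continuous_on_intrinsic_volume_hull[OF m(1) dim_m]])
  have "(\<lambda>\<omega> j. path (real j / real J) \<omega>) \<in> borel_measurable N"
  proof (rule measurable_coordinatewise_then_product)
    fix j
    have [measurable]: "X (real j / real J) \<in> borel_measurable N" by (rule X_measurable) simp
    have c: "continuous_on UNIV (spacetime (real j / real J))"
    proof -
      have "continuous_on UNIV (\<lambda>y. (real j / real J, y))" by (intro continuous_intros)
      from continuous_on_compose2[OF continuous_spacetime[of UNIV] this] show ?thesis by simp
    qed
    show "(\<lambda>\<omega>. path (real j / real J) \<omega>) \<in> borel_measurable N"
      unfolding path_def by (rule measurable_compose[OF _ borel_measurable_continuous_onI[OF c]]) measurable
  qed
  from measurable_compose[OF this g] show ?thesis by (simp add: path_grid_volume_def[abs_def])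
qed

lemma limit_volume_measurable [measurable]: "limit_volume \<in> borel_measurable N"
  by (rule borel_measurable_LIMSEQ_real[OF path_grid_volume_tendsto]) measurable

text \<open>Partial sums of increments recover the path relative to its starting point, which is 0
  only almost surely.\<close>

lemma grid_volume_increments: "AE \<omega> in N. grid_volume J (increments X J \<omega>) = path_grid_volume J \<omega>"
proof -
  have "AE \<omega> in N. X 0 \<omega> = 0" using X by (simp add: brownian_motion_def)
  then show ?thesis
  proof eventually_elim
    case (elim \<omega>)
    have "(\<Sum>l<j. increments X J \<omega> l) = X (real j / real J) \<omega>" for j
      using sum_lessThan_telescope[of "\<lambda>l. X (real l / real J) \<omega>" j] elim by (simp add: increments_def)
    then show ?case by (simp add: grid_volume_def path_grid_volume_def path_def)
  qed
qed

lemma grid_volume_blocks: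
  "grid_volume J (block_increments J n \<omega>) =
    intrinsic_volume m (convex hull ((\<lambda>j. spacetime (real j / real J) (W (grid J n j) \<omega> /\<^sub>R sqrt (real n))) ` {..J}))"
proof -
  have "(\<Sum>l<j. block_increments J n \<omega> l) = W (grid J n j) \<omega> /\<^sub>R sqrt (real n)" for j
    using sum_lessThan_telescope[of "\<lambda>l. W (grid J n l) \<omega>" j]
    by (simp add: block_increments_def W_def flip: scaleR_sum_right)
  then show ?thesis by (simp add: grid_volume_def)
qed

end

lemma grid_fraction:
  assumes J: "J > 0" and n: "n > 0"
  shows "\<bar>real (grid J n j) / real n - real j / real J\<bar> \<le> 1 / real n"
proof -
  have "\<bar>real (grid J n j) - real n * real j / real J\<bar> \<le> 1"
    using grid_bounds[OF J, of n j] by (simp add: abs_le_iff)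
  then have "\<bar>real (grid J n j) - real n * real j / real J\<bar> / real n \<le> 1 / real n"
    by (rule divide_right_mono) simp
  moreover have "\<bar>real (grid J n j) / real n - real j / real J\<bar> = \<bar>real (grid J n j) - real n * real j / real J\<bar> / real n"
  proof -
    have "real (grid J n j) / real n - real j / real J = (real (grid J n j) - real n * real j / real J) / real n"
      using n by (simp add: diff_divide_distrib)
    then show ?thesis by (simp only: abs_divide abs_of_nat)
  qed
  ultimately show ?thesis by simp
qed

lemma block_fraction:
  assumes J: "J > 0" and n: "n > 0" and k: "k \<le> n"
  shows "\<bar>real k / real n - real (block J n k) / real J\<bar> \<le> 1 / real J + 1 / real n"
proof -
  let ?j = "block J n k"
  have b: "grid J n ?j \<le> k" "k \<le> grid J n (Suc ?j)" using block_bounds[OF J k] by auto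
  have "real (grid J n ?j) / real n \<le> real k / real n" "real k / real n \<le> real (grid J n (Suc ?j)) / real n"
    using b by (auto intro!: divide_right_mono)
  moreover have "real (Suc ?j) / real J = real ?j / real J + 1 / real J" by (simp add: add_divide_distrib)
  moreover have "0 \<le> 1 / real J" by simp
  ultimately show ?thesis
    using grid_fraction[OF J n, of ?j] grid_fraction[OF J n, of "Suc ?j"] unfolding abs_le_iff by linarith
qed

section \<open>Comparison of the hulls and convergence of the volumes\<close>

context drifted_walk
begin

text \<open>A deterministic estimate for a single outcome with bounded maximum and small
  oscillation. Every walk point is near the point at the start of its block, and every grid point is
  near a walk point, so the generating sets are Hausdorff close.\<close>

lemma volume_comparison:
  obtains D where "D \<ge> 0" "\<And>n J L s \<omega>. n > 0 \<Longrightarrow> J > 0 \<Longrightarrow> L \<ge> 0 \<Longrightarrow> s \<ge> 0 \<Longrightarrow> maxW n \<omega> \<le> L * sqrt (real n) \<Longrightarrow>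
    (\<forall>k\<le>n. norm (W k \<omega> - W (grid J n (block J n k)) \<omega>) \<le> 2 * (s * sqrt (real n))) \<Longrightarrow>
    \<bar>walk_volume n \<omega> - grid_volume J (block_increments J n \<omega>)\<bar> \<le>
      D * (1 + norm \<mu> + 2 * L) ^ (m - 1) * (L / sqrt (real n) + norm \<mu> * (1 / real J + 1 / real n) + 2 * s)"
proof -
  obtain D where D: "D \<ge> 0" "\<forall>(S::(real ^ 'n) set) T R \<delta>. compact S \<longrightarrow> compact T \<longrightarrow> S \<noteq> {} \<longrightarrow> T \<noteq> {} \<longrightarrow> R > 0 \<longrightarrow>
    S \<subseteq> cball 0 R \<longrightarrow> T \<subseteq> cball 0 R \<longrightarrow> 0 \<le> \<delta> \<longrightarrow>
    (\<forall>x\<in>S. \<exists>y\<in>T. dist x y \<le> \<delta>) \<longrightarrow> (\<forall>y\<in>T. \<exists>x\<in>S. dist y x \<le> \<delta>) \<longrightarrow>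
    \<bar>intrinsic_volume m (convex hull S) - intrinsic_volume m (convex hull T)\<bar> \<le> D * R ^ (m - 1) * \<delta>"
    by (rule intrinsic_volume_hull_lipschitz[OF m(1) dim_m]) (rule that)
  show thesis
  proof (rule that[OF D(1)])
    fix n J :: nat and L s :: real and \<omega>
    assume n: "n > 0" and J: "J > 0" and L: "L \<ge> 0" and s: "s \<ge> 0" and max: "maxW n \<omega> \<le> L * sqrt (real n)"
      and osc: "\<forall>k\<le>n. norm (W k \<omega> - W (grid J n (block J n k)) \<omega>) \<le> 2 * (s * sqrt (real n))"
    define z where "z j = spacetime (real j / real J) (W (grid J n j) \<omega> /\<^sub>R sqrt (real n))" for j
    \<comment> \<open>Three errors: the fluctuation along the drift, the rounding of time to the
      grid, and the oscillation within a block.\<close>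
    define \<delta> where "\<delta> = L / sqrt (real n) + norm \<mu> * (1 / real J + 1 / real n) + 2 * s"
    define R where "R = 1 + norm \<mu> + 2 * L"
    have R: "R > 0" using L by (simp add: R_def add_pos_nonneg)
    have sn: "sqrt (real n) > 0" "sqrt (real n) * sqrt (real n) = real n" using n by auto
    have mx: "maxW n \<omega> / sqrt (real n) \<le> L" using max sn by (simp add: divide_le_eq)
    have mn: "maxW n \<omega> / real n \<le> L / sqrt (real n)"
    proof -
      have "maxW n \<omega> / real n = (maxW n \<omega> / sqrt (real n)) / sqrt (real n)" using sn by simp
      also have "\<dots> \<le> L / sqrt (real n)" by (intro divide_right_mono mx) simp
      finally show ?thesis .
    qed
    have scale: "norm (x /\<^sub>R sqrt (real n) - y /\<^sub>R sqrt (real n)) = norm (x - y) / sqrt (real n)" for x y :: "real ^ 'n"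
      by (simp add: divide_inverse mult.commute flip: scaleR_diff_right)
    have wp: "norm (walk_point n k \<omega>) \<le> R" if "k \<le> n" for k
      using walk_point_norm[OF n that, of \<omega>] mx by (simp add: R_def)
    have zn: "norm (z j) \<le> R" if "j \<le> J" for j
    proof -
      have "norm (W (grid J n j) \<omega>) / sqrt (real n) \<le> maxW n \<omega> / sqrt (real n)"
        by (intro divide_right_mono maxW_ge grid_le that) simp
      then have "norm (W (grid J n j) \<omega> /\<^sub>R sqrt (real n)) \<le> L" using mx by (simp add: divide_inverse mult.commute)
      moreover have "norm \<mu> * \<bar>real j / real J\<bar> \<le> norm \<mu> * 1"
        using that J by (intro mult_left_mono) (auto simp: divide_le_eq)
      ultimately show ?thesis
        using spacetime_norm[of "real j / real J" "W (grid J n j) \<omega> /\<^sub>R sqrt (real n)"] L by (simp add: z_def R_def)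
    qed
    have d1: "dist (walk_point n k \<omega>) (z (block J n k)) \<le> \<delta>" if k: "k \<le> n" for k
    proof -
      have "norm (W k \<omega> - W (grid J n (block J n k)) \<omega>) / sqrt (real n) \<le> 2 * s"
        using osc k sn(1) by (simp add: divide_le_eq mult.assoc)
      moreover have "norm \<mu> * \<bar>real k / real n - real (block J n k) / real J\<bar> \<le> norm \<mu> * (1 / real J + 1 / real n)"
        by (intro mult_left_mono block_fraction J n k) simp
      ultimately show ?thesis
        using walk_point_dist[OF n k, of \<omega> "real (block J n k) / real J" "W (grid J n (block J n k)) \<omega> /\<^sub>R sqrt (real n)"] mn
        unfolding scale by (simp add: dist_norm z_def \<delta>_def)
    qed
    have d2: "dist (z j) (walk_point n (grid J n j) \<omega>) \<le> \<delta>" if j: "j \<le> J" for j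
    proof -
      have "\<bar>real (grid J n j) / real n - real j / real J\<bar> \<le> 1 / real J + 1 / real n"
        using grid_fraction[OF J n, of j] by (rule order_trans) simp
      then have "norm \<mu> * \<bar>real (grid J n j) / real n - real j / real J\<bar> \<le> norm \<mu> * (1 / real J + 1 / real n)"
        by (intro mult_left_mono) auto
      then show ?thesis
        using walk_point_dist[OF n grid_le[OF j], of \<omega> "real j / real J" "W (grid J n j) \<omega> /\<^sub>R sqrt (real n)"] mn s
        by (simp add: dist_norm norm_minus_commute z_def \<delta>_def)
    qed
    have "\<bar>intrinsic_volume m (convex hull ((\<lambda>k. walk_point n k \<omega>) ` {..n})) - intrinsic_volume m (convex hull (z ` {..J}))\<bar> \<le> D * R ^ (m - 1) * \<delta>"
    proof (rule D(2)[rule_format, OF _ _ _ _ R])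
      show "(\<lambda>k. walk_point n k \<omega>) ` {..n} \<subseteq> cball 0 R" "z ` {..J} \<subseteq> cball 0 R" using wp zn by auto
      show "0 \<le> \<delta>" using L s by (simp add: \<delta>_def)
      show "\<exists>y\<in>z ` {..J}. dist x y \<le> \<delta>" if "x \<in> (\<lambda>k. walk_point n k \<omega>) ` {..n}" for x
      proof -
        from that obtain k where k: "k \<le> n" "x = walk_point n k \<omega>" by auto
        then show ?thesis using d1[OF k(1)] block_bounds(1)[OF J k(1)]
          by (intro bexI[of _ "z (block J n k)"]) auto
      qed
      show "\<exists>x\<in>(\<lambda>k. walk_point n k \<omega>) ` {..n}. dist y x \<le> \<delta>" if "y \<in> z ` {..J}" for y
      proof -
        from that obtain j where j: "j \<le> J" "y = z j" by auto
        then show ?thesis using d2[OF j(1)] grid_le[OF j(1), of n]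
          by (intro bexI[of _ "walk_point n (grid J n j) \<omega>"]) auto
      qed
    qed (auto intro: finite_imp_compact)
    then show "\<bar>walk_volume n \<omega> - grid_volume J (block_increments J n \<omega>)\<bar> \<le>
      D * (1 + norm \<mu> + 2 * L) ^ (m - 1) * (L / sqrt (real n) + norm \<mu> * (1 / real J + 1 / real n) + 2 * s)"
      unfolding walk_volume_def grid_volume_blocks by (simp add: z_def[abs_def] R_def \<delta>_def)
  qed
qed

lemma maxW_tight:
  assumes "\<eta> > 0"
  obtains L where "L > 0" "\<And>n. n \<ge> 1 \<Longrightarrow> prob {\<omega> \<in> space M. maxW n \<omega> > L * sqrt (real n)} \<le> \<eta>"
proof -
  have p2: "(x::real) powr 2 = x\<^sup>2" if "x \<ge> 0" for x using that by simp
  have "integrable M (\<lambda>\<omega>. norm (\<xi> 1 \<omega>) powr 2)" using square_integrable by (simp add: p2)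
  from maxW_moment_bound[OF order_refl this] obtain B where B: "B \<ge> 0"
    "\<And>n. integrable M (\<lambda>\<omega>. maxW n \<omega> powr 2)" "\<And>n. expectation (\<lambda>\<omega>. maxW n \<omega> powr 2) \<le> B * real n powr (2 / 2)"
    by blast
  have B2: "integrable M (\<lambda>\<omega>. (maxW n \<omega>)\<^sup>2)" "expectation (\<lambda>\<omega>. (maxW n \<omega>)\<^sup>2) \<le> B * real n" for n
    using B(2,3)[of n] by (simp_all add: p2 maxW_nonneg)
  define L where "L = sqrt (B / \<eta>) + 1"
  have L: "L > 0" using B assms by (simp add: L_def add_nonneg_pos)
  have "B / \<eta> = (sqrt (B / \<eta>))\<^sup>2" using B assms by simp
  also have "\<dots> \<le> L\<^sup>2" unfolding L_def using B assms by (intro power_mono) auto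
  finally have LB: "B / \<eta> \<le> L\<^sup>2" .
  have "prob {\<omega> \<in> space M. maxW n \<omega> > L * sqrt (real n)} \<le> \<eta>" if n: "n \<ge> 1" for n
  proof -
    have "prob {\<omega> \<in> space M. maxW n \<omega> > L * sqrt (real n)} \<le> prob {\<omega> \<in> space M. (maxW n \<omega>)\<^sup>2 \<ge> (L * sqrt (real n))\<^sup>2}"
      using L n by (intro finite_measure_mono) (auto intro!: power_mono)
    also have "\<dots> \<le> expectation (\<lambda>\<omega>. (maxW n \<omega>)\<^sup>2) / (L * sqrt (real n))\<^sup>2"
      using L n by (intro integral_Markov_inequality_measure[where A="{}"] B2) auto
    also have "\<dots> \<le> B * real n / (L * sqrt (real n))\<^sup>2" by (intro divide_right_mono B2) simp
    also have "\<dots> = B / L\<^sup>2" using n by (simp add: power_mult_distrib)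
    also have "\<dots> \<le> \<eta>" using LB L assms by (simp add: divide_le_eq mult.commute)
    finally show ?thesis .
  qed
  then show thesis using that L by blast
qed

text \<open>Three comparisons of size \<epsilon> / 3: walk against its grid, walk grid against
  Brownian grid, Brownian grid against the path. The first and the last fix \<open>J\<close>; the
  first two then hold for large \<open>n\<close>.\<close>

lemma walk_volume_weak_convergence:
  fixes \<phi> :: "real \<Rightarrow> real"
  assumes lip: "\<And>x y. \<bar>\<phi> x - \<phi> y\<bar> \<le> \<bar>x - y\<bar>" and B: "\<And>x. \<bar>\<phi> x\<bar> \<le> B"
  shows "(\<lambda>n. expectation (\<lambda>\<omega>. \<phi> (walk_volume n \<omega>))) \<longlonglongrightarrow> (\<integral>\<omega>. \<phi> (limit_volume \<omega>) \<partial>N)"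
proof (rule LIMSEQ_I)
  fix \<epsilon> :: real assume eps: "\<epsilon> > 0"
  interpret N: prob_space N by (rule prob_space_N)
  have B0: "B \<ge> 0" using B[of 0] by linarith
  have phic: "continuous_on UNIV \<phi>"
    by (rule lipschitz_on_continuous_on[of 1], rule lipschitz_onI) (use lip in \<open>auto simp: dist_real_def\<close>)
  have [measurable]: "\<phi> \<in> borel_measurable borel" by (rule borel_measurable_continuous_onI[OF phic])
  have gvm[measurable]: "(\<lambda>\<omega>. grid_volume J (block_increments J n \<omega>)) \<in> borel_measurable M" for J n
  proof -
    have "(\<lambda>\<omega>. block_increments J n \<omega>) \<in> borel_measurable M"
      by (rule measurable_coordinatewise_then_product) (unfold block_increments_def, measurable)
    from measurable_compose[OF this borel_measurable_continuous_onI[OF continuous_grid_volume]] show ?thesis .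
  qed
  \<comment> \<open>The exceptional events for the maximum and for the oscillation have total
    probability at most \<open>2 * \<eta>\<close>. Test function values differ by at most
    \<open>2 * B\<close>, so they contribute at most \<epsilon> / 6.\<close>
  define \<eta> where "\<eta> = (\<epsilon> / 24) / (B + 1)"
  have eta: "\<eta> > 0" using eps B0 by (simp add: \<eta>_def)
  have eta2: "2 * B * (2 * \<eta>) \<le> \<epsilon> / 6"
  proof -
    have "2 * B * (2 * \<eta>) \<le> 4 * ((B + 1) * \<eta>)" using eta by (simp add: algebra_simps)
    moreover have "(B + 1) * \<eta> = \<epsilon> / 24"
      unfolding \<eta>_def by (rule plus_one_times_divide[OF B0])
    ultimately show ?thesis by linarith
  qed
  obtain L where L: "L > 0" "\<And>n. n \<ge> 1 \<Longrightarrow> prob {\<omega> \<in> space M. maxW n \<omega> > L * sqrt (real n)} \<le> \<eta>"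
    by (rule maxW_tight[OF eta]) (rule that)
  obtain D where D: "D \<ge> 0" "\<And>n J L s \<omega>. n > 0 \<Longrightarrow> J > 0 \<Longrightarrow> L \<ge> 0 \<Longrightarrow> s \<ge> 0 \<Longrightarrow> maxW n \<omega> \<le> L * sqrt (real n) \<Longrightarrow>
    (\<forall>k\<le>n. norm (W k \<omega> - W (grid J n (block J n k)) \<omega>) \<le> 2 * (s * sqrt (real n))) \<Longrightarrow>
    \<bar>walk_volume n \<omega> - grid_volume J (block_increments J n \<omega>)\<bar> \<le>
      D * (1 + norm \<mu> + 2 * L) ^ (m - 1) * (L / sqrt (real n) + norm \<mu> * (1 / real J + 1 / real n) + 2 * s)"
    by (rule volume_comparison) (rule that)
  define K where "K = D * (1 + norm \<mu> + 2 * L) ^ (m - 1)"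
  have K: "K \<ge> 0" using D L by (simp add: K_def)
  \<comment> \<open>Chosen after \<open>L\<close>, because the Lipschitz constant \<open>K\<close>
    grows with the radius and hence with \<open>L\<close>.\<close>
  define s where "s = (\<epsilon> / 48) / (K + 1)"
  have s: "s > 0" using eps K by (simp add: s_def)
  have Ks: "K * (2 * s) \<le> \<epsilon> / 24"
  proof -
    have "K * (2 * s) \<le> 2 * ((K + 1) * s)" using s by (simp add: algebra_simps)
    moreover have "(K + 1) * s = \<epsilon> / 48"
      unfolding s_def by (rule plus_one_times_divide[OF K])
    ultimately show ?thesis by linarith
  qed
  have evJ1: "\<forall>\<^sub>F J in sequentially. K * (norm \<mu> * (1 / real J)) < \<epsilon> / 24"
  proof (rule order_tendstoD(2))
    show "(\<lambda>J. K * (norm \<mu> * (1 / real J))) \<longlonglongrightarrow> 0" by real_asymp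
  qed (use eps in simp)
  have evn1: "\<forall>\<^sub>F n in sequentially. K * (L / sqrt (real n) + norm \<mu> * (1 / real n)) < \<epsilon> / 24"
  proof (rule order_tendstoD(2))
    show "(\<lambda>n. K * (L / sqrt (real n) + norm \<mu> * (1 / real n))) \<longlonglongrightarrow> 0" by real_asymp
  qed (use eps in simp)
  have "(\<lambda>J. \<integral>\<omega>. \<phi> (path_grid_volume J \<omega>) \<partial>N) \<longlonglongrightarrow> (\<integral>\<omega>. \<phi> (limit_volume \<omega>) \<partial>N)"
  proof (rule integral_dominated_convergence[where w="\<lambda>_. B"])
    show "AE \<omega> in N. (\<lambda>J. \<phi> (path_grid_volume J \<omega>)) \<longlonglongrightarrow> \<phi> (limit_volume \<omega>)"
      using phic by (intro AE_I2 continuous_on_tendsto_compose[OF phic path_grid_volume_tendsto]) auto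
  qed (use B in auto)
  from tendstoD[OF this, of "\<epsilon> / 3"] eps
  have evJ2: "\<forall>\<^sub>F J in sequentially. \<bar>(\<integral>\<omega>. \<phi> (path_grid_volume J \<omega>) \<partial>N) - (\<integral>\<omega>. \<phi> (limit_volume \<omega>) \<partial>N)\<bar> < \<epsilon> / 3"
    by (simp add: dist_real_def)
  from eventually_happens[OF eventually_conj[OF eventually_conj[OF evJ1 evJ2] eventually_conj[OF oscillation[OF X C s eta] eventually_gt_at_top[of 0]]]]
  obtain J where J: "K * (norm \<mu> * (1 / real J)) < \<epsilon> / 24"
    "\<bar>(\<integral>\<omega>. \<phi> (path_grid_volume J \<omega>) \<partial>N) - (\<integral>\<omega>. \<phi> (limit_volume \<omega>) \<partial>N)\<bar> < \<epsilon> / 3"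
    "\<forall>\<^sub>F n in sequentially. prob {\<omega> \<in> space M. \<exists>k\<le>n. norm (W k \<omega> - W (grid J n (block J n k)) \<omega>) > 2 * (s * sqrt (real n))} \<le> \<eta>"
    "J > 0" by auto
  have "(\<lambda>n. expectation (\<lambda>\<omega>. \<phi> (grid_volume J (block_increments J n \<omega>)))) \<longlonglongrightarrow> (\<integral>\<omega>. \<phi> (grid_volume J (increments X J \<omega>)) \<partial>N)"
  proof (rule fidi_convergence[OF X C J(4)])
    show "continuous_on UNIV (\<lambda>x. \<phi> (grid_volume J x))"
      by (rule continuous_on_compose2[OF phic continuous_grid_volume]) simp
    show "\<phi> (grid_volume J x) = \<phi> (grid_volume J y)" if "\<And>j. j < J \<Longrightarrow> x j = y j" for x y
      using grid_volume_cong[OF that] by simp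
  qed (rule B)
  also have "(\<integral>\<omega>. \<phi> (grid_volume J (increments X J \<omega>)) \<partial>N) = (\<integral>\<omega>. \<phi> (path_grid_volume J \<omega>) \<partial>N)"
  proof (rule integral_cong_AE)
    have "(\<lambda>\<omega>. increments X J \<omega>) \<in> borel_measurable N"
    proof (rule measurable_coordinatewise_then_product)
      fix j
      have [measurable]: "X (real (Suc j) / real J) \<in> borel_measurable N" "X (real j / real J) \<in> borel_measurable N"
        by (rule X_measurable; simp)+
      show "(\<lambda>\<omega>. increments X J \<omega> j) \<in> borel_measurable N" unfolding increments_def by measurable
    qed
    from measurable_compose[OF this borel_measurable_continuous_onI[OF continuous_grid_volume]]
    have [measurable]: "(\<lambda>\<omega>. grid_volume J (increments X J \<omega>)) \<in> borel_measurable N" .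
    show "(\<lambda>\<omega>. \<phi> (grid_volume J (increments X J \<omega>))) \<in> borel_measurable N" by measurable
    show "(\<lambda>\<omega>. \<phi> (path_grid_volume J \<omega>)) \<in> borel_measurable N" by measurable
    show "AE \<omega> in N. \<phi> (grid_volume J (increments X J \<omega>)) = \<phi> (path_grid_volume J \<omega>)"
      using grid_volume_increments[of J] by eventually_elim simp
  qed
  finally have fidi: "(\<lambda>n. expectation (\<lambda>\<omega>. \<phi> (grid_volume J (block_increments J n \<omega>)))) \<longlonglongrightarrow> (\<integral>\<omega>. \<phi> (path_grid_volume J \<omega>) \<partial>N)" .
  from tendstoD[OF fidi, of "\<epsilon> / 3"] eps
  have evn2: "\<forall>\<^sub>F n in sequentially. \<bar>expectation (\<lambda>\<omega>. \<phi> (grid_volume J (block_increments J n \<omega>))) - (\<integral>\<omega>. \<phi> (path_grid_volume J \<omega>) \<partial>N)\<bar> < \<epsilon> / 3"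
    by (simp add: dist_real_def)
  have "\<forall>\<^sub>F n in sequentially. norm (expectation (\<lambda>\<omega>. \<phi> (walk_volume n \<omega>)) - (\<integral>\<omega>. \<phi> (limit_volume \<omega>) \<partial>N)) < \<epsilon>"
    using evn1 evn2 J(3) eventually_ge_at_top[of 1]
  proof eventually_elim
    case (elim n)
    then have n: "n \<ge> 1" "n > 0" by auto
    define A1 where "A1 = {\<omega> \<in> space M. maxW n \<omega> > L * sqrt (real n)}"
    define A2 where "A2 = {\<omega> \<in> space M. \<exists>k\<le>n. norm (W k \<omega> - W (grid J n (block J n k)) \<omega>) > 2 * (s * sqrt (real n))}"
    have A1m: "A1 \<in> events" unfolding A1_def by measurable
    have A2m: "A2 \<in> events" unfolding A2_def by measurable
    have P: "prob (A1 \<union> A2) \<le> 2 * \<eta>"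
    proof -
      have "prob (A1 \<union> A2) \<le> prob A1 + prob A2" by (rule measure_Un_le[OF A1m A2m])
      also have "\<dots> \<le> \<eta> + \<eta>" using L(2)[OF n(1)] elim(3) by (intro add_mono) (simp_all add: A1_def A2_def)
      finally show ?thesis by simp
    qed
    have close: "\<bar>\<phi> (walk_volume n \<omega>) - \<phi> (grid_volume J (block_increments J n \<omega>))\<bar> \<le> \<epsilon> / 6"
      if "\<omega> \<in> space M" "\<omega> \<notin> A1 \<union> A2" for \<omega>
    proof -
      have "maxW n \<omega> \<le> L * sqrt (real n)" using that by (simp add: A1_def not_less)
      moreover have "\<forall>k\<le>n. norm (W k \<omega> - W (grid J n (block J n k)) \<omega>) \<le> 2 * (s * sqrt (real n))"
        using that by (auto simp: A2_def not_less)
      ultimately have "\<bar>walk_volume n \<omega> - grid_volume J (block_increments J n \<omega>)\<bar> \<le>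
        K * (L / sqrt (real n) + norm \<mu> * (1 / real J + 1 / real n) + 2 * s)"
        unfolding K_def using L s by (intro D(2) n J(4)) auto
      also have "\<dots> = K * (L / sqrt (real n) + norm \<mu> * (1 / real n)) + K * (norm \<mu> * (1 / real J)) + K * (2 * s)"
        by (simp add: distrib_left)
      also have "\<dots> \<le> \<epsilon> / 24 + \<epsilon> / 24 + \<epsilon> / 24" using elim(1) J(1) Ks by linarith
      also have "\<dots> \<le> \<epsilon> / 6" using eps by simp
      finally show ?thesis using lip[of "walk_volume n \<omega>" "grid_volume J (block_increments J n \<omega>)"] by linarith
    qed
    have "\<bar>expectation (\<lambda>\<omega>. \<phi> (walk_volume n \<omega>)) - expectation (\<lambda>\<omega>. \<phi> (grid_volume J (block_increments J n \<omega>)))\<bar> \<le>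
      \<epsilon> / 6 + 2 * B * prob (A1 \<union> A2)"
    proof (rule expectation_difference_off_event[OF _ _ _ close])
      show "integrable M (\<lambda>\<omega>. \<phi> (walk_volume n \<omega>))" "integrable M (\<lambda>\<omega>. \<phi> (grid_volume J (block_increments J n \<omega>)))"
        using B by (auto intro!: integrable_const_bound[of _ B])
      show "A1 \<union> A2 \<in> events" using A1m A2m by blast
      show "\<bar>\<phi> (walk_volume n \<omega>) - \<phi> (grid_volume J (block_increments J n \<omega>))\<bar> \<le> 2 * B" for \<omega>
        using B[of "walk_volume n \<omega>"] B[of "grid_volume J (block_increments J n \<omega>)"] by linarith
    qed (use eps in auto)
    also have "\<dots> \<le> \<epsilon> / 6 + 2 * B * (2 * \<eta>)" using P B0 by (intro add_left_mono mult_left_mono) auto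
    also have "\<dots> \<le> \<epsilon> / 6 + \<epsilon> / 6" using eta2 by simp
    finally show ?case using elim(2) J(2) unfolding real_norm_def by linarith
  qed
  then show "\<exists>no. \<forall>n\<ge>no. norm (expectation (\<lambda>\<omega>. \<phi> (walk_volume n \<omega>)) - (\<integral>\<omega>. \<phi> (limit_volume \<omega>) \<partial>N)) < \<epsilon>"
    by (simp add: eventually_sequentially)
qed

text \<open>On a ball of radius \<open>R\<close> the volume is at most a multiple of
  \<open>R ^ m\<close>, whose power \<open>q / m\<close> is \<open>R powr q\<close>. The radius is a
  constant plus the maximum divided by \<open>sqrt n\<close>, so the moment bound for the maximum
  applies uniformly in \<open>n\<close>.\<close>

lemma walk_volume_moment:
  assumes q: "q \<ge> 2" "q > real m" and int: "integrable M (\<lambda>\<omega>. norm (\<xi> 1 \<omega>) powr q)"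
  obtains B where "\<And>n. n \<ge> 1 \<Longrightarrow> integrable M (\<lambda>\<omega>. \<bar>walk_volume n \<omega>\<bar> powr (q / real m))"
    "\<And>n. n \<ge> 1 \<Longrightarrow> expectation (\<lambda>\<omega>. \<bar>walk_volume n \<omega>\<bar> powr (q / real m)) \<le> B"
proof -
  obtain C' where C': "C' \<ge> 0" "\<And>n. integrable M (\<lambda>\<omega>. maxW n \<omega> powr q)"
    "\<And>n. expectation (\<lambda>\<omega>. maxW n \<omega> powr q) \<le> C' * real n powr (q / 2)"
    by (rule maxW_moment_bound[OF q(1) int]) (rule that)
  obtain D where D: "D \<ge> 0" "\<And>(K::(real ^ 'n) set) R. convex_body K \<Longrightarrow> R > 0 \<Longrightarrow> K \<subseteq> cball 0 R \<Longrightarrow> \<bar>intrinsic_volume m K\<bar> \<le> D * R ^ m"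
    by (rule intrinsic_volume_bound[OF dim_m]) (rule that)
  define r where "r = q / real m"
  have m0: "real m > 0" using m by simp
  have r: "r > 0" using q m0 by (simp add: r_def)
  define u where "u = 1 + norm \<mu>"
  have u: "u > 0" by (simp add: u_def add_pos_nonneg)
  define B where "B = D powr r * ((2 * u) powr q + 4 powr q * C')"
  have pw: "(R ^ m) powr r = R powr q" if "R > 0" for R :: real
    using that m0 by (simp add: r_def powr_powr flip: powr_realpow)
  have bound: "\<bar>walk_volume n \<omega>\<bar> powr r \<le> D powr r * ((2 * u) powr q + 4 powr q * real n powr (- (q / 2)) * maxW n \<omega> powr q)"
    if n: "n \<ge> 1" for n \<omega>
  proof -
    define v where "v = 2 * (maxW n \<omega> / sqrt (real n))"
    have v: "v \<ge> 0" using maxW_nonneg[of n \<omega>] by (simp add: v_def)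
    have sub: "convex hull ((\<lambda>k. walk_point n k \<omega>) ` {..n}) \<subseteq> cball 0 (u + v)"
    proof (rule hull_minimal)
      show "(\<lambda>k. walk_point n k \<omega>) ` {..n} \<subseteq> cball 0 (u + v)"
      proof
        fix x assume "x \<in> (\<lambda>k. walk_point n k \<omega>) ` {..n}"
        then obtain k where "k \<le> n" "x = walk_point n k \<omega>" by auto
        then show "x \<in> cball 0 (u + v)" using walk_point_norm[of n k \<omega>] n by (simp add: u_def v_def)
      qed
    qed simp
    have "\<bar>walk_volume n \<omega>\<bar> \<le> D * (u + v) ^ m"
      unfolding walk_volume_def using u v
      by (intro D(2) convex_body_hull sub) (auto intro: finite_imp_compact)
    then have "\<bar>walk_volume n \<omega>\<bar> powr r \<le> (D * (u + v) ^ m) powr r" using r by (intro powr_mono2) auto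
    also have "\<dots> = D powr r * (u + v) powr q" using D u v by (simp add: powr_mult pw)
    \<comment> \<open>A sum is at most twice the larger summand.\<close>
    also have "(u + v) powr q \<le> (2 * u) powr q + (2 * v) powr q"
    proof (cases "v \<le> u")
      case True
      then have "(u + v) powr q \<le> (2 * u) powr q" using u v q by (intro powr_mono2) auto
      then show ?thesis by (simp add: add_increasing2)
    next
      case False
      then have "(u + v) powr q \<le> (2 * v) powr q" using u v q by (intro powr_mono2) auto
      then show ?thesis by (simp add: add_increasing)
    qed
    also have "(2 * v) powr q = 4 powr q * real n powr (- (q / 2)) * maxW n \<omega> powr q"
    proof -
      have "2 * v = 4 * (inverse (sqrt (real n)) * maxW n \<omega>)" by (simp add: v_def divide_inverse)
      moreover have "inverse (sqrt (real n)) powr q = real n powr (- (q / 2))"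
        using n by (simp add: powr_powr powr_minus inverse_powr flip: powr_half_sqrt)
      ultimately show ?thesis using maxW_nonneg[of n \<omega>] by (simp add: powr_mult)
    qed
    finally show ?thesis by (simp add: mult_left_mono)
  qed
  have dom: "integrable M (\<lambda>\<omega>. D powr r * ((2 * u) powr q + 4 powr q * real n powr (- (q / 2)) * maxW n \<omega> powr q))" for n
    using C'(2)[of n] by simp
  have int: "integrable M (\<lambda>\<omega>. \<bar>walk_volume n \<omega>\<bar> powr r)" if n: "n \<ge> 1" for n
    by (rule Bochner_Integration.integrable_bound[OF dom[of n]])
      (auto intro!: AE_I2 order_trans[OF bound[OF n]] simp del: powr_minus)
  have "expectation (\<lambda>\<omega>. \<bar>walk_volume n \<omega>\<bar> powr r) \<le> B" if n: "n \<ge> 1" for n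
  proof -
    have "expectation (\<lambda>\<omega>. \<bar>walk_volume n \<omega>\<bar> powr r) \<le>
      expectation (\<lambda>\<omega>. D powr r * ((2 * u) powr q + 4 powr q * real n powr (- (q / 2)) * maxW n \<omega> powr q))"
      by (rule integral_mono[OF int[OF n] dom bound[OF n]])
    also have "\<dots> = D powr r * ((2 * u) powr q + 4 powr q * real n powr (- (q / 2)) * expectation (\<lambda>\<omega>. maxW n \<omega> powr q))"
      using C'(2)[of n] by (simp add: prob_space)
    also have "\<dots> \<le> D powr r * ((2 * u) powr q + 4 powr q * real n powr (- (q / 2)) * (C' * real n powr (q / 2)))"
      by (intro mult_left_mono add_left_mono C') auto
    also have "real n powr (- (q / 2)) * real n powr (q / 2) = 1" using n by (simp flip: powr_add)
    then have "4 powr q * real n powr (- (q / 2)) * (C' * real n powr (q / 2)) = 4 powr q * C'"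
      by (metis (no_types, lifting) mult.assoc mult.left_commute mult_1_right)
    then have "D powr r * ((2 * u) powr q + 4 powr q * real n powr (- (q / 2)) * (C' * real n powr (q / 2))) = B"
      by (simp add: B_def)
    finally show ?thesis .
  qed
  then show thesis using that int unfolding r_def by blast
qed

theorem volume_expectation_convergence:
  assumes q: "q \<ge> 2" "q > real m" and int: "integrable M (\<lambda>\<omega>. norm (\<xi> 1 \<omega>) powr q)"
  shows "integrable N limit_volume" "\<And>n. n \<ge> 1 \<Longrightarrow> integrable M (walk_volume n)"
    "(\<lambda>n. expectation (walk_volume n)) \<longlonglongrightarrow> (\<integral>\<omega>. limit_volume \<omega> \<partial>N)"
proof -
  obtain B where B: "\<And>n. n \<ge> 1 \<Longrightarrow> integrable M (\<lambda>\<omega>. \<bar>walk_volume n \<omega>\<bar> powr (q / real m))"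
    "\<And>n. n \<ge> 1 \<Longrightarrow> expectation (\<lambda>\<omega>. \<bar>walk_volume n \<omega>\<bar> powr (q / real m)) \<le> B"
    by (rule walk_volume_moment[OF assms]) (rule that)
  have r: "q / real m > 1" using q m by (simp add: less_divide_eq)
  note * = expectation_tendsto_of_weak_convergence[OF prob_space_axioms prob_space_N r walk_volume_measurable limit_volume_measurable B
    walk_volume_weak_convergence]
  show "integrable N limit_volume" by (rule *(1))
  show "\<And>n. n \<ge> 1 \<Longrightarrow> integrable M (walk_volume n)" by (rule *(2))
  show "(\<lambda>n. expectation (walk_volume n)) \<longlonglongrightarrow> (\<integral>\<omega>. limit_volume \<omega> \<partial>N)" by (rule *(3))
qed

end

text \<open>Passing to coordinates in an orthonormal basis preserves volume, and the diagonal
  scaling has determinant \<open>1/n\<close> times \<open>(1 / sqrt n) ^ (d - 1)\<close>, that is,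
  \<open>n\<close> to the power \<open>-(d + 1)/2\<close>.\<close>

lemma scaling_matrix_volume:
  fixes K :: "(real ^ 'n) set"
  assumes e: "orthonormal_basis e" and K: "convex_body K" and n: "n \<ge> 1"
  shows "intrinsic_volume CARD('n) ((\<lambda>x. scaling_matrix a n *v coordinates e x) ` K) =
    real n powr (- ((real CARD('n) + 1) / 2)) * intrinsic_volume CARD('n) K"
proof -
  define c where "c b = (if b = axis a 1 then 1 / real n else 1 / sqrt (real n))" for b :: "real ^ 'n"
  have D: "scaling_matrix a n *v x = (\<Sum>b\<in>Basis. (c b * (x \<bullet> b)) *\<^sub>R b)" for x
  proof (rule euclidean_eqI)
    fix b :: "real ^ 'n" assume b: "b \<in> Basis"
    then obtain i where i: "b = axis i 1" by (auto simp: Basis_vec_def)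
    have "(scaling_matrix a n *v x) \<bullet> b = c b * (x \<bullet> b)"
      unfolding scaling_matrix_mult i by (simp add: inner_axis c_def axis_eq_axis)
    then show "(scaling_matrix a n *v x) \<bullet> b = (\<Sum>b\<in>Basis. (c b * (x \<bullet> b)) *\<^sub>R b) \<bullet> b"
      using b by (simp only: inner_sum_left_Basis)
  qed
  have cpos: "c b > 0" for b using n by (simp add: c_def)
  have lin: "linear (\<lambda>x. scaling_matrix a n *v coordinates e x)"
    using linear_compose[OF linear_coordinates matrix_vector_mul_linear] by (simp add: comp_def)
  have K': "compact K" "convex K" "K \<noteq> {}" using K by (auto simp: convex_body_def)
  have body: "convex_body (f ` K)" if "linear f" for f :: "real ^ 'n \<Rightarrow> real ^ 'n"
    unfolding convex_body_def using K' that
    by (auto intro!: compact_continuous_image convex_linear_image linear_continuous_on simp: linear_conv_bounded_linear)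
  have CK: "coordinates e ` K \<in> sets borel"
    using body[OF linear_coordinates] by (auto simp: convex_body_def intro!: borel_compact)
  \<comment> \<open>The drift axis is taken out of the product; the remaining
    \<open>CARD('n) - 1\<close> factors are equal.\<close>
  have "(\<Prod>b\<in>Basis. c b) = c (axis a 1) * (\<Prod>b\<in>Basis - {axis a 1}. c b)"
    by (rule prod.remove) auto
  also have "(\<Prod>b\<in>Basis - {axis a 1}. c b) = (\<Prod>b\<in>Basis - {axis a 1 :: real ^ 'n}. 1 / sqrt (real n))"
    by (intro prod.cong) (auto simp: c_def)
  also have "\<dots> = (1 / sqrt (real n)) ^ (CARD('n) - 1)" by simp
  also have "c (axis a 1) * (1 / sqrt (real n)) ^ (CARD('n) - 1) = real n powr (- ((real CARD('n) + 1) / 2))"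
  proof -
    have "1 / sqrt (real n) = real n powr (- (1 / 2))" using n by (simp add: powr_minus_divide powr_half_sqrt)
    then have "(1 / sqrt (real n)) ^ (CARD('n) - 1) = real n powr (- (1 / 2) * (real CARD('n) - 1))"
      using n by (simp add: powr_powr of_nat_diff Suc_leI flip: powr_realpow)
    moreover have "1 / real n = real n powr (- 1)" using n by (simp add: powr_minus_divide)
    ultimately have "c (axis a 1) * (1 / sqrt (real n)) ^ (CARD('n) - 1) = real n powr (- 1 + - (1 / 2) * (real CARD('n) - 1))"
      by (simp only: c_def powr_add) simp
    also have "- 1 + - (1 / 2) * (real CARD('n) - 1) = - ((real CARD('n) + 1) / 2)" by (simp add: field_simps)
    finally show ?thesis .
  qed
  finally have prod: "(\<Prod>b\<in>Basis. c b) = real n powr (- ((real CARD('n) + 1) / 2))" .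
  have top: "intrinsic_volume CARD('n) L = measure lborel L" if "convex_body L" for L :: "(real ^ 'n) set"
    using intrinsic_volume_top[OF that] by simp
  have "measure lborel ((\<lambda>x. scaling_matrix a n *v coordinates e x) ` K) =
    measure lborel ((\<lambda>x. \<Sum>b\<in>Basis. (c b * (x \<bullet> b)) *\<^sub>R b) ` coordinates e ` K)"
    by (simp add: D image_image)
  also have "\<dots> = (\<Prod>b\<in>Basis. c b) * measure lborel (coordinates e ` K)"
    by (rule lborel_diagonal_image[OF cpos CK])
  also have "measure lborel (coordinates e ` K) = measure lborel K"
    using K' by (intro lborel_isometric_image linear_coordinates norm_coordinates e borel_compact)
  finally show ?thesis unfolding top[OF body[OF lin]] top[OF K] prod .
qed

theorem theorem3p9:
  fixes M :: "'w measure" and N :: "'v measure"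
    and Y :: "nat \<Rightarrow> 'w \<Rightarrow> real ^ 'n"
    and X :: "real \<Rightarrow> 'v \<Rightarrow> real ^ 'n"
    and e :: "'n \<Rightarrow> real ^ 'n" and a :: 'n
    and \<mu> :: "real ^ 'n" and m :: nat and p :: real
  assumes m: "1 \<le> m" "m \<le> CARD('n)"
    and M: "prob_space M"
    and indep: "prob_space.indep_vars M (\<lambda>_. borel) Y {1..}"
    and ident: "\<And>i. i \<ge> 1 \<Longrightarrow> distr M borel (Y i) = distr M borel (Y 1)"
    and mu: "\<mu> = integral\<^sup>L M (Y 1)" "\<mu> \<noteq> 0"
    and p: "p > 1"
    and moment: "integrable M (\<lambda>\<omega>. norm (Y 1 \<omega>) powr max 2 (real m * p))"
    and basis: "orthonormal_basis e" "e a = \<mu> /\<^sub>R norm \<mu>"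
    and X: "brownian_motion N (covariance_matrix M (Y 1)) X"
  shows "integrable N (\<lambda>\<omega>. intrinsic_volume m (limit_hull a e \<mu> X \<omega>))
    \<and> (\<forall>n\<ge>1. integrable M (\<lambda>\<omega>. intrinsic_volume m (scaled_walk_hull a e Y n \<omega>)))
    \<and> (\<lambda>n. \<integral>\<omega>. intrinsic_volume m (scaled_walk_hull a e Y n \<omega>) \<partial>M)
        \<longlonglongrightarrow> (\<integral>\<omega>. intrinsic_volume m (limit_hull a e \<mu> X \<omega>) \<partial>N)
    \<and> (m = CARD('n) \<longrightarrow>
        (\<forall>n\<ge>1. integrable M (\<lambda>\<omega>. intrinsic_volume CARD('n) (walk_hull Y n \<omega>)))
        \<and> (\<lambda>n. (\<integral>\<omega>. intrinsic_volume CARD('n) (walk_hull Y n \<omega>) \<partial>M)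
              / real n powr ((real CARD('n) + 1) / 2))
            \<longlonglongrightarrow> (\<integral>\<omega>. intrinsic_volume CARD('n) (limit_hull a e \<mu> X \<omega>) \<partial>N))"
proof -
  interpret P: prob_space M by fact
  define q where "q = max 2 (real m * p)"
  have q2: "q \<ge> 2" by (simp add: q_def)
  have qm: "q > real m"
  proof (cases "m = 1")
    case False
    then have "real m * 1 < real m * p" using m p by (intro mult_strict_left_mono) auto
    then show ?thesis by (simp add: q_def)
  qed (simp add: q_def)
  have Ym: "Y i \<in> borel_measurable M" if "i \<ge> 1" for i
    using indep that by (auto simp: P.indep_vars_def2)
  have Y1[measurable]: "Y 1 \<in> borel_measurable M" by (rule Ym) simp
  have intq: "integrable M (\<lambda>\<omega>. norm (Y 1 \<omega>) powr q)" using moment by (simp add: q_def)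
  have Yint: "integrable M (Y 1)"
  proof (rule Bochner_Integration.integrable_bound)
    show "integrable M (\<lambda>\<omega>. 1 + norm (Y 1 \<omega>) powr q)" using intq by simp
    have "norm y \<le> 1 + norm y powr q" for y :: "real ^ 'n"
      using powr_le_one_plus[of "norm y" 1 q] q2 by simp
    then show "AE \<omega> in M. norm (Y 1 \<omega>) \<le> norm (1 + norm (Y 1 \<omega>) powr q)"
      by (auto intro!: AE_I2 order_trans[OF _ abs_ge_self])
  qed (rule Y1)
  define \<xi> where "\<xi> i \<omega> = Y i \<omega> - \<mu>" for i \<omega>
  have xi1[measurable]: "\<xi> 1 \<in> borel_measurable M" unfolding \<xi>_def by measurable
  have xiq: "integrable M (\<lambda>\<omega>. norm (\<xi> 1 \<omega>) powr q)"
  proof (rule Bochner_Integration.integrable_bound)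
    show "integrable M (\<lambda>\<omega>. 2 powr q * norm (Y 1 \<omega>) powr q + 2 powr q * norm \<mu> powr q)" using intq by simp
    have "norm (y - \<mu>) powr q \<le> 2 powr q * norm y powr q + 2 powr q * norm \<mu> powr q" for y :: "real ^ 'n"
    proof -
      have "norm (y - \<mu>) \<le> 2 * max (norm y) (norm \<mu>)" using norm_triangle_ineq4[of y \<mu>] by linarith
      then have "norm (y - \<mu>) powr q \<le> (2 * max (norm y) (norm \<mu>)) powr q" using q2 by (intro powr_mono2) auto
      also have "\<dots> = 2 powr q * max (norm y) (norm \<mu>) powr q" by (simp add: powr_mult)
      also have "max (norm y) (norm \<mu>) powr q \<le> norm y powr q + norm \<mu> powr q" by (simp add: max_def)
      finally show ?thesis by (simp add: distrib_left)
    qed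
    then show "AE \<omega> in M. norm (norm (\<xi> 1 \<omega>) powr q) \<le> norm (2 powr q * norm (Y 1 \<omega>) powr q + 2 powr q * norm \<mu> powr q)"
      unfolding \<xi>_def by (auto intro!: AE_I2 order_trans[OF _ abs_ge_self])
  qed measurable
  have xi2: "integrable M (\<lambda>\<omega>. (norm (\<xi> 1 \<omega>))\<^sup>2)"
  proof (rule Bochner_Integration.integrable_bound)
    show "integrable M (\<lambda>\<omega>. 1 + norm (\<xi> 1 \<omega>) powr q)" using xiq by simp
    have "(norm y)\<^sup>2 \<le> 1 + norm y powr q" for y :: "real ^ 'n"
      using powr_le_one_plus[of "norm y" 2 q] q2 by simp
    then show "AE \<omega> in M. norm ((norm (\<xi> 1 \<omega>))\<^sup>2) \<le> norm (1 + norm (\<xi> 1 \<omega>) powr q)"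
      by (auto intro!: AE_I2 order_trans[OF _ abs_ge_self])
  qed measurable
  interpret centered_walk M \<xi>
  proof
    show "P.indep_vars (\<lambda>_. borel) \<xi> {1..}"
      unfolding \<xi>_def by (rule P.indep_vars_compose2[OF indep, where Y="\<lambda>_ x. x - \<mu>"]) auto
    show "distr M borel (\<xi> i) = distr M borel (\<xi> 1)" if "i \<ge> 1" for i
    proof -
      have "distr M borel (\<xi> j) = distr (distr M borel (Y j)) borel (\<lambda>x. x - \<mu>)" if "j \<ge> 1" for j
        using Ym[OF that] by (subst distr_distr) (auto simp: \<xi>_def[abs_def] comp_def)
      then show ?thesis using ident[OF that] that by simp
    qed
    show "integrable M (\<lambda>\<omega>. (norm (\<xi> 1 \<omega>))\<^sup>2)" by (rule xi2)
    show "P.expectation (\<xi> 1) = 0" unfolding \<xi>_def using Yint by (simp add: mu(1) P.prob_space)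
  qed
  \<comment> \<open>The quadratic form of the covariance matrix is the variance of a projection;
    entrywise integrability follows from the square of the norm, which dominates each product of two
    coordinates.\<close>
  have cov: "v \<bullet> (covariance_matrix M (Y 1) *v v) = P.expectation (\<lambda>\<omega>. (v \<bullet> \<xi> 1 \<omega>)\<^sup>2)" for v
  proof -
    have prod_int: "integrable M (\<lambda>\<omega>. \<xi> 1 \<omega> $ i * \<xi> 1 \<omega> $ j)" for i j
    proof (rule Bochner_Integration.integrable_bound[OF xi2])
      have "\<bar>y $ i * y $ j\<bar> \<le> (norm y)\<^sup>2" for y :: "real ^ 'n"
        unfolding abs_mult power2_eq_square by (intro mult_mono component_le_norm_cart) auto
      then show "AE \<omega> in M. norm (\<xi> 1 \<omega> $ i * \<xi> 1 \<omega> $ j) \<le> norm ((norm (\<xi> 1 \<omega>))\<^sup>2)" by simp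
    qed measurable
    have Cij: "covariance_matrix M (Y 1) $ i $ j = P.expectation (\<lambda>\<omega>. \<xi> 1 \<omega> $ i * \<xi> 1 \<omega> $ j)" for i j
      by (simp add: covariance_matrix_def \<xi>_def mu(1))
    have "P.expectation (\<lambda>\<omega>. (v \<bullet> \<xi> 1 \<omega>)\<^sup>2) = P.expectation (\<lambda>\<omega>. \<Sum>i\<in>UNIV. \<Sum>j\<in>UNIV. v $ i * v $ j * (\<xi> 1 \<omega> $ i * \<xi> 1 \<omega> $ j))"
      by (simp add: power2_eq_square inner_vec_def sum_product mult_ac)
    also have "\<dots> = (\<Sum>i\<in>UNIV. \<Sum>j\<in>UNIV. v $ i * v $ j * P.expectation (\<lambda>\<omega>. \<xi> 1 \<omega> $ i * \<xi> 1 \<omega> $ j))"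
      using prod_int by (simp add: Bochner_Integration.integral_sum)
    also have "\<dots> = v \<bullet> (covariance_matrix M (Y 1) *v v)"
      by (simp add: inner_vec_def matrix_vector_mult_def Cij sum_distrib_left mult_ac del: One_nat_def)
    finally show ?thesis by simp
  qed
  interpret drifted_walk M \<xi> N X "covariance_matrix M (Y 1)" a e \<mu> m
  proof
    show "\<mu> = norm \<mu> *\<^sub>R e a" using basis(2) mu(2) by simp
  qed (use X cov basis m in auto)
  have walk: "random_walk Y k \<omega> = W k \<omega> + real k *\<^sub>R \<mu>" for k \<omega>
    by (simp add: random_walk_def W_def \<xi>_def sum_subtractf atLeastSucAtMost_greaterThanAtMost sum_constant_scaleR del: sum_constant)
  have lin: "linear (\<lambda>x. scaling_matrix a n *v coordinates e x)" for n
    using linear_compose[OF linear_coordinates matrix_vector_mul_linear] by (simp add: comp_def)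
  have scaled: "intrinsic_volume m (scaled_walk_hull a e Y n \<omega>) = walk_volume n \<omega>" for n \<omega>
    unfolding scaled_walk_hull_def walk_hull_def walk_volume_def walk_point_def convex_hull_linear_image[OF lin] image_image
    by (simp add: walk atLeast0AtMost)
  have limit: "intrinsic_volume m (limit_hull a e \<mu> X \<omega>) = limit_volume \<omega>" if "\<omega> \<in> space N" for \<omega>
  proof -
    have path: "drift_process a e \<mu> X t \<omega> = path t \<omega>" for t
      by (simp add: drift_process_def path_def spacetime_def)
    have "compact ((\<lambda>t. path t \<omega>) ` {0..1})" by (intro compact_continuous_image continuous_path that) simp
    then have "closure ((\<lambda>t. path t \<omega>) ` {0..1}) = (\<lambda>t. path t \<omega>) ` {0..1}" by (simp add: compact_imp_closed)
    then show ?thesis by (simp add: limit_hull_def path limit_volume_def)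
  qed
  note conv = volume_expectation_convergence[OF q2 qm xiq]
  have A: "integrable N (\<lambda>\<omega>. intrinsic_volume m (limit_hull a e \<mu> X \<omega>))"
    using conv(1) by (simp add: limit cong: Bochner_Integration.integrable_cong)
  have lim_eq: "(\<integral>\<omega>. intrinsic_volume m (limit_hull a e \<mu> X \<omega>) \<partial>N) = (\<integral>\<omega>. limit_volume \<omega> \<partial>N)"
    by (intro Bochner_Integration.integral_cong) (auto simp: limit)
  have B: "integrable M (\<lambda>\<omega>. intrinsic_volume m (scaled_walk_hull a e Y n \<omega>))" if "n \<ge> 1" for n
    unfolding scaled using conv(2)[OF that] .
  have L: "(\<lambda>n. \<integral>\<omega>. intrinsic_volume m (scaled_walk_hull a e Y n \<omega>) \<partial>M)
        \<longlonglongrightarrow> (\<integral>\<omega>. intrinsic_volume m (limit_hull a e \<mu> X \<omega>) \<partial>N)"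
    unfolding scaled lim_eq by (rule conv(3))
  have top: "(\<forall>n\<ge>1. integrable M (\<lambda>\<omega>. intrinsic_volume CARD('n) (walk_hull Y n \<omega>)))
        \<and> (\<lambda>n. (\<integral>\<omega>. intrinsic_volume CARD('n) (walk_hull Y n \<omega>) \<partial>M) / real n powr ((real CARD('n) + 1) / 2))
            \<longlonglongrightarrow> (\<integral>\<omega>. intrinsic_volume CARD('n) (limit_hull a e \<mu> X \<omega>) \<partial>N)" if md: "m = CARD('n)"
  proof -
    \<comment> \<open>The reciprocal of the determinant of the scaling. It vanishes at
      \<open>n = 0\<close>, so the two sequences are identified only from 1 on.\<close>
    define s where "s n = real n powr ((real CARD('n) + 1) / 2)" for n
    have s: "s n > 0" if "n \<ge> 1" for n using that by (simp add: s_def)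
    have vol: "intrinsic_volume m (walk_hull Y n \<omega>) = s n * intrinsic_volume m (scaled_walk_hull a e Y n \<omega>)"
      if n: "n \<ge> 1" for n \<omega>
    proof -
      have "convex_body (walk_hull Y n \<omega>)"
        unfolding walk_hull_def by (intro convex_body_hull finite_imp_compact) auto
      from scaling_matrix_volume[OF basis(1) this n, of a]
      have "intrinsic_volume m (scaled_walk_hull a e Y n \<omega>) = real n powr (- ((real CARD('n) + 1) / 2)) * intrinsic_volume m (walk_hull Y n \<omega>)"
        by (simp add: md scaled_walk_hull_def)
      also have "real n powr (- ((real CARD('n) + 1) / 2)) = 1 / s n" by (simp only: s_def powr_minus_divide)
      finally show ?thesis using s[OF n] by simp
    qed
    have int: "integrable M (\<lambda>\<omega>. intrinsic_volume m (walk_hull Y n \<omega>))" if "n \<ge> 1" for n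
      unfolding vol[OF that] using B[OF that] by simp
    have "(\<integral>\<omega>. intrinsic_volume m (scaled_walk_hull a e Y n \<omega>) \<partial>M) = (\<integral>\<omega>. intrinsic_volume m (walk_hull Y n \<omega>) \<partial>M) / s n"
      if "n \<ge> 1" for n
      unfolding vol[OF that] using s[OF that] by simp
    then have "\<forall>\<^sub>F n in sequentially. (\<integral>\<omega>. intrinsic_volume m (scaled_walk_hull a e Y n \<omega>) \<partial>M) =
      (\<integral>\<omega>. intrinsic_volume m (walk_hull Y n \<omega>) \<partial>M) / s n"
      by (intro eventually_sequentiallyI[of 1])
    from Lim_transform_eventually[OF L this]
    show ?thesis using int unfolding md[symmetric] s_def by simp
  qed
  show ?thesis using A B L top by blast
qed

end
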